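(* Let $\alpha<1$ and $\beta<1$ satisfy $|\rho|<1$, $x\in\mathbb{R}$, let $b,\sigma:\mathbb{R}\to\mathbb{R}$ be Lipschitz continuous with $|\sigma(y)|>0$ for all $y\in\mathbb{R}$, and let $(X_t)_{t\ge0}$ be the unique solution of $$X_t=x+\int_0^t\sigma(X_s)\,dW_s+\int_0^t b(X_s)\,ds+\alpha\max_{0\le s\le t}X_s+\beta\min_{0\le s\le t}X_s.$$ Then for every $t>0$ the law of $X_t$ is absolutely continuous with respect to Lebesgue measure on $\mathbb{R}$.
   Context: $W$ is a standard one-dimensional Brownian motion on the canonical Wiener space with its completed natural filtration; $\rho=\frac{\alpha\beta}{(1-\alpha)(1-\beta)}$. The equation has a unique continuous adapted strong solution under these assumptions. *)

theory Defs
  imports "HOL-Probability.Probability"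
begin

definition rho :: "real \<Rightarrow> real \<Rightarrow> real" where
  "rho \<alpha> \<beta> = \<alpha> * \<beta> / ((1 - \<alpha>) * (1 - \<beta>))"

definition brownian_motion :: "'a measure \<Rightarrow> (real \<Rightarrow> 'a \<Rightarrow> real) \<Rightarrow> bool" where
  "brownian_motion M W \<longleftrightarrow>
     (\<forall>t\<ge>0. W t \<in> borel_measurable M) \<and>
     (\<forall>\<omega>\<in>space M. W 0 \<omega> = 0) \<and>
     (\<forall>\<omega>\<in>space M. continuous_on {0..} (\<lambda>t. W t \<omega>)) \<and>
     (\<forall>s t. 0 \<le> s \<and> s < t \<longrightarrow>
        distributed M lborel (\<lambda>\<omega>. W t \<omega> - W s \<omega>) (normal_density 0 (sqrt (t - s)))) \<and>
     (\<forall>(n::nat) (u::nat \<Rightarrow> real). 0 \<le> u 0 \<and> strict_mono u \<longrightarrow>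
        prob_space.indep_vars M (\<lambda>_. borel) (\<lambda>i \<omega>. W (u (Suc i)) \<omega> - W (u i) \<omega>) {..<n})"

definition nat_filtration :: "'a measure \<Rightarrow> (real \<Rightarrow> 'a \<Rightarrow> real) \<Rightarrow> real \<Rightarrow> 'a measure" where
  "nat_filtration M W s = sigma (space M)
     ({W r -` B \<inter> space M | r B. 0 \<le> r \<and> r \<le> s \<and> B \<in> sets borel} \<union> null_sets M)"

definition ito_sum :: "(real \<Rightarrow> 'a \<Rightarrow> real) \<Rightarrow> (real \<Rightarrow> 'a \<Rightarrow> real) \<Rightarrow> real \<Rightarrow> nat \<Rightarrow> 'a \<Rightarrow> real" where
  "ito_sum W Y t n \<omega> =
     (\<Sum>k<2^n. Y (t * real k / 2^n) \<omega> * (W (t * real (Suc k) / 2^n) \<omega> - W (t * real k / 2^n) \<omega>))"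

text \<open>I is (a version of) the Ito integral of the continuous adapted process Y
  over [0,t]: the limit in probability of the left-point Riemann sums.\<close>
definition is_ito_integral ::
    "'a measure \<Rightarrow> (real \<Rightarrow> 'a \<Rightarrow> real) \<Rightarrow> (real \<Rightarrow> 'a \<Rightarrow> real) \<Rightarrow> real \<Rightarrow> ('a \<Rightarrow> real) \<Rightarrow> bool" where
  "is_ito_integral M W Y t I \<longleftrightarrow>
     I \<in> borel_measurable M \<and>
     (\<forall>\<epsilon>>0. (\<lambda>n. measure M {\<omega>\<in>space M. \<bar>ito_sum W Y t n \<omega> - I \<omega>\<bar> > \<epsilon>}) \<longlonglongrightarrow> 0)"

end

theory Submission imports Defs begin

text \<open>Put \<open>U t = X t - \<alpha> * M t - \<beta> * m t\<close>, where \<open>M\<close> and \<open>m\<close> are the running maximum and minimum of \<open>X\<close>; this is an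
  Ito process with coefficients \<open>\<sigma> (X t)\<close> and \<open>b (X t)\<close>. At a time \<open>T\<close> at which \<open>X\<close> is at neither extremum, both
  extrema have been constant since some \<open>s < T\<close>, so that \<open>X T = U T + \<alpha> * M s + \<beta> * m s\<close>; if \<open>X T = M T\<close>, then
  \<open>(1 - \<alpha>) * X T = U T + \<beta> * m s\<close>, and similarly at the minimum. Hence it suffices that \<open>U T + S\<close> avoids
  null sets almost surely for every \<open>S\<close> that is measurable at a time \<open>s < T\<close>.

  This is shown by multiscale comparison. Over the last \<open>T / 256 ^ k\<close> units of time, \<open>U\<close> moves by a Gaussian
  of standard deviation of order \<open>16 ^ - k\<close>, up to an error that is \<open>O(64 ^ - k)\<close> off a small event, because
  \<open>X\<close> oscillates by at most \<open>8 ^ - k\<close>: the condition on \<open>rho\<close> bounds the oscillation of \<open>X\<close> by that of \<open>U\<close>. A test function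
  that is an average over a window of length \<open>32 ^ - k\<close> is Lipschitz enough to ignore the error, while the
  Gaussian does not feel a shift by \<open>32 ^ - k\<close>. Refining the window from scale \<open>k\<close> to \<open>k + 1\<close> therefore changes the
  expectation by \<open>O(2 ^ - k)\<close>, and summing up, \<open>P(U T + S \<in> V) \<le> 32 ^ k * measure V + O(2 ^ - k)\<close> for open \<open>V\<close>
  and all large \<open>k\<close>, up to an arbitrarily small localization error.\<close>

section \<open>Increments of Brownian motion and the completed natural filtration\<close>

text \<open>The ratios of the scales are forced. The time step 256 ^ - k gives standard deviation 16
  ^ - k; Chebyshev at level 8 ^ - k leaves probability 4 ^ - k for a large oscillation; freezing
  \<sigma> then costs 128 ^ - k in standard deviation, which is below 64 ^ - k off an event of
  probability O(4 ^ - k); the window 32 ^ - k lies a factor 2 ^ k above that error and a factor 2 ^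
  k below the Gaussian. All are powers of two, so that every time involved is a dyadic fraction of
  \<open>T\<close>.

  Two obstacles shape the rest. The integral is known only as a limit in probability of left-point
  sums at each fixed time, on grids that do not fit together for different times: isometry and
  maximal inequality are therefore proved for discrete sums and carried to the limit. And the scales
  can be telescoped only under one fixed event, \<open>Good\<close>, which depends on the path up to
  \<open>T\<close>, while the Gaussian estimate at scale k needs an event known at time
  \<open>tm T k\<close>; each step exchanges \<open>Good\<close> for \<open>good k\<close> and pays
  O(4 ^ - k).\<close>

lemma increasing_indexing:
  fixes J :: "real set"
  assumes "finite J" "J \<subseteq> {0..s}" "0 \<le> s" "s < r"
  obtains u :: "nat \<Rightarrow> real" and n where "u 0 = 0" "strict_mono u" "u n = s" "u (Suc n) = r" "J \<subseteq> u ` {..n}"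
proof -
  define xs where "xs = sorted_list_of_set (insert 0 (insert s J))"
  have fin: "finite (insert 0 (insert s J))" using assms by auto
  have set: "set xs = insert 0 (insert s J)" unfolding xs_def using fin by (rule set_sorted_list_of_set)
  have sorted: "sorted_wrt (<) xs" unfolding xs_def by simp
  obtain n where n: "length xs = Suc n"
    using set by (cases xs) auto
  \<comment> \<open>Past the list the sequence goes on with \<open>r\<close>, \<open>r + 1\<close>,
    ...: independence of increments is postulated for infinite strictly increasing
    sequences.\<close>
  define u where "u i = (if i \<le> n then xs ! i else r + real (i - Suc n))" for i
  have le: "xs ! i \<le> s" if "i \<le> n" for i
  proof -
    have "xs ! i \<in> set xs" using that n by auto
    then show ?thesis using set assms by auto
  qed
  have ge: "xs ! i \<ge> 0" if "i \<le> n" for i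
  proof -
    have "xs ! i \<in> set xs" using that n by auto
    then show ?thesis using set assms by auto
  qed
  have mono: "xs ! i < xs ! j" if "i < j" "j \<le> n" for i j
    using sorted that n by (auto simp: sorted_wrt_iff_nth_less)
  have "u i < u (Suc i)" for i
    using mono[of i "Suc i"] le[of i] \<open>s < r\<close> by (auto simp: u_def)
  then have sm: "strict_mono u" by (simp add: strict_mono_Suc_iff)
  have im: "set xs = u ` {..n}"
    using n by (auto simp: u_def in_set_conv_nth image_iff less_Suc_eq_le Bex_def)
  have smle: "u i \<le> u j" if "i \<le> j" for i j
    using sm that by (simp add: strict_mono_less_eq)
  obtain i where i: "i \<le> n" "u i = 0" using im set by (metis atMost_iff imageE insertI1)
  obtain j where j: "j \<le> n" "u j = s" using im set by (metis atMost_iff imageE insertI1 insertI2)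
  have u0: "u 0 = 0" using smle[of 0 i] i ge[of 0] by (simp add: u_def)
  have un: "u n = s" using smle[of j n] j le[of n] by (simp add: u_def)
  show ?thesis
    by (rule that[of u n]) (use u0 un sm im set in \<open>auto simp: u_def\<close>)
qed

locale brownian = prob_space M for M :: "'a measure" +
  fixes W :: "real \<Rightarrow> 'a \<Rightarrow> real"
  assumes bm: "brownian_motion M W"
begin

abbreviation "\<F> \<equiv> nat_filtration M W"

lemma W_meas: "0 \<le> t \<Longrightarrow> W t \<in> borel_measurable M"
  using bm unfolding brownian_motion_def by simp

lemma W_0: "\<omega> \<in> space M \<Longrightarrow> W 0 \<omega> = 0"
  using bm unfolding brownian_motion_def by simp

lemma W_increment: "0 \<le> s \<Longrightarrow> s < t \<Longrightarrow>
    distributed M lborel (\<lambda>\<omega>. W t \<omega> - W s \<omega>) (normal_density 0 (sqrt (t - s)))"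
  using bm unfolding brownian_motion_def by simp

lemma W_indep: "0 \<le> u 0 \<Longrightarrow> strict_mono u \<Longrightarrow>
    indep_vars (\<lambda>_. borel) (\<lambda>i \<omega>. W (u (Suc i)) \<omega> - W (u i) \<omega>) {..<n}"
  using bm unfolding brownian_motion_def by simp

lemma space_F [simp]: "space (\<F> s) = space M"
  unfolding nat_filtration_def
  by (rule space_measure_of) (use sets.sets_into_space in \<open>auto simp: null_sets_def\<close>)

lemma sets_F: "sets (\<F> s) = sigma_sets (space M)
     ({W r -` B \<inter> space M | r B. 0 \<le> r \<and> r \<le> s \<and> B \<in> sets borel} \<union> null_sets M)"
  unfolding nat_filtration_def
  by (rule sets_measure_of) (use sets.sets_into_space in \<open>auto simp: null_sets_def\<close>)

lemma sets_F_mono: "s \<le> r \<Longrightarrow> sets (\<F> s) \<subseteq> sets (\<F> r)"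
  unfolding sets_F by (rule sigma_sets_mono') (intro Un_mono subset_refl, blast intro: order_trans)

lemma sets_F_le: "sets (\<F> s) \<subseteq> sets M"
  unfolding sets_F by (rule sets.sigma_sets_subset) (auto intro: measurable_sets[OF W_meas])

lemma measurable_F_mono: "f \<in> measurable (\<F> s) N \<Longrightarrow> s \<le> r \<Longrightarrow> f \<in> measurable (\<F> r) N"
  using sets_F_mono[of s r] by (auto simp: measurable_def)

lemma measurable_F_M: "f \<in> measurable (\<F> s) N \<Longrightarrow> f \<in> measurable M N"
  using sets_F_le[of s] by (auto simp: measurable_def)

lemma W_meas_F: "0 \<le> r \<Longrightarrow> r \<le> s \<Longrightarrow> W r \<in> borel_measurable (\<F> s)"
  by (rule measurableI) (auto simp: sets_F intro!: sigma_sets.Basic)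

text \<open>A pi-system that generates \<F> s up to null sets. Its members are kept as preimages of
  sets of functions on a finite index set, so that two of them can be moved to the union of their
  index sets.\<close>

definition cylinders :: "real \<Rightarrow> 'a set set" where
  "cylinders s = {(\<lambda>\<omega>. \<lambda>r\<in>J. W r \<omega>) -` C \<inter> space M | J C.
     finite J \<and> J \<subseteq> {0..s} \<and> C \<in> sets (\<Pi>\<^sub>M r\<in>J. (borel :: real measure))}"

lemma restrict_W_measurable:
  assumes "J \<subseteq> {0..s}" shows "(\<lambda>\<omega>. \<lambda>r\<in>J. W r \<omega>) \<in> measurable M (\<Pi>\<^sub>M r\<in>J. borel)"
  by (rule measurable_restrict) (use assms in \<open>auto intro!: W_meas\<close>)

lemma cylinders_sets: "cylinders s \<subseteq> sets M"
  unfolding cylinders_def by (auto intro: measurable_sets[OF restrict_W_measurable])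

lemma cylinders_single:
  assumes "0 \<le> r" "r \<le> s" "B \<in> sets borel" shows "W r -` B \<inter> space M \<in> cylinders s"
proof -
  have "W r -` B \<inter> space M = (\<lambda>\<omega>. \<lambda>r\<in>{r}. W r \<omega>) -` (\<Pi>\<^sub>E r\<in>{r}. B) \<inter> space M"
    by auto
  moreover have "(\<Pi>\<^sub>E r\<in>{r}. B) \<in> sets (\<Pi>\<^sub>M r\<in>{r}. borel)"
    using assms by (intro sets_PiM_I_finite) auto
  ultimately show ?thesis unfolding cylinders_def using assms by (auto intro!: exI[of _ "{r}"])
qed

lemma cylinders_mono_index:
  assumes "finite J'" "J \<subseteq> J'" "C \<in> sets (\<Pi>\<^sub>M r\<in>J. (borel :: real measure))"
  obtains C' where "C' \<in> sets (\<Pi>\<^sub>M r\<in>J'. (borel :: real measure))"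
    "(\<lambda>\<omega>. \<lambda>r\<in>J. W r \<omega>) -` C \<inter> space M = (\<lambda>\<omega>. \<lambda>r\<in>J'. W r \<omega>) -` C' \<inter> space M"
proof
  show "(\<lambda>y. restrict y J) -` C \<inter> space (\<Pi>\<^sub>M r\<in>J'. (borel :: real measure)) \<in> sets (\<Pi>\<^sub>M r\<in>J'. borel)"
    by (rule measurable_sets[OF measurable_restrict_subset[OF assms(2)] assms(3)])
  have *: "restrict (\<lambda>r\<in>J'. W r \<omega>) J = (\<lambda>r\<in>J. W r \<omega>)" for \<omega>
    using assms(2) by (auto simp: restrict_def fun_eq_iff)
  show "(\<lambda>\<omega>. \<lambda>r\<in>J. W r \<omega>) -` C \<inter> space M =
    (\<lambda>\<omega>. \<lambda>r\<in>J'. W r \<omega>) -` ((\<lambda>y. restrict y J) -` C \<inter> space (\<Pi>\<^sub>M r\<in>J'. borel)) \<inter> space M"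
    unfolding vimage_def using assms(2) by (auto simp: * space_PiM simp del: restrict_restrict)
qed

lemma cylinders_Int: assumes "A \<in> cylinders s" "B \<in> cylinders s" shows "A \<inter> B \<in> cylinders s"
proof -
  obtain J C where J: "A = (\<lambda>\<omega>. \<lambda>r\<in>J. W r \<omega>) -` C \<inter> space M" "finite J" "J \<subseteq> {0..s}"
     "C \<in> sets (\<Pi>\<^sub>M r\<in>J. (borel :: real measure))"
    using assms(1) unfolding cylinders_def by blast
  obtain J' C' where J': "B = (\<lambda>\<omega>. \<lambda>r\<in>J'. W r \<omega>) -` C' \<inter> space M" "finite J'" "J' \<subseteq> {0..s}"
     "C' \<in> sets (\<Pi>\<^sub>M r\<in>J'. (borel :: real measure))"
    using assms(2) unfolding cylinders_def by blast
  obtain D where D: "D \<in> sets (\<Pi>\<^sub>M r\<in>J\<union>J'. (borel :: real measure))"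
    "A = (\<lambda>\<omega>. \<lambda>r\<in>J\<union>J'. W r \<omega>) -` D \<inter> space M"
    using cylinders_mono_index[of "J \<union> J'" J C] J J' by auto
  obtain D' where D': "D' \<in> sets (\<Pi>\<^sub>M r\<in>J\<union>J'. (borel :: real measure))"
    "B = (\<lambda>\<omega>. \<lambda>r\<in>J\<union>J'. W r \<omega>) -` D' \<inter> space M"
    using cylinders_mono_index[of "J \<union> J'" J' C'] J J' by auto
  have "A \<inter> B = (\<lambda>\<omega>. \<lambda>r\<in>J\<union>J'. W r \<omega>) -` (D \<inter> D') \<inter> space M"
    using D D' by auto
  moreover have "D \<inter> D' \<in> sets (\<Pi>\<^sub>M r\<in>J\<union>J'. (borel :: real measure))" "finite (J \<union> J')" "J \<union> J' \<subseteq> {0..s}"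
    using D D' J J' by auto
  ultimately show ?thesis unfolding cylinders_def by blast
qed

text \<open>Since \<open>W\<close> starts at 0, its values at finitely many times up to
  \<open>s\<close> are partial sums of increments over a partition ending at \<open>s\<close>. The
  cylinder is thus an event of the first \<open>n\<close> increments, and the increment from
  \<open>s\<close> to \<open>r\<close> is the next one.\<close>

lemma cylinders_indep:
  assumes "0 \<le> s" "s < r" "E \<in> cylinders s" "B \<in> sets borel"
  shows "prob (E \<inter> ((\<lambda>\<omega>. W r \<omega> - W s \<omega>) -` B \<inter> space M)) =
         prob E * prob ((\<lambda>\<omega>. W r \<omega> - W s \<omega>) -` B \<inter> space M)"
proof -
  obtain J C where J: "E = (\<lambda>\<omega>. \<lambda>r\<in>J. W r \<omega>) -` C \<inter> space M" "finite J" "J \<subseteq> {0..s}"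
     "C \<in> sets (\<Pi>\<^sub>M r\<in>J. (borel :: real measure))"
    using assms(3) unfolding cylinders_def by blast
  obtain u n where u: "u 0 = 0" "strict_mono u" "u n = s" "u (Suc n) = r" "J \<subseteq> u ` {..n}"
    using increasing_indexing[OF J(2,3) assms(1,2)] by blast
  define I where "I i \<omega> = W (u (Suc i)) \<omega> - W (u i) \<omega>" for i \<omega>
  have "indep_vars (\<lambda>_. borel) I {..<Suc n}" unfolding I_def
    using u by (intro W_indep) auto
  then have ind: "indep_var (PiM {..<n} (\<lambda>_. borel)) (\<lambda>\<omega>. restrict (\<lambda>i. I i \<omega>) {..<n})
     (PiM {n} (\<lambda>_. borel)) (\<lambda>\<omega>. restrict (\<lambda>i. I i \<omega>) {n})"
    by (rule indep_var_restrict) auto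
  have "\<forall>q\<in>J. \<exists>i. i \<le> n \<and> u i = q" using u(5) by auto
  then obtain idx where idx: "\<And>q. q \<in> J \<Longrightarrow> idx q \<le> n \<and> u (idx q) = q"
    using bchoice[of J "\<lambda>q i. i \<le> n \<and> u i = q"] by auto
  have Wsum: "W (u k) \<omega> = (\<Sum>i<k. I i \<omega>)" if "\<omega> \<in> space M" for k \<omega>
    unfolding I_def using u(1) W_0[OF that] by (subst sum_lessThan_telescope) auto
  define \<Phi> where "\<Phi> y = (\<lambda>q\<in>J. \<Sum>i<idx q. y i)" for y :: "nat \<Rightarrow> real"
  have \<Phi>: "\<Phi> \<in> measurable (PiM {..<n} (\<lambda>_. borel)) (\<Pi>\<^sub>M r\<in>J. (borel :: real measure))"
    unfolding \<Phi>_def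
  proof (rule measurable_restrict, rule borel_measurable_sum)
    fix q i assume "q \<in> J" "i \<in> {..<idx q}"
    then have "i \<in> {..<n}" using idx[of q] by auto
    then show "(\<lambda>y. y i) \<in> borel_measurable (PiM {..<n} (\<lambda>_. borel))"
      by (rule measurable_component_singleton)
  qed
  let ?I1 = "\<lambda>\<omega>. restrict (\<lambda>i. I i \<omega>) {..<n}" and ?I2 = "\<lambda>\<omega>. restrict (\<lambda>i. I i \<omega>) {n}"
  let ?A1 = "\<Phi> -` C \<inter> space (PiM {..<n} (\<lambda>_. borel :: real measure))"
  let ?A2 = "(\<lambda>y. y n) -` B \<inter> space (PiM {n} (\<lambda>_. borel :: real measure))"
  have A1: "?A1 \<in> sets (PiM {..<n} (\<lambda>_. borel))"
    by (rule measurable_sets[OF \<Phi> J(4)])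
  have A2: "?A2 \<in> sets (PiM {n} (\<lambda>_. borel))"
    by (rule measurable_sets[OF measurable_component_singleton[of n "{n}" "\<lambda>_. borel"] assms(4)]) simp
  have "\<Phi> (?I1 \<omega>) = (\<lambda>r\<in>J. W r \<omega>)" if "\<omega> \<in> space M" for \<omega>
  proof
    fix q show "\<Phi> (?I1 \<omega>) q = (\<lambda>r\<in>J. W r \<omega>) q"
      using idx[of q] Wsum[OF that, of "idx q"] by (auto simp: \<Phi>_def intro!: sum.cong)
  qed
  then have eq1: "?I1 -` ?A1 \<inter> space M = E"
    by (auto simp: J(1) space_PiM)
  have eq2: "?I2 -` ?A2 \<inter> space M = (\<lambda>\<omega>. W r \<omega> - W s \<omega>) -` B \<inter> space M"
    using u by (auto simp: I_def space_PiM)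
  have "(\<lambda>\<omega>. (?I1 \<omega>, ?I2 \<omega>)) -` (?A1 \<times> ?A2) \<inter> space M = 
      (?I1 -` ?A1 \<inter> space M) \<inter> (?I2 -` ?A2 \<inter> space M)" by blast
  then show ?thesis using indep_varD[OF ind A1 A2] unfolding eq1 eq2 by simp
qed

text \<open>Dynkin's argument extends independence from cylinders to \<F> s. The function
  \<open>f\<close> leaves room for squares of the increment and for its embedding into another
  space.\<close>

lemma indep_increment:
  assumes "0 \<le> s" "s < r" "Y \<in> measurable (\<F> s) N" "f \<in> measurable borel N'"
  shows "indep_var N Y N' (\<lambda>\<omega>. f (W r \<omega> - W s \<omega>))"
proof -
  let ?D = "\<lambda>\<omega>. W r \<omega> - W s \<omega>"
  \<comment> \<open>The completed filtration also contains all null sets, so the pi-system consists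
    of the events that agree with a cylinder off a null set.\<close>
  define P where "P = {E \<in> sets M. \<exists>E0\<in>cylinders s. \<exists>Z\<in>null_sets M. E - Z = E0 - Z}"
  define Q where "Q = {?D -` B \<inter> space M | B. B \<in> sets borel}"
  have D: "?D \<in> borel_measurable M" using assms W_meas[of s] W_meas[of r] by simp
  have Qs: "Q \<subseteq> sets M" unfolding Q_def using D by (auto intro: measurable_sets)
  have "indep_set P Q"
  proof (rule indep_setI)
    show "P \<subseteq> events" unfolding P_def by auto
    show "Q \<subseteq> events" by fact
    fix E F assume "E \<in> P" "F \<in> Q"
    then obtain E0 Z where E0: "E \<in> sets M" "E0 \<in> cylinders s" "Z \<in> null_sets M" "E - Z = E0 - Z"
      unfolding P_def by blast
    have F: "F \<in> sets M" using Qs \<open>F \<in> Q\<close> by auto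
    have E0s: "E0 \<in> sets M" using E0 cylinders_sets by auto
    have "prob E = prob (E - Z)" using measure_Diff_null_set[OF E0(1,3)] by simp
    also have "\<dots> = prob E0" unfolding E0(4) using measure_Diff_null_set[OF E0s E0(3)] by simp
    finally have 1: "prob E = prob E0" .
    have "prob (E \<inter> F) = prob (E \<inter> F - Z)" using measure_Diff_null_set[OF _ E0(3), of "E \<inter> F"] E0(1) F by simp
    also have "E \<inter> F - Z = E0 \<inter> F - Z" using E0(4) by blast
    also have "prob \<dots> = prob (E0 \<inter> F)" using measure_Diff_null_set[OF _ E0(3), of "E0 \<inter> F"] E0s F by simp
    finally have 2: "prob (E \<inter> F) = prob (E0 \<inter> F)" .
    show "prob (E \<inter> F) = prob E * prob F"
      using cylinders_indep[OF assms(1,2) E0(2)] \<open>F \<in> Q\<close> unfolding 1 2 Q_def by auto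
  qed
  moreover have "Int_stable P"
  proof (rule Int_stableI)
    fix A B assume "A \<in> P" "B \<in> P"
    then obtain A0 Z B0 Z' where *: "A \<in> sets M" "A0 \<in> cylinders s" "Z \<in> null_sets M" "A - Z = A0 - Z"
       "B \<in> sets M" "B0 \<in> cylinders s" "Z' \<in> null_sets M" "B - Z' = B0 - Z'"
      unfolding P_def by blast
    have "A \<inter> B - (Z \<union> Z') = A0 \<inter> B0 - (Z \<union> Z')" using * by blast
    moreover have "A0 \<inter> B0 \<in> cylinders s" "A \<inter> B \<in> sets M" "Z \<union> Z' \<in> null_sets M"
      using * by (auto intro: cylinders_Int)
    ultimately show "A \<inter> B \<in> P" unfolding P_def by blast
  qed
  moreover have "Int_stable Q"
  proof (rule Int_stableI)
    fix A B assume "A \<in> Q" "B \<in> Q"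
    then obtain A' B' where "A = ?D -` A' \<inter> space M" "A' \<in> sets borel" "B = ?D -` B' \<inter> space M" "B' \<in> sets borel"
      unfolding Q_def by blast
    then have "A \<inter> B = ?D -` (A' \<inter> B') \<inter> space M" "A' \<inter> B' \<in> sets borel" by auto
    then show "A \<inter> B \<in> Q" unfolding Q_def by blast
  qed
  ultimately have ind: "indep_set (sigma_sets (space M) P) (sigma_sets (space M) Q)"
    by (rule indep_set_sigma_sets)
  have empty: "{} \<in> cylinders s"
    using cylinders_single[of 0 s "{}"] assms by simp
  have "W q -` B \<inter> space M \<in> P" if "0 \<le> q" "q \<le> s" "B \<in> sets borel" for q B
    unfolding P_def using cylinders_single[OF that] cylinders_sets[of s] by blast
  moreover have "Z \<in> P" if "Z \<in> null_sets M" for Z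
  proof -
    have "Z \<in> sets M" "Z - Z = {} - Z" using that by auto
    then show ?thesis unfolding P_def using that empty by blast
  qed
  ultimately have "sets (\<F> s) \<subseteq> sigma_sets (space M) P"
    unfolding sets_F by (intro sigma_sets_mono') auto
  then have "sigma_sets (space M) {Y -` A \<inter> space M | A. A \<in> sets N} \<subseteq> sigma_sets (space M) P"
    by (intro sigma_sets_mono) (use measurable_sets[OF assms(3)] in auto)
  moreover have "(\<lambda>\<omega>. f (?D \<omega>)) -` A \<inter> space M \<in> Q" if "A \<in> sets N'" for A
  proof -
    have "(\<lambda>\<omega>. f (?D \<omega>)) -` A \<inter> space M = ?D -` (f -` A) \<inter> space M" "f -` A \<in> sets borel"
      using measurable_sets[OF assms(4) that] by auto
    then show ?thesis unfolding Q_def by blast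
  qed
  then have "sigma_sets (space M) {(\<lambda>\<omega>. f (?D \<omega>)) -` A \<inter> space M | A. A \<in> sets N'} \<subseteq> sigma_sets (space M) Q"
    by (intro sigma_sets_mono') auto
  ultimately have "indep_set (sigma_sets (space M) {Y -` A \<inter> space M | A. A \<in> sets N})
      (sigma_sets (space M) {(\<lambda>\<omega>. f (?D \<omega>)) -` A \<inter> space M | A. A \<in> sets N'})"
    using ind unfolding indep_set_def by (elim indep_sets_mono_sets) (auto split: bool.split)
  moreover have "(\<lambda>\<omega>. f (?D \<omega>)) \<in> measurable M N'" by (rule measurable_compose[OF D assms(4)])
  ultimately show ?thesis unfolding indep_var_eq using measurable_F_M[OF assms(3)] by blast
qed

end

section \<open>Discrete stochastic sums\<close>

text \<open>The events that \<open>P m\<close> holds for some m \<ge> n decrease to the empty set,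
  so continuity from above applies.\<close>

lemma (in prob_space) prob_tendsto_0:
  assumes "\<And>n. {\<omega>\<in>space M. P n \<omega>} \<in> events"
    and "\<And>\<omega>. \<omega> \<in> space M \<Longrightarrow> eventually (\<lambda>n. \<not> P n \<omega>) sequentially"
  shows "(\<lambda>n. prob {\<omega>\<in>space M. P n \<omega>}) \<longlonglongrightarrow> 0"
proof -
  let ?A = "\<lambda>n. \<Union>m\<in>{n..}. {\<omega>\<in>space M. P m \<omega>}"
  have A: "?A n \<in> events" for n using assms(1) by auto
  have "(\<lambda>n. prob (?A n)) \<longlonglongrightarrow> prob (\<Inter>n. ?A n)"
  proof (rule finite_Lim_measure_decseq)
    show "range ?A \<subseteq> events" using A by auto
    show "decseq ?A" by (rule decseq_SucI) (auto intro: Suc_leD)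
  qed
  moreover have "(\<Inter>n. ?A n) = {}"
  proof (rule equals0I)
    fix \<omega> assume \<omega>: "\<omega> \<in> (\<Inter>n. ?A n)"
    then obtain N where N: "\<And>n. n \<ge> N \<Longrightarrow> \<not> P n \<omega>"
      using assms(2)[of \<omega>] unfolding eventually_sequentially by auto
    have "\<omega> \<in> ?A N" using \<omega> by blast
    with N show False by auto
  qed
  ultimately have "(\<lambda>n. prob (?A n)) \<longlonglongrightarrow> 0" by simp
  then show ?thesis
    by (rule tendsto_sandwich[OF _ _ tendsto_const, rotated -1])
       (use A in \<open>auto intro!: always_eventually finite_measure_mono\<close>)
qed

context brownian
begin

lemma increment_moments:
  assumes "0 \<le> s" "s < r"
  shows "integrable M (\<lambda>\<omega>. W r \<omega> - W s \<omega>)" "expectation (\<lambda>\<omega>. W r \<omega> - W s \<omega>) = 0"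
    "integrable M (\<lambda>\<omega>. (W r \<omega> - W s \<omega>)\<^sup>2)" "expectation (\<lambda>\<omega>. (W r \<omega> - W s \<omega>)\<^sup>2) = r - s"
proof -
  note D = W_increment[OF assms]
  have pos: "0 < sqrt (r - s)" using assms by simp
  have *: "integrable M (\<lambda>\<omega>. (W r \<omega> - W s \<omega>) ^ k)" for k
    using integrable_normal_moment[OF pos, of 0 k] distributed_integrable[OF D, of "\<lambda>x. x ^ k"] by simp
  show "integrable M (\<lambda>\<omega>. W r \<omega> - W s \<omega>)" using *[of 1] by simp
  show E: "expectation (\<lambda>\<omega>. W r \<omega> - W s \<omega>) = 0" by (rule normal_distributed_expectation[OF pos D])
  show "integrable M (\<lambda>\<omega>. (W r \<omega> - W s \<omega>)\<^sup>2)" by (rule *)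
  show "expectation (\<lambda>\<omega>. (W r \<omega> - W s \<omega>)\<^sup>2) = r - s"
    using normal_distributed_variance[OF pos D] assms unfolding E by simp
qed

text \<open>The Ito integral of a process that is constant on each cell of the partition
  \<tau>.\<close>

definition dsum :: "(nat \<Rightarrow> real) \<Rightarrow> (nat \<Rightarrow> 'a \<Rightarrow> real) \<Rightarrow> nat \<Rightarrow> 'a \<Rightarrow> real" where
  "dsum \<tau> H n \<omega> = (\<Sum>i<n. H i \<omega> * (W (\<tau> (Suc i)) \<omega> - W (\<tau> i) \<omega>))"

lemma dsum_measurable:
  assumes "0 \<le> \<tau> 0" "strict_mono \<tau>" "\<And>i. i < n \<Longrightarrow> H i \<in> borel_measurable (\<F> (\<tau> i))"
  shows "dsum \<tau> H n \<in> borel_measurable (\<F> (\<tau> n))"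
proof -
  have pos: "0 \<le> \<tau> i" for i
    using assms(1) strict_mono_less_eq[OF assms(2), of 0 i] by linarith
  have mono: "\<tau> i \<le> \<tau> j" if "i \<le> j" for i j
    using strict_mono_less_eq[OF assms(2), of i j] that by simp
  show ?thesis unfolding dsum_def
    by (intro borel_measurable_sum borel_measurable_times borel_measurable_diff W_meas_F pos mono
          measurable_F_mono[OF assms(3)]) auto
qed

text \<open>Discrete Ito isometry, as an inequality: the product of the partial sum and the next
  integrand is known at time \<open>\<tau> n\<close>, hence independent of the centred next
  increment. Cross terms vanish, and each square contributes at most \<open>B\<^sup>2\<close> times
  the step.\<close>

lemma dsum_second_moment:
  assumes \<tau>: "0 \<le> \<tau> 0" "strict_mono \<tau>"
    and H: "\<And>i. i < n \<Longrightarrow> H i \<in> borel_measurable (\<F> (\<tau> i))"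
    and B: "\<And>i \<omega>. i < n \<Longrightarrow> \<omega> \<in> space M \<Longrightarrow> \<bar>H i \<omega>\<bar> \<le> B"
  shows "integrable M (\<lambda>\<omega>. (dsum \<tau> H n \<omega>)\<^sup>2)"
    and "expectation (\<lambda>\<omega>. (dsum \<tau> H n \<omega>)\<^sup>2) \<le> B\<^sup>2 * (\<tau> n - \<tau> 0)"
proof -
  have pos: "0 \<le> \<tau> i" for i
    using \<tau>(1) strict_mono_less_eq[OF \<tau>(2), of 0 i] by linarith
  have "integrable M (\<lambda>\<omega>. (dsum \<tau> H n \<omega>)\<^sup>2) \<and>
    expectation (\<lambda>\<omega>. (dsum \<tau> H n \<omega>)\<^sup>2) \<le> B\<^sup>2 * (\<tau> n - \<tau> 0)"
    using H B
  proof (induction n)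
    case 0
    then show ?case by (simp add: dsum_def)
  next
    case (Suc n)
    let ?S = "dsum \<tau> H n" and ?h = "H n" and ?D = "\<lambda>\<omega>. W (\<tau> (Suc n)) \<omega> - W (\<tau> n) \<omega>"
    have IH: "integrable M (\<lambda>\<omega>. (?S \<omega>)\<^sup>2)" "expectation (\<lambda>\<omega>. (?S \<omega>)\<^sup>2) \<le> B\<^sup>2 * (\<tau> n - \<tau> 0)"
      using Suc by auto
    have lt: "\<tau> n < \<tau> (Suc n)" using \<tau>(2) by (simp add: strict_mono_Suc_iff)
    note D = increment_moments[OF pos[of n] lt]
    have S: "?S \<in> borel_measurable (\<F> (\<tau> n))" using Suc.prems by (intro dsum_measurable \<tau>) auto
    have h: "?h \<in> borel_measurable (\<F> (\<tau> n))" using Suc.prems by auto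
    note SM = measurable_F_M[OF S] and hM = measurable_F_M[OF h]
    have hB: "\<bar>?h \<omega>\<bar> \<le> B" if "\<omega> \<in> space M" for \<omega> using Suc.prems that by auto
    have Sint: "integrable M ?S" by (rule square_integrable_imp_integrable[OF SM IH(1)])
    have Sh: "integrable M (\<lambda>\<omega>. ?S \<omega> * ?h \<omega>)"
    proof (rule Bochner_Integration.integrable_bound[where f="\<lambda>\<omega>. B * ?S \<omega>"])
      show "AE \<omega> in M. norm (?S \<omega> * ?h \<omega>) \<le> norm (B * ?S \<omega>)"
      proof (rule AE_I2)
        fix \<omega> assume "\<omega> \<in> space M"
        from hB[OF this] have "\<bar>?h \<omega>\<bar> * \<bar>?S \<omega>\<bar> \<le> \<bar>B\<bar> * \<bar>?S \<omega>\<bar>" by (intro mult_right_mono) auto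
        then show "norm (?S \<omega> * ?h \<omega>) \<le> norm (B * ?S \<omega>)" by (simp add: abs_mult mult.commute)
      qed
    qed (use SM hM Sint in auto)
    have h2: "(?h \<omega>)\<^sup>2 \<le> B\<^sup>2" if "\<omega> \<in> space M" for \<omega>
      using power_mono[OF hB[OF that], of 2] by simp
    have h2int: "integrable M (\<lambda>\<omega>. (?h \<omega>)\<^sup>2)"
      by (rule integrable_const_bound[of _ "B\<^sup>2"]) (use h2 hM in \<open>auto intro!: AE_I2\<close>)
    have i1: "indep_var borel (\<lambda>\<omega>. ?S \<omega> * ?h \<omega>) borel ?D"
      by (rule indep_increment[OF pos lt borel_measurable_times[OF S h], where f="\<lambda>x. x"]) simp
    have i2: "indep_var borel (\<lambda>\<omega>. (?h \<omega>)\<^sup>2) borel (\<lambda>\<omega>. (?D \<omega>)\<^sup>2)"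
      by (rule indep_increment[OF pos lt borel_measurable_power[OF h], where f="\<lambda>x. x\<^sup>2"]) simp
    note J1 = indep_var_integrable[OF i1 Sh D(1)] and J2 = indep_var_integrable[OF i2 h2int D(3)]
    have E1: "expectation (\<lambda>\<omega>. ?S \<omega> * ?h \<omega> * ?D \<omega>) = 0"
      using indep_var_lebesgue_integral[OF i1 Sh D(1)] D(2) by simp
    have E2: "expectation (\<lambda>\<omega>. (?h \<omega>)\<^sup>2 * (?D \<omega>)\<^sup>2) = expectation (\<lambda>\<omega>. (?h \<omega>)\<^sup>2) * (\<tau> (Suc n) - \<tau> n)"
      using indep_var_lebesgue_integral[OF i2 h2int D(3)] D(4) by simp
    have "expectation (\<lambda>\<omega>. (?h \<omega>)\<^sup>2) \<le> expectation (\<lambda>\<omega>. B\<^sup>2)"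
      by (rule integral_mono) (use h2int h2 in auto)
    then have "expectation (\<lambda>\<omega>. (?h \<omega>)\<^sup>2) \<le> B\<^sup>2" by (simp add: prob_space)
    then have E3: "expectation (\<lambda>\<omega>. (?h \<omega>)\<^sup>2 * (?D \<omega>)\<^sup>2) \<le> B\<^sup>2 * (\<tau> (Suc n) - \<tau> n)"
      unfolding E2 using lt by (intro mult_right_mono) linarith+
    have eq: "(\<lambda>\<omega>. (dsum \<tau> H (Suc n) \<omega>)\<^sup>2) =
        (\<lambda>\<omega>. ((?S \<omega>)\<^sup>2 + 2 * (?S \<omega> * ?h \<omega> * ?D \<omega>)) + (?h \<omega>)\<^sup>2 * (?D \<omega>)\<^sup>2)"
      by (auto simp: dsum_def power2_eq_square algebra_simps)
    have I3: "integrable M (\<lambda>\<omega>. (?S \<omega>)\<^sup>2 + 2 * (?S \<omega> * ?h \<omega> * ?D \<omega>))" using IH J1 by simp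
    have "expectation (\<lambda>\<omega>. (dsum \<tau> H (Suc n) \<omega>)\<^sup>2) =
       expectation (\<lambda>\<omega>. (?S \<omega>)\<^sup>2) + expectation (\<lambda>\<omega>. (?h \<omega>)\<^sup>2 * (?D \<omega>)\<^sup>2)"
      unfolding eq Bochner_Integration.integral_add[OF I3 J2]
      using IH(1) J1 E1 by simp
    moreover have "integrable M (\<lambda>\<omega>. (dsum \<tau> H (Suc n) \<omega>)\<^sup>2)"
      unfolding eq using I3 J2 by simp
    ultimately show ?case using IH(2) E3 by (auto simp: algebra_simps)
  qed
  then show "integrable M (\<lambda>\<omega>. (dsum \<tau> H n \<omega>)\<^sup>2)"
    "expectation (\<lambda>\<omega>. (dsum \<tau> H n \<omega>)\<^sup>2) \<le> B\<^sup>2 * (\<tau> n - \<tau> 0)" by auto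
qed

text \<open>Stopping in place of Doob's inequality: the integrand is cut off once the sum has passed
  \<kappa>, so the final value of the stopped sum records the passage, and Chebyshev is applied to
  that value alone.\<close>

lemma dsum_maximal:
  assumes \<tau>: "0 \<le> \<tau> 0" "strict_mono \<tau>"
    and H: "\<And>i. i < n \<Longrightarrow> H i \<in> borel_measurable (\<F> (\<tau> i))"
    and "0 \<le> B" "0 < \<kappa>"
  shows "prob {\<omega>\<in>space M. \<exists>k\<le>n. \<bar>dsum \<tau> H k \<omega>\<bar> > \<kappa>} \<le>
     prob {\<omega>\<in>space M. \<exists>i<n. \<bar>H i \<omega>\<bar> > B} + B\<^sup>2 * (\<tau> n - \<tau> 0) / \<kappa>\<^sup>2"
proof -
  \<comment> \<open>The event that step \<open>i\<close> is still taken. It is known at time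
    \<open>\<tau> i\<close>, which keeps \<open>K\<close> adapted.\<close>
  define G where "G i = {\<omega>\<in>space M. \<bar>H i \<omega>\<bar> \<le> B \<and> (\<forall>j\<in>{..i}. \<bar>dsum \<tau> H j \<omega>\<bar> \<le> \<kappa>)}" for i
  define K where "K i \<omega> = H i \<omega> * indicator (G i) \<omega>" for i \<omega>
  have mono: "\<tau> i \<le> \<tau> j" if "i \<le> j" for i j
    using strict_mono_less_eq[OF \<tau>(2), of i j] that by simp
  have Sm: "dsum \<tau> H j \<in> borel_measurable (\<F> (\<tau> i))" if "j \<le> i" "j \<le> n" for i j
    using that by (intro measurable_F_mono[OF dsum_measurable[OF \<tau> H] mono]) auto
  have "G i \<in> sets (\<F> (\<tau> i))" if "i < n" for i
  proof -
    have [measurable]: "H i \<in> borel_measurable (\<F> (\<tau> i))" using H that by auto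
    have [measurable]: "dsum \<tau> H j \<in> borel_measurable (\<F> (\<tau> i))" if "j \<in> {..i}" for j
      using that \<open>i < n\<close> Sm[of j i] by auto
    have "{\<omega>\<in>space (\<F> (\<tau> i)). \<bar>H i \<omega>\<bar> \<le> B \<and> (\<forall>j\<in>{..i}. \<bar>dsum \<tau> H j \<omega>\<bar> \<le> \<kappa>)} \<in> sets (\<F> (\<tau> i))"
      by measurable
    then show ?thesis by (simp add: G_def)
  qed
  then have K: "K i \<in> borel_measurable (\<F> (\<tau> i))" if "i < n" for i
    unfolding K_def using H that by (intro borel_measurable_times borel_measurable_indicator) auto
  have KB: "\<bar>K i \<omega>\<bar> \<le> B" if "i < n" for i \<omega>
    unfolding K_def G_def using \<open>0 \<le> B\<close> by (auto simp: indicator_def)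
  note m = dsum_second_moment[of \<tau> n K B, OF \<tau> K KB]
  have KM: "dsum \<tau> K n \<in> borel_measurable M" by (rule measurable_F_M[OF dsum_measurable[OF \<tau> K]])
  have "prob {\<omega>\<in>space M. \<bar>dsum \<tau> K n \<omega>\<bar> \<ge> \<kappa>} \<le> expectation (\<lambda>\<omega>. (dsum \<tau> K n \<omega>)\<^sup>2) / \<kappa>\<^sup>2"
    by (rule second_moment_method[OF KM m(1) \<open>0 < \<kappa>\<close>]) auto
  also have "\<dots> \<le> B\<^sup>2 * (\<tau> n - \<tau> 0) / \<kappa>\<^sup>2" by (rule divide_right_mono) (use m(2) in auto)
  finally have 1: "prob {\<omega>\<in>space M. \<bar>dsum \<tau> K n \<omega>\<bar> \<ge> \<kappa>} \<le> B\<^sup>2 * (\<tau> n - \<tau> 0) / \<kappa>\<^sup>2" .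
  have key: "\<bar>dsum \<tau> K n \<omega>\<bar> > \<kappa>" if \<omega>: "\<omega> \<in> space M" "\<forall>i<n. \<bar>H i \<omega>\<bar> \<le> B" and ex: "\<exists>k\<le>n. \<bar>dsum \<tau> H k \<omega>\<bar> > \<kappa>" for \<omega>
  proof -
    define k where "k = (LEAST k. \<bar>dsum \<tau> H k \<omega>\<bar> > \<kappa>)"
    obtain k' where k': "k' \<le> n" "\<bar>dsum \<tau> H k' \<omega>\<bar> > \<kappa>" using ex by blast
    have k: "\<bar>dsum \<tau> H k \<omega>\<bar> > \<kappa>" unfolding k_def by (rule LeastI) (rule k')
    have "k \<le> k'" unfolding k_def by (rule Least_le) (rule k')
    then have "k \<le> n" using k' by simp
    have less: "\<bar>dsum \<tau> H j \<omega>\<bar> \<le> \<kappa>" if "j < k" for j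
      using not_less_Least[of j] that unfolding k_def by fastforce
    \<comment> \<open>From \<open>k\<close> on the index \<open>k\<close> itself violates the
      condition in \<open>G i\<close>, so all further terms vanish.\<close>
    have "dsum \<tau> K n \<omega> = (\<Sum>i<k. K i \<omega> * (W (\<tau> (Suc i)) \<omega> - W (\<tau> i) \<omega>))"
      unfolding dsum_def using \<open>k \<le> n\<close> k
      by (intro sum.mono_neutral_right) (auto simp: K_def G_def indicator_def not_less not_le intro!: bexI[of _ k])
    also have "\<dots> = dsum \<tau> H k \<omega>" unfolding dsum_def
      using less \<omega> \<open>k \<le> n\<close> by (intro sum.cong) (auto simp: K_def G_def indicator_def)
    finally show ?thesis using k by simp
  qed
  have "{\<omega>\<in>space M. \<exists>k\<le>n. \<bar>dsum \<tau> H k \<omega>\<bar> > \<kappa>} \<subseteq>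
     {\<omega>\<in>space M. \<exists>i\<in>{..<n}. \<bar>H i \<omega>\<bar> > B} \<union> {\<omega>\<in>space M. \<bar>dsum \<tau> K n \<omega>\<bar> \<ge> \<kappa>}"
  proof
    fix \<omega> assume \<omega>: "\<omega> \<in> {\<omega>\<in>space M. \<exists>k\<le>n. \<bar>dsum \<tau> H k \<omega>\<bar> > \<kappa>}"
    show "\<omega> \<in> {\<omega>\<in>space M. \<exists>i\<in>{..<n}. \<bar>H i \<omega>\<bar> > B} \<union> {\<omega>\<in>space M. \<bar>dsum \<tau> K n \<omega>\<bar> \<ge> \<kappa>}"
    proof (cases "\<forall>i<n. \<bar>H i \<omega>\<bar> \<le> B")
      case True
      then show ?thesis using key[of \<omega>] \<omega> by auto
    next
      case False
      then show ?thesis using \<omega> by (auto simp: not_le)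
    qed
  qed
  moreover have m1: "{\<omega>\<in>space M. \<exists>i\<in>{..<n}. \<bar>H i \<omega>\<bar> > B} \<in> events"
  proof -
    have [measurable]: "H i \<in> borel_measurable M" if "i \<in> {..<n}" for i 
      using measurable_F_M[OF H] that by auto
    show ?thesis by measurable
  qed
  moreover have m2: "{\<omega>\<in>space M. \<bar>dsum \<tau> K n \<omega>\<bar> \<ge> \<kappa>} \<in> events" using KM by measurable
  ultimately have "prob {\<omega>\<in>space M. \<exists>k\<le>n. \<bar>dsum \<tau> H k \<omega>\<bar> > \<kappa>} \<le>
     prob ({\<omega>\<in>space M. \<exists>i\<in>{..<n}. \<bar>H i \<omega>\<bar> > B} \<union> {\<omega>\<in>space M. \<bar>dsum \<tau> K n \<omega>\<bar> \<ge> \<kappa>})"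
    by (intro finite_measure_mono) auto
  also have "\<dots> \<le> prob {\<omega>\<in>space M. \<exists>i\<in>{..<n}. \<bar>H i \<omega>\<bar> > B} + prob {\<omega>\<in>space M. \<bar>dsum \<tau> K n \<omega>\<bar> \<ge> \<kappa>}"
    by (rule measure_Un_le[OF m1 m2])
  finally show ?thesis using 1 by (simp add: Bex_def)
qed

end

section \<open>Running extrema and oscillation\<close>

definition run_max :: "(real \<Rightarrow> real) \<Rightarrow> real \<Rightarrow> real" where
  "run_max f t = (SUP s\<in>{0..t}. f s)"

definition run_min :: "(real \<Rightarrow> real) \<Rightarrow> real \<Rightarrow> real" where
  "run_min f t = (INF s\<in>{0..t}. f s)"

lemma run_min_uminus: "run_min f t = - run_max (\<lambda>s. - f s) t"
  by (simp add: run_min_def run_max_def Inf_real_def image_image)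

context
  fixes f :: "real \<Rightarrow> real"
  assumes cont: "continuous_on {0..} f"
begin

lemma cont_upto: "continuous_on {0..t} f"
  by (rule continuous_on_subset[OF cont]) auto

lemma run_max_bdd: "bdd_above (f ` {0..t})"
  by (rule compact_imp_bounded[OF compact_continuous_image[OF cont_upto], THEN bounded_imp_bdd_above]) simp

lemma run_max_upper: "0 \<le> s \<Longrightarrow> s \<le> t \<Longrightarrow> f s \<le> run_max f t"
  unfolding run_max_def by (rule cSUP_upper) (auto intro: run_max_bdd)

lemma run_max_mono: "0 \<le> s \<Longrightarrow> s \<le> t \<Longrightarrow> run_max f s \<le> run_max f t"
  unfolding run_max_def by (rule cSUP_subset_mono) (auto intro: run_max_bdd)

lemma run_max_attained:
  assumes "0 \<le> t" obtains v where "v \<in> {0..t}" "f v = run_max f t"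
proof -
  obtain v where v: "v \<in> {0..t}" "\<forall>y\<in>{0..t}. f y \<le> f v"
    using continuous_attains_sup[of "{0..t}" f] cont_upto assms by auto
  have "run_max f t = f v" unfolding run_max_def
    by (rule cSup_eq_maximum) (use v in auto)
  with v that show ?thesis by simp
qed

text \<open>A maximizer over \<open>{0..r}\<close> must lie after \<open>s\<close> if the maximum
  has grown, and nothing larger follows it, so the maximum at time \<open>v\<close> is already the
  final one.\<close>

lemma run_max_attained_later:
  assumes "0 \<le> s" "s \<le> r" "run_max f s < run_max f r"
  obtains v where "v \<in> {s..r}" "f v = run_max f r" "run_max f v = run_max f r"
proof -
  obtain v where v: "v \<in> {0..r}" "f v = run_max f r" using run_max_attained[of r] assms by auto
  have "\<not> v \<le> s" using run_max_upper[of v s] v assms by auto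
  moreover have "run_max f v = run_max f r"
    using run_max_mono[of v r] run_max_upper[of v v] v by auto
  ultimately show ?thesis using v by (intro that[of v]) auto
qed

lemma run_max_eq_before:
  assumes "0 < t" "f t < run_max f t"
  obtains s where "0 \<le> s" "s < t" "\<And>r. s \<le> r \<Longrightarrow> r \<le> t \<Longrightarrow> run_max f r = run_max f t"
proof -
  obtain v where v: "v \<in> {0..t}" "f v = run_max f t" using run_max_attained[of t] assms by auto
  have "v \<noteq> t" using v assms by auto
  then have "0 \<le> v" "v < t" using v by auto
  then show ?thesis
  proof (rule that)
    fix r assume "v \<le> r" "r \<le> t"
    then show "run_max f r = run_max f t"
      using run_max_upper[of v r] run_max_mono[of r t] v by (intro antisym) auto
  qed
qed

end

text \<open>At the time \<open>v\<close> where the new maximum is attained, \<open>u v - u s\<close>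
  is the sum of \<open>(1 - \<alpha>) * (P r - P s)\<close>, the nonnegative
  \<open>P s - f s\<close> and \<open>\<beta> * (Q s - Q v)\<close>; only a negative \<beta> works
  against the bound. \<open>P\<close> and \<open>Q\<close> stay abstract so that, for
  \<open>- f\<close>, the negated minimum and maximum can take their places.\<close>

lemma run_max_increment_bound:
  fixes P Q f u :: "real \<Rightarrow> real"
  assumes "s \<le> r" "\<alpha> < 1" and f: "f s \<le> P s"
    and att: "P s < P r \<Longrightarrow> \<exists>v\<in>{s..r}. f v = P r \<and> P v = P r" and "P s \<le> P r"
    and Q: "\<And>v. v \<in> {s..r} \<Longrightarrow> Q v \<le> Q s \<and> Q r \<le> Q v"
    and u: "\<And>v. v \<in> {s..r} \<Longrightarrow> u v = f v - \<alpha> * P v - \<beta> * Q v"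
    and O: "\<And>v. v \<in> {s..r} \<Longrightarrow> \<bar>u v - u s\<bar> \<le> D"
  shows "(1 - \<alpha>) * (P r - P s) \<le> D + max (- \<beta>) 0 * (Q s - Q r)"
proof -
  have pos: "0 \<le> max (- \<beta>) 0 * (Q s - Q r)" using Q[of r] \<open>s \<le> r\<close> by (intro mult_nonneg_nonneg) auto
  have "0 \<le> D" using O[of s] \<open>s \<le> r\<close> by auto
  show ?thesis
  proof (cases "P s < P r")
    case True
    then obtain v where v: "v \<in> {s..r}" "f v = P r" "P v = P r" using att by auto
    have "- \<beta> * (Q s - Q v) \<le> max (- \<beta>) 0 * (Q s - Q v)"
      using Q[OF v(1)] by (intro mult_right_mono) auto
    also have "\<dots> \<le> max (- \<beta>) 0 * (Q s - Q r)"
      using Q[OF v(1)] by (intro mult_left_mono) auto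
    finally have 1: "- \<beta> * (Q s - Q v) \<le> max (- \<beta>) 0 * (Q s - Q r)" .
    have "u v - u s = P r - f s - \<alpha> * (P r - P s) + \<beta> * (Q s - Q v)"
      using u[OF v(1)] u[of s] v \<open>s \<le> r\<close> by (simp add: algebra_simps)
    moreover have "u v - u s \<le> D" using O[OF v(1)] by auto
    ultimately show ?thesis using 1 f by (simp add: algebra_simps)
  next
    case False
    then have "P r = P s" using \<open>P s \<le> P r\<close> by simp
    then show ?thesis using pos \<open>0 \<le> D\<close> by simp
  qed
qed

text \<open>If both coefficients are negative, the subtracted product is \<alpha> * \<beta>, and the
  condition on \<open>rho\<close> puts it below the denominator; otherwise it is 0.\<close>

lemma perturbation_gap:
  fixes \<alpha> \<beta> :: real
  assumes "\<alpha> < 1" "\<beta> < 1" "\<bar>rho \<alpha> \<beta>\<bar> < 1"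
  shows "0 < (1 - \<alpha>) * (1 - \<beta>) - max (- \<alpha>) 0 * max (- \<beta>) 0"
proof (cases "\<alpha> < 0 \<and> \<beta> < 0")
  case True
  have "0 < (1 - \<alpha>) * (1 - \<beta>)" using assms by simp
  moreover have "\<alpha> * \<beta> / ((1 - \<alpha>) * (1 - \<beta>)) < 1"
    using assms(3) unfolding rho_def by linarith
  ultimately have "\<alpha> * \<beta> < (1 - \<alpha>) * (1 - \<beta>)" by (simp add: divide_less_eq)
  then show ?thesis using True by (simp add: max_def)
next
  case False
  then have "max (- \<alpha>) 0 * max (- \<beta>) 0 = 0" by (auto simp: max_def)
  moreover have "0 < (1 - \<alpha>) * (1 - \<beta>)" using assms by simp
  ultimately show ?thesis by linarith
qed

text \<open>The condition on \<open>rho\<close> makes the linear system for the increments of the running maximum and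
  minimum solvable with nonnegative coefficients.\<close>

lemma oscillation_bound:
  fixes \<alpha> \<beta> :: real
  assumes ab: "\<alpha> < 1" "\<beta> < 1" "\<bar>rho \<alpha> \<beta>\<bar> < 1"
  obtains C where "C > 0"
    "\<And>f s r v D. continuous_on {0..} f \<Longrightarrow> 0 \<le> s \<Longrightarrow> s \<le> v \<Longrightarrow> v \<le> r \<Longrightarrow>
      (\<And>w. w \<in> {s..r} \<Longrightarrow> \<bar>(f w - \<alpha> * run_max f w - \<beta> * run_min f w) -
         (f s - \<alpha> * run_max f s - \<beta> * run_min f s)\<bar> \<le> D) \<Longrightarrow> \<bar>f v - f s\<bar> \<le> C * D"
proof -
  define \<Delta> where "\<Delta> = (1 - \<alpha>) * (1 - \<beta>) - max (- \<alpha>) 0 * max (- \<beta>) 0"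
  have \<Delta>: "\<Delta> > 0" unfolding \<Delta>_def by (rule perturbation_gap[OF ab])
  define Ca Cb where "Ca = (1 - \<beta> + max (- \<beta>) 0) / \<Delta>" and "Cb = (1 - \<alpha> + max (- \<alpha>) 0) / \<Delta>"
  have Cpos: "0 \<le> Ca" "0 \<le> Cb" unfolding Ca_def Cb_def using ab \<Delta> by (auto intro!: divide_nonneg_pos)
  define C where "C = 1 + \<bar>\<alpha>\<bar> * Ca + \<bar>\<beta>\<bar> * Cb"
  show ?thesis
  proof (rule that[of C])
    show "0 < C" unfolding C_def using Cpos by (intro add_pos_nonneg mult_nonneg_nonneg) auto
    fix f s r v D
    assume cont: "continuous_on {0..} (f :: real \<Rightarrow> real)" and sr: "0 \<le> s" "s \<le> v" "v \<le> r"
      and osc: "\<And>w. w \<in> {s..r} \<Longrightarrow> \<bar>(f w - \<alpha> * run_max f w - \<beta> * run_min f w) -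
         (f s - \<alpha> * run_max f s - \<beta> * run_min f s)\<bar> \<le> D"
    have cont': "continuous_on {0..} (\<lambda>s. - f s)" using cont by (rule continuous_on_minus)
    define a d where "a = run_max f r - run_max f s" and "d = run_min f s - run_min f r"
    have mono: "run_max f w \<le> run_max f w'" "run_min f w' \<le> run_min f w" if "0 \<le> w" "w \<le> w'" for w w'
      using run_max_mono[OF cont, of w w'] run_max_mono[OF cont', of w w'] that
      by (auto simp: run_min_uminus)
    have 1: "(1 - \<alpha>) * a \<le> D + max (- \<beta>) 0 * d" unfolding a_def d_def
    proof (rule run_max_increment_bound[where f=f])
      show "\<exists>v\<in>{s..r}. f v = run_max f r \<and> run_max f v = run_max f r" if "run_max f s < run_max f r"
        by (rule run_max_attained_later[OF cont sr(1) _ that]) (use sr in auto)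
    qed (use ab sr osc mono in \<open>auto intro: run_max_upper[OF cont]\<close>)
    \<comment> \<open>The same bound for \<open>- f\<close>: \<alpha> and \<beta> change places,
      \<open>- run_min\<close> acts as the running maximum and \<open>- run_max\<close> as the
      running minimum.\<close>
    have "(1 - \<beta>) * (- run_min f r - - run_min f s) \<le> D + max (- \<alpha>) 0 * (- run_max f s - - run_max f r)"
    proof (rule run_max_increment_bound[where f="\<lambda>s. - f s"
          and u="\<lambda>w. - (f w - \<alpha> * run_max f w - \<beta> * run_min f w)"])
      show "\<exists>v\<in>{s..r}. - f v = - run_min f r \<and> - run_min f v = - run_min f r"
        if "- run_min f s < - run_min f r"
      proof -
        have lt: "run_max (\<lambda>s. - f s) s < run_max (\<lambda>s. - f s) r"
          using that by (simp add: run_min_uminus)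
        show ?thesis unfolding run_min_uminus
          by (rule run_max_attained_later[OF cont' sr(1) _ lt]) (use sr in auto)
      qed
      show "- f s \<le> - run_min f s"
        using run_max_upper[OF cont', of s s] sr by (simp add: run_min_uminus)
      show "\<bar>- (f w - \<alpha> * run_max f w - \<beta> * run_min f w) - - (f s - \<alpha> * run_max f s - \<beta> * run_min f s)\<bar> \<le> D"
        if "w \<in> {s..r}" for w using osc[OF that] by linarith
    qed (use ab sr mono in auto)
    then have 2: "(1 - \<beta>) * d \<le> D + max (- \<alpha>) 0 * a" by (simp add: a_def d_def)
    \<comment> \<open>Elimination of \<open>d\<close> from the two inequalities: all multipliers are
      nonnegative, and the determinant \<Delta> is positive.\<close>
    have "(1 - \<beta>) * ((1 - \<alpha>) * a) \<le> (1 - \<beta>) * (D + max (- \<beta>) 0 * d)"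
      using 1 ab by (intro mult_left_mono) auto
    moreover have "max (- \<beta>) 0 * ((1 - \<beta>) * d) \<le> max (- \<beta>) 0 * (D + max (- \<alpha>) 0 * a)"
      using 2 by (intro mult_left_mono) auto
    ultimately have "\<Delta> * a \<le> (1 - \<beta> + max (- \<beta>) 0) * D"
      unfolding \<Delta>_def by (simp add: algebra_simps)
    then have a: "a \<le> Ca * D" unfolding Ca_def using \<Delta> by (simp add: field_simps)
    have "(1 - \<alpha>) * ((1 - \<beta>) * d) \<le> (1 - \<alpha>) * (D + max (- \<alpha>) 0 * a)"
      using 2 ab by (intro mult_left_mono) auto
    moreover have "max (- \<alpha>) 0 * ((1 - \<alpha>) * a) \<le> max (- \<alpha>) 0 * (D + max (- \<beta>) 0 * d)"
      using 1 by (intro mult_left_mono) auto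
    ultimately have "\<Delta> * d \<le> (1 - \<alpha> + max (- \<alpha>) 0) * D"
      unfolding \<Delta>_def by (simp add: algebra_simps)
    then have d: "d \<le> Cb * D" unfolding Cb_def using \<Delta> by (simp add: field_simps)
    let ?a = "run_max f v - run_max f s" and ?d = "run_min f s - run_min f v"
    have v: "0 \<le> ?a" "?a \<le> a" "0 \<le> ?d" "?d \<le> d"
      unfolding a_def d_def using mono[of s v] mono[of v r] sr by auto
    define z p q where "z = (f v - \<alpha> * run_max f v - \<beta> * run_min f v) -
      (f s - \<alpha> * run_max f s - \<beta> * run_min f s)" and "p = \<alpha> * ?a" and "q = \<beta> * ?d"
    have "f v - f s = z + p - q" by (simp add: z_def p_def q_def algebra_simps)
    moreover have "\<bar>z\<bar> \<le> D" unfolding z_def by (rule osc) (use sr in auto)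
    moreover have "\<bar>p\<bar> \<le> \<bar>\<alpha>\<bar> * (Ca * D)"
      unfolding p_def abs_mult using v a by (intro mult_left_mono) auto
    moreover have "\<bar>q\<bar> \<le> \<bar>\<beta>\<bar> * (Cb * D)"
      unfolding q_def abs_mult using v d by (intro mult_left_mono) auto
    ultimately have "\<bar>f v - f s\<bar> \<le> D + \<bar>\<alpha>\<bar> * (Ca * D) + \<bar>\<beta>\<bar> * (Cb * D)" by linarith
    then show "\<bar>f v - f s\<bar> \<le> C * D" by (simp add: C_def algebra_simps)
  qed
qed

section \<open>Riemann sums along refining dyadic grids\<close>

context prob_space
begin

definition conv_prob :: "(nat \<Rightarrow> 'a \<Rightarrow> real) \<Rightarrow> ('a \<Rightarrow> real) \<Rightarrow> bool" where
  "conv_prob Y Z \<longleftrightarrow> (\<forall>\<kappa>>0. (\<lambda>n. prob {\<omega>\<in>space M. \<bar>Y n \<omega> - Z \<omega>\<bar> > \<kappa>}) \<longlonglongrightarrow> 0)"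

lemma conv_prob_diff:
  assumes Y: "\<And>n. Y n \<in> borel_measurable M" "Z \<in> borel_measurable M" "conv_prob Y Z"
    and Y': "\<And>n. Y' n \<in> borel_measurable M" "Z' \<in> borel_measurable M" "conv_prob Y' Z'"
  shows "conv_prob (\<lambda>n \<omega>. Y n \<omega> - Y' n \<omega>) (\<lambda>\<omega>. Z \<omega> - Z' \<omega>)"
  unfolding conv_prob_def
proof (intro allI impI)
  fix \<kappa> :: real assume "\<kappa> > 0"
  note [measurable] = Y(1,2) Y'(1,2)
  have "(\<lambda>n. prob {\<omega>\<in>space M. \<bar>Y n \<omega> - Z \<omega>\<bar> > \<kappa>/2} + prob {\<omega>\<in>space M. \<bar>Y' n \<omega> - Z' \<omega>\<bar> > \<kappa>/2}) \<longlonglongrightarrow> 0 + 0"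
    by (intro tendsto_add Y(3)[unfolded conv_prob_def, rule_format] Y'(3)[unfolded conv_prob_def, rule_format])
       (use \<open>\<kappa> > 0\<close> in simp_all)
  then have lim: "(\<lambda>n. prob {\<omega>\<in>space M. \<bar>Y n \<omega> - Z \<omega>\<bar> > \<kappa>/2} + prob {\<omega>\<in>space M. \<bar>Y' n \<omega> - Z' \<omega>\<bar> > \<kappa>/2}) \<longlonglongrightarrow> 0" by simp
  have "prob {\<omega>\<in>space M. \<bar>Y n \<omega> - Y' n \<omega> - (Z \<omega> - Z' \<omega>)\<bar> > \<kappa>} \<le>
     prob {\<omega>\<in>space M. \<bar>Y n \<omega> - Z \<omega>\<bar> > \<kappa>/2} + prob {\<omega>\<in>space M. \<bar>Y' n \<omega> - Z' \<omega>\<bar> > \<kappa>/2}" for n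
  proof -
    have "{\<omega>\<in>space M. \<bar>Y n \<omega> - Y' n \<omega> - (Z \<omega> - Z' \<omega>)\<bar> > \<kappa>} \<subseteq>
      {\<omega>\<in>space M. \<bar>Y n \<omega> - Z \<omega>\<bar> > \<kappa>/2} \<union> {\<omega>\<in>space M. \<bar>Y' n \<omega> - Z' \<omega>\<bar> > \<kappa>/2}"
    proof
      fix \<omega> assume \<omega>: "\<omega> \<in> {\<omega>\<in>space M. \<bar>Y n \<omega> - Y' n \<omega> - (Z \<omega> - Z' \<omega>)\<bar> > \<kappa>}"
      have "\<bar>Y n \<omega> - Y' n \<omega> - (Z \<omega> - Z' \<omega>)\<bar> \<le> \<bar>Y n \<omega> - Z \<omega>\<bar> + \<bar>Y' n \<omega> - Z' \<omega>\<bar>" by linarith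
      moreover have "\<bar>Y n \<omega> - Y' n \<omega> - (Z \<omega> - Z' \<omega>)\<bar> > \<kappa>" using \<omega> by blast
      ultimately have "\<bar>Y n \<omega> - Z \<omega>\<bar> > \<kappa>/2 \<or> \<bar>Y' n \<omega> - Z' \<omega>\<bar> > \<kappa>/2" by linarith
      then show "\<omega> \<in> {\<omega>\<in>space M. \<bar>Y n \<omega> - Z \<omega>\<bar> > \<kappa>/2} \<union> {\<omega>\<in>space M. \<bar>Y' n \<omega> - Z' \<omega>\<bar> > \<kappa>/2}"
        using \<omega> by blast
    qed
    then have "prob {\<omega>\<in>space M. \<bar>Y n \<omega> - Y' n \<omega> - (Z \<omega> - Z' \<omega>)\<bar> > \<kappa>} \<le>
      prob ({\<omega>\<in>space M. \<bar>Y n \<omega> - Z \<omega>\<bar> > \<kappa>/2} \<union> {\<omega>\<in>space M. \<bar>Y' n \<omega> - Z' \<omega>\<bar> > \<kappa>/2})"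
      by (rule finite_measure_mono) measurable
    also have "\<dots> \<le> prob {\<omega>\<in>space M. \<bar>Y n \<omega> - Z \<omega>\<bar> > \<kappa>/2} + prob {\<omega>\<in>space M. \<bar>Y' n \<omega> - Z' \<omega>\<bar> > \<kappa>/2}"
      by (rule measure_Un_le) measurable
    finally show ?thesis .
  qed
  then show "(\<lambda>n. prob {\<omega>\<in>space M. \<bar>Y n \<omega> - Y' n \<omega> - (Z \<omega> - Z' \<omega>)\<bar> > \<kappa>}) \<longlonglongrightarrow> 0"
    by (intro tendsto_sandwich[OF _ _ tendsto_const lim] always_eventually) auto
qed

end

lemma sum_lessThan_shift: "(\<Sum>i<k + l. g i) = (\<Sum>i<k. g i) + (\<Sum>i<l. g (k + i))"
  for g :: "nat \<Rightarrow> 'b :: comm_monoid_add" and k l :: nat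
  by (induction l) (simp_all add: algebra_simps)

text \<open>Starts at T * a / 2 ^ m and has step T / 2 ^ (m + n): the \<open>n\<close>-fold dyadic
  refinement of a grid of level \<open>m\<close>, whose points it meets at the indices k * 2 ^
  n.\<close>

definition grid :: "real \<Rightarrow> nat \<Rightarrow> nat \<Rightarrow> nat \<Rightarrow> nat \<Rightarrow> real" where
  "grid T a m n i = T * real (a * 2 ^ n + i) / 2 ^ (m + n)"

lemma grid_strict_mono: "T > 0 \<Longrightarrow> strict_mono (grid T a m n)"
  by (auto simp: strict_mono_Suc_iff grid_def divide_strict_right_mono)

lemma grid_nonneg: "T > 0 \<Longrightarrow> 0 \<le> grid T a m n i"
  by (simp add: grid_def)

lemma grid_block: "grid T a m n (k * 2 ^ n) = T * real (a + k) / 2 ^ m"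
  by (simp add: grid_def power_add field_simps)

lemma grid_0_add: "grid T 0 m n (a * 2 ^ n + i) = grid T a m n i"
  by (simp add: grid_def)

locale perturbed_diffusion = brownian M W for M :: "'a measure" and W +
  fixes X :: "real \<Rightarrow> 'a \<Rightarrow> real" and b \<sigma> :: "real \<Rightarrow> real" and \<alpha> \<beta> x :: real
  assumes \<alpha>: "\<alpha> < 1" and \<beta>: "\<beta> < 1" and \<rho>: "\<bar>rho \<alpha> \<beta>\<bar> < 1"
    and b_Lipschitz: "\<exists>L. L-lipschitz_on UNIV b" and \<sigma>_Lipschitz: "\<exists>L. L-lipschitz_on UNIV \<sigma>"
    and \<sigma>_pos: "\<bar>\<sigma> y\<bar> > 0"
    and X_adapted: "0 \<le> t \<Longrightarrow> X t \<in> borel_measurable (nat_filtration M W t)"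
    and X_cont: "\<omega> \<in> space M \<Longrightarrow> continuous_on {0..} (\<lambda>t. X t \<omega>)"
    and X_ito: "0 \<le> t \<Longrightarrow> is_ito_integral M W (\<lambda>s \<omega>. \<sigma> (X s \<omega>)) t
           (\<lambda>\<omega>. X t \<omega> - x - integral {0..t} (\<lambda>s. b (X s \<omega>))
                 - \<alpha> * run_max (\<lambda>s. X s \<omega>) t - \<beta> * run_min (\<lambda>s. X s \<omega>) t)"
begin

definition U :: "real \<Rightarrow> 'a \<Rightarrow> real" where
  "U t \<omega> = X t \<omega> - \<alpha> * run_max (\<lambda>s. X s \<omega>) t - \<beta> * run_min (\<lambda>s. X s \<omega>) t"

text \<open>The martingale part of \<open>U\<close>, which \<open>X_ito\<close> identifies with the
  stochastic integral.\<close>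

definition N :: "real \<Rightarrow> 'a \<Rightarrow> real" where
  "N t \<omega> = U t \<omega> - x - integral {0..t} (\<lambda>s. b (X s \<omega>))"

lemma N_ito: assumes "0 \<le> t" shows "is_ito_integral M W (\<lambda>s \<omega>. \<sigma> (X s \<omega>)) t (N t)"
proof -
  have "(\<lambda>\<omega>. X t \<omega> - x - integral {0..t} (\<lambda>s. b (X s \<omega>))
                 - \<alpha> * run_max (\<lambda>s. X s \<omega>) t - \<beta> * run_min (\<lambda>s. X s \<omega>) t) = N t"
    by (auto simp: N_def U_def)
  then show ?thesis using X_ito[OF assms] by simp
qed

lemma N_measurable: "0 \<le> t \<Longrightarrow> N t \<in> borel_measurable M"
  using N_ito unfolding is_ito_integral_def by blast

lemma X_measurable: "0 \<le> t \<Longrightarrow> X t \<in> borel_measurable M"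
  by (rule measurable_F_M[OF X_adapted])

lemma b_cont: "continuous_on A b" and \<sigma>_cont: "continuous_on A \<sigma>"
  using b_Lipschitz \<sigma>_Lipschitz lipschitz_on_continuous_on continuous_on_subset by blast+

lemma \<sigma>_measurable: "\<sigma> \<in> borel_measurable borel"
  by (rule borel_measurable_continuous_onI[OF \<sigma>_cont])

lemma \<sigma>X_adapted: "0 \<le> s \<Longrightarrow> s \<le> t \<Longrightarrow> (\<lambda>\<omega>. \<sigma> (X s \<omega>)) \<in> borel_measurable (\<F> t)"
  by (rule measurable_F_mono[OF measurable_compose[OF X_adapted \<sigma>_measurable]])

text \<open>Each of the 2 ^ n cells of the defining sum consists of \<open>p\<close> grid steps. The
  integrand is frozen at the left end of the cell, whose index is \<open>p * (i div p)\<close>, and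
  the increments inside a cell telescope.\<close>

lemma ito_sum_eq_dsum:
  "ito_sum W (\<lambda>s \<omega>. \<sigma> (X s \<omega>)) (T * real p / 2 ^ m) n \<omega> =
   dsum (grid T 0 m n) (\<lambda>i \<omega>. \<sigma> (X (grid T 0 m n (p * (i div p))) \<omega>)) (p * 2 ^ n) \<omega>"
proof -
  let ?g = "grid T 0 m n"
  let ?H = "\<lambda>i. \<sigma> (X (?g (p * (i div p))) \<omega>) * (W (?g (Suc i)) \<omega> - W (?g i) \<omega>)"
  have g: "T * real p / 2 ^ m * real k / 2 ^ n = ?g (k * p)" for k
    by (simp add: grid_def power_add field_simps)
  have "ito_sum W (\<lambda>s \<omega>. \<sigma> (X s \<omega>)) (T * real p / 2 ^ m) n \<omega> =
    (\<Sum>k<2 ^ n. \<Sum>i\<in>{k * p..<k * p + p}. ?H i)"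
    unfolding ito_sum_def g
  proof (rule sum.cong[OF refl])
    fix k
    have "(\<Sum>i\<in>{k * p..<k * p + p}. ?H i) =
      (\<Sum>i\<in>{k * p..<k * p + p}. \<sigma> (X (?g (k * p)) \<omega>) * (W (?g (Suc i)) \<omega> - W (?g i) \<omega>))"
    proof (rule sum.cong[OF refl])
      fix i assume "i \<in> {k * p..<k * p + p}"
      then have "i div p = k" by (intro div_nat_eqI) (auto simp: mult.commute)
      then show "?H i = \<sigma> (X (?g (k * p)) \<omega>) * (W (?g (Suc i)) \<omega> - W (?g i) \<omega>)"
        by (simp add: mult.commute)
    qed
    also have "\<dots> = \<sigma> (X (?g (k * p)) \<omega>) * (W (?g (k * p + p)) \<omega> - W (?g (k * p)) \<omega>)"
      unfolding sum_distrib_left[symmetric] by (subst sum_Suc_diff') auto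
    finally show "\<sigma> (X (?g (k * p)) \<omega>) * (W (?g (Suc k * p)) \<omega> - W (?g (k * p)) \<omega>) =
       (\<Sum>i\<in>{k * p..<k * p + p}. ?H i)" by (simp add: add.commute)
  qed
  then show ?thesis unfolding sum.nat_group dsum_def by (simp add: mult.commute)
qed

lemma grid_adapted:
  assumes "T > 0" "j \<le> i" shows "(\<lambda>\<omega>. \<sigma> (X (grid T a m n j) \<omega>)) \<in> borel_measurable (\<F> (grid T a m n i))"
  using strict_mono_less_eq[OF grid_strict_mono[OF assms(1)], of a m n j i] assms
  by (intro \<sigma>X_adapted grid_nonneg) auto

lemma dsum_grid_measurable:
  "T > 0 \<Longrightarrow> dsum (grid T a m n) (\<lambda>i \<omega>. \<sigma> (X (grid T a m n i) \<omega>)) k \<in> borel_measurable M"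
  by (rule measurable_F_M[OF dsum_measurable]) (auto intro: grid_nonneg grid_strict_mono grid_adapted)

text \<open>The Riemann sums defining the integral at the dyadic fraction \<open>T * p / 2 ^ m\<close> use steps that are
  \<open>p\<close> times those of the grid of \<open>T\<close>; refining them changes the sum by a sum with small integrand.\<close>

lemma dsum_conv_ito:
  assumes "T > 0"
  shows "conv_prob (\<lambda>n. dsum (grid T 0 m n) (\<lambda>i \<omega>. \<sigma> (X (grid T 0 m n i) \<omega>)) (p * 2 ^ n)) (N (T * real p / 2 ^ m))"
proof -
  let ?v = "T * real p / 2 ^ m"
  let ?Y = "\<lambda>s \<omega>. \<sigma> (X s \<omega>)"
  let ?g = "\<lambda>n. grid T 0 m n"
  define H where "H n i \<omega> = ?Y (?g n (p * (i div p))) \<omega> - ?Y (?g n i) \<omega>" for n i \<omega>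
  have v: "0 \<le> ?v" using assms by simp
  have Hm: "H n i \<in> borel_measurable (\<F> (?g n i))" for n i
    unfolding H_def using assms by (intro borel_measurable_diff grid_adapted) auto
  have *: "dsum (?g n) (H n) (p * 2 ^ n) \<omega> = ito_sum W ?Y ?v n \<omega> - dsum (?g n) (\<lambda>i. ?Y (?g n i)) (p * 2 ^ n) \<omega>" for n \<omega>
    unfolding ito_sum_eq_dsum by (simp add: dsum_def H_def sum_subtractf[symmetric] algebra_simps)
  have dm: "dsum (?g n) (H n) (p * 2 ^ n) \<in> borel_measurable M" for n
    using assms Hm by (intro measurable_F_M[OF dsum_measurable] grid_nonneg grid_strict_mono)
  \<comment> \<open>Rounding down to the left end of a cell moves the time by at most
    \<open>?v / 2 ^ n\<close>, so uniform continuity of the path makes all \<open>H n i\<close>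
    small from some \<open>n\<close> on.\<close>
  have small: "(\<lambda>n. prob {\<omega>\<in>space M. \<exists>i\<in>{..<p * 2 ^ n}. \<bar>H n i \<omega>\<bar> > \<eta>}) \<longlonglongrightarrow> 0" if "\<eta> > 0" for \<eta>
  proof (rule prob_tendsto_0)
    fix n
    have [measurable]: "H n i \<in> borel_measurable M" for i by (rule measurable_F_M[OF Hm])
    show "{\<omega>\<in>space M. \<exists>i\<in>{..<p * 2 ^ n}. \<bar>H n i \<omega>\<bar> > \<eta>} \<in> events" by measurable
  next
    fix \<omega> assume \<omega>: "\<omega> \<in> space M"
    have "continuous_on {0..?v} (\<lambda>t. ?Y t \<omega>)"
      by (rule continuous_on_compose2[OF \<sigma>_cont continuous_on_subset[OF X_cont[OF \<omega>]]]) auto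
    then have "uniformly_continuous_on {0..?v} (\<lambda>t. ?Y t \<omega>)"
      by (rule compact_uniformly_continuous) simp
    then obtain d where d: "d > 0" "\<And>s r. s \<in> {0..?v} \<Longrightarrow> r \<in> {0..?v} \<Longrightarrow> dist r s < d \<Longrightarrow> dist (?Y r \<omega>) (?Y s \<omega>) < \<eta>"
      unfolding uniformly_continuous_on_def using \<open>\<eta> > 0\<close> by metis
    have "(\<lambda>n. ?v * (1 / 2) ^ n) \<longlonglongrightarrow> ?v * 0"
      by (intro tendsto_mult tendsto_const LIMSEQ_power_zero) auto
    then have "eventually (\<lambda>n. ?v * (1 / 2) ^ n < d) sequentially"
      using d(1) by (intro order_tendstoD) auto
    then show "\<forall>\<^sub>F n in sequentially. \<not> (\<exists>i\<in>{..<p * 2 ^ n}. \<bar>H n i \<omega>\<bar> > \<eta>)"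
    proof eventually_elim
      case (elim n)
      have "\<bar>H n i \<omega>\<bar> \<le> \<eta>" if i: "i < p * 2 ^ n" for i
      proof -
        let ?j = "p * (i div p)"
        have "p > 0" using i by (cases p) auto
        have j: "?j \<le> i" "i - ?j \<le> p" using mod_less_divisor[OF \<open>p > 0\<close>, of i]
          by (auto simp: minus_mult_div_eq_mod)
        have j': "real i - real ?j \<le> real p" using j of_nat_diff[OF j(1), where 'a=real] by linarith
        have top: "?g n (p * 2 ^ n) = ?v" using grid_block[of T 0 m n p] by simp
        have mono: "?g n k \<le> ?g n l" if "k \<le> l" for k l
          using strict_mono_less_eq[OF grid_strict_mono[OF assms]] that by blast
        have "?g n i - ?g n ?j = T * (real i - real ?j) / 2 ^ (m + n)"
          by (simp add: grid_def diff_divide_distrib algebra_simps)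
        also have "\<dots> \<le> T * real p / 2 ^ (m + n)"
          using j' assms by (intro divide_right_mono mult_left_mono) simp_all
        also have "\<dots> = ?v * (1 / 2) ^ n" by (simp add: power_add power_divide)
        finally have "dist (?g n ?j) (?g n i) < d"
          using elim mono[OF j(1)] by (simp add: dist_real_def)
        then have "dist (?Y (?g n ?j) \<omega>) (?Y (?g n i) \<omega>) < \<eta>"
          using mono[of i "p * 2 ^ n"] mono[OF j(1)] i top grid_nonneg[OF assms]
          by (intro d(2)) auto
        then show ?thesis by (simp add: H_def dist_real_def)
      qed
      then show ?case by (auto simp: not_less)
    qed
  qed
  have "conv_prob (\<lambda>n. dsum (?g n) (H n) (p * 2 ^ n)) (\<lambda>_. 0)"
    unfolding conv_prob_def
  proof (intro allI impI)
    fix \<kappa> :: real assume \<kappa>: "\<kappa> > 0"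
    show "(\<lambda>n. prob {\<omega>\<in>space M. \<bar>dsum (?g n) (H n) (p * 2 ^ n) \<omega> - 0\<bar> > \<kappa>}) \<longlonglongrightarrow> 0"
    proof (rule order_tendstoI)
      fix e :: real assume "e < 0"
      then show "\<forall>\<^sub>F n in sequentially. e < prob {\<omega>\<in>space M. \<bar>dsum (?g n) (H n) (p * 2 ^ n) \<omega> - 0\<bar> > \<kappa>}"
        by (auto intro!: always_eventually less_le_trans[OF _ measure_nonneg])
    next
      fix e :: real assume e: "0 < e"
      \<comment> \<open>Makes the Chebyshev term of \<open>dsum_maximal\<close> at most
        \<open>e / 2\<close>; the added 1 covers \<open>p = 0\<close>, where the interval is
        degenerate.\<close>
      define \<eta> where "\<eta> = sqrt (e * \<kappa>\<^sup>2 / (2 * (?v + 1)))"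
      have \<eta>: "\<eta> > 0" unfolding \<eta>_def using e \<kappa> v by (intro real_sqrt_gt_zero divide_pos_pos mult_pos_pos) auto
      have alg: "e * \<kappa>\<^sup>2 / (2 * (w + 1)) * w / \<kappa>\<^sup>2 = e / 2 * (w / (w + 1))" for w :: real
        using \<kappa> by simp
      have alg2: "w / (w + 1) \<le> 1" if "0 \<le> w" for w :: real using that by simp
      have "\<eta>\<^sup>2 = e * \<kappa>\<^sup>2 / (2 * (?v + 1))" unfolding \<eta>_def
        by (rule real_sqrt_pow2) (use e \<kappa> v in \<open>intro divide_nonneg_nonneg mult_nonneg_nonneg; simp\<close>)
      then have "\<eta>\<^sup>2 * ?v / \<kappa>\<^sup>2 = e / 2 * (?v / (?v + 1))" by (simp only: alg)
      also have "\<dots> \<le> e / 2 * 1" by (rule mult_left_mono[OF alg2[OF v]]) (use e in simp)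
      finally have \<eta>2: "\<eta>\<^sup>2 * ?v / \<kappa>\<^sup>2 \<le> e / 2" by simp
      have "eventually (\<lambda>n. prob {\<omega>\<in>space M. \<exists>i\<in>{..<p * 2 ^ n}. \<bar>H n i \<omega>\<bar> > \<eta>} < e / 2) sequentially"
        using small[OF \<eta>] e by (intro order_tendstoD) auto
      then show "\<forall>\<^sub>F n in sequentially. prob {\<omega>\<in>space M. \<bar>dsum (?g n) (H n) (p * 2 ^ n) \<omega> - 0\<bar> > \<kappa>} < e"
      proof eventually_elim
        case (elim n)
        have "prob {\<omega>\<in>space M. \<bar>dsum (?g n) (H n) (p * 2 ^ n) \<omega> - 0\<bar> > \<kappa>} \<le>
          prob {\<omega>\<in>space M. \<exists>k\<in>{..p * 2 ^ n}. \<bar>dsum (?g n) (H n) k \<omega>\<bar> > \<kappa>}"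
        proof (rule finite_measure_mono)
          have [measurable]: "dsum (?g n) (H n) k \<in> borel_measurable M" for k
            using assms Hm by (intro measurable_F_M[OF dsum_measurable] grid_nonneg grid_strict_mono)
          show "{\<omega>\<in>space M. \<exists>k\<in>{..p * 2 ^ n}. \<bar>dsum (?g n) (H n) k \<omega>\<bar> > \<kappa>} \<in> events" by measurable
        qed auto
        also have "\<dots> \<le> prob {\<omega>\<in>space M. \<exists>i<p * 2 ^ n. \<bar>H n i \<omega>\<bar> > \<eta>} +
            \<eta>\<^sup>2 * (?g n (p * 2 ^ n) - ?g n 0) / \<kappa>\<^sup>2"
          using dsum_maximal[of "?g n" "p * 2 ^ n" "H n" \<eta> \<kappa>] assms Hm \<eta> \<kappa>
          by (auto simp: Bex_def intro: grid_nonneg grid_strict_mono)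
        also have "?g n (p * 2 ^ n) - ?g n 0 = ?v" using grid_block[of T 0 m n p] by (simp add: grid_def)
        finally show ?case using elim[simplified Bex_def lessThan_iff] \<eta>2 by linarith
      qed
    qed
  qed
  moreover have "conv_prob (ito_sum W ?Y ?v) (N ?v)"
    using N_ito[OF v] unfolding is_ito_integral_def conv_prob_def by blast
  moreover have "ito_sum W ?Y ?v n \<in> borel_measurable M" for n
  proof -
    have "ito_sum W ?Y ?v n = (\<lambda>\<omega>. dsum (?g n) (H n) (p * 2 ^ n) \<omega> + dsum (?g n) (\<lambda>i. ?Y (?g n i)) (p * 2 ^ n) \<omega>)"
      by (auto simp: *)
    then show ?thesis using dm[of n] dsum_grid_measurable[OF assms] by simp
  qed
  ultimately have "conv_prob (\<lambda>n \<omega>. ito_sum W ?Y ?v n \<omega> - dsum (?g n) (H n) (p * 2 ^ n) \<omega>) (\<lambda>\<omega>. N ?v \<omega> - 0)"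
    using dm N_measurable[OF v] by (intro conv_prob_diff) auto
  then show ?thesis by (simp add: *)
qed

text \<open>On a common grid the sum up to \<open>c\<close> splits at the index
  \<open>a * 2 ^ n\<close>. The defining sums for the two end points have different steps and do not
  subtract in this way.\<close>

lemma dsum_conv_ito_increment:
  assumes "T > 0" "a \<le> c"
  shows "conv_prob (\<lambda>n. dsum (grid T a m n) (\<lambda>i \<omega>. \<sigma> (X (grid T a m n i) \<omega>)) ((c - a) * 2 ^ n))
     (\<lambda>\<omega>. N (T * real c / 2 ^ m) \<omega> - N (T * real a / 2 ^ m) \<omega>)"
proof -
  let ?d = "\<lambda>p n. dsum (grid T 0 m n) (\<lambda>i \<omega>. \<sigma> (X (grid T 0 m n i) \<omega>)) (p * 2 ^ n)"
  have "conv_prob (\<lambda>n \<omega>. ?d c n \<omega> - ?d a n \<omega>) (\<lambda>\<omega>. N (T * real c / 2 ^ m) \<omega> - N (T * real a / 2 ^ m) \<omega>)"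
    using assms(1) by (intro conv_prob_diff dsum_conv_ito N_measurable dsum_grid_measurable) auto
  moreover have "?d c n \<omega> - ?d a n \<omega> = dsum (grid T a m n) (\<lambda>i \<omega>. \<sigma> (X (grid T a m n i) \<omega>)) ((c - a) * 2 ^ n) \<omega>" for n \<omega>
  proof -
    have "c * 2 ^ n = a * 2 ^ n + (c - a) * 2 ^ n" using assms(2) by (simp add: diff_mult_distrib)
    then show ?thesis unfolding dsum_def
      by (simp only: sum_lessThan_shift grid_0_add) (simp add: grid_0_add flip: add_Suc_right)
  qed
  ultimately show ?thesis by simp
qed

end

section \<open>Oscillation probabilities\<close>

lemma run_max_increment_le:
  assumes cont: "continuous_on {0..} f" and "0 \<le> s" "s \<le> r"
    and le: "\<And>v. v \<in> {s..r} \<Longrightarrow> f v \<le> f s + e"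
  shows "run_max f r \<le> run_max f s + e"
proof -
  obtain v where v: "v \<in> {0..r}" "f v = run_max f r" using run_max_attained[OF cont, of r] assms by auto
  have e: "0 \<le> e" using le[of s] assms by auto
  show ?thesis
  proof (cases "v \<le> s")
    case True
    then show ?thesis using run_max_upper[OF cont, of v s] v e by auto
  next
    case False
    then show ?thesis using le[of v] run_max_upper[OF cont, of s s] v assms by auto
  qed
qed

lemma continuous_on_run_max:
  assumes cont: "continuous_on {0..} f"
  shows "continuous_on {0..t} (run_max f)"
proof (rule uniformly_continuous_imp_continuous)
  have uc: "uniformly_continuous_on {0..t} f"
    by (rule compact_uniformly_continuous[OF cont_upto[OF cont]]) simp
  show "uniformly_continuous_on {0..t} (run_max f)"
    unfolding uniformly_continuous_on_def
  proof (intro allI impI)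
    fix e :: real assume "0 < e"
    then obtain d where d: "d > 0" "\<And>s r. s \<in> {0..t} \<Longrightarrow> r \<in> {0..t} \<Longrightarrow> dist r s < d \<Longrightarrow> dist (f r) (f s) < e / 2"
      using uc unfolding uniformly_continuous_on_def by (metis half_gt_zero)
    have *: "\<bar>run_max f r - run_max f s\<bar> < e" if "0 \<le> s" "s \<le> r" "r \<le> t" "r - s < d" for s r
    proof -
      have "f v \<le> f s + e / 2" if "v \<in> {s..r}" for v
      proof -
        have "dist (f v) (f s) < e / 2"
          using that \<open>0 \<le> s\<close> \<open>r \<le> t\<close> \<open>r - s < d\<close> by (intro d(2)) (auto simp: dist_real_def)
        then show ?thesis unfolding dist_real_def by linarith
      qed
      then have "run_max f r \<le> run_max f s + e / 2"
        using that by (intro run_max_increment_le[OF cont]) auto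
      then show ?thesis using run_max_mono[OF cont, of s r] that \<open>0 < e\<close> by linarith
    qed
    have "dist (run_max f r) (run_max f s) < e" if "s \<in> {0..t}" "r \<in> {0..t}" "dist r s < d" for r s
    proof (cases "s \<le> r")
      case True
      then show ?thesis using *[of s r] that by (auto simp: dist_real_def)
    next
      case False
      then have "\<bar>run_max f s - run_max f r\<bar> < e" using that by (intro *) (auto simp: dist_real_def)
      then show ?thesis by (simp add: dist_real_def abs_minus_commute)
    qed
    then show "\<exists>d>0. \<forall>x\<in>{0..t}. \<forall>x'\<in>{0..t}. dist x' x < d \<longrightarrow> dist (run_max f x') (run_max f x) < e"
      using d(1) by blast
  qed
qed

lemma continuous_on_run_min:
  assumes "continuous_on {0..} f" shows "continuous_on {0..t} (run_min f)"
  unfolding run_min_uminus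
  by (intro continuous_on_minus continuous_on_run_max assms)

text \<open>A countable dense set of times that contains the grid points of every level. Conditions
  on whole stretches of the path are imposed only here, which keeps the events measurable;
  continuity recovers the other times.\<close>

definition dyadics :: "real \<Rightarrow> real set" where
  "dyadics T = (\<lambda>(i, l). T * real i / 2 ^ l) ` (UNIV :: (nat \<times> nat) set)"

lemma ball_dyadics: "(\<forall>q\<in>dyadics T. P q) \<longleftrightarrow> (\<forall>i l. P (T * real i / 2 ^ l))"
  by (auto simp: dyadics_def)

lemma bex_dyadics: "(\<exists>q\<in>dyadics T. P q) \<longleftrightarrow> (\<exists>i l. P (T * real i / 2 ^ l))"
  by (auto simp: dyadics_def)

lemma dyadicsI: "T * real i / 2 ^ l \<in> dyadics T"
  unfolding dyadics_def by (rule image_eqI[of _ _ "(i, l)"]) auto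

lemma dyadics_nonneg: "T > 0 \<Longrightarrow> q \<in> dyadics T \<Longrightarrow> 0 \<le> q"
  unfolding dyadics_def by auto

lemma dyadics_dense:
  assumes "T > 0" "0 \<le> s" "s < r" shows "\<exists>q\<in>dyadics T. s < q \<and> q < r"
proof -
  have "(\<lambda>l. T * (1 / 2) ^ l) \<longlonglongrightarrow> T * 0"
    by (intro tendsto_mult tendsto_const LIMSEQ_power_zero) auto
  then have "eventually (\<lambda>l. T * (1 / 2) ^ l < r - s) sequentially"
    using assms by (intro order_tendstoD(2)[where y="T * 0"]) auto
  then obtain l where l: "T * (1 / 2) ^ l < r - s" unfolding eventually_sequentially by auto
  define h where "h = T / 2 ^ l"
  have h: "0 < h" "h < r - s" using l assms by (auto simp: h_def power_divide)
  define i where "i = Suc (nat \<lfloor>s / h\<rfloor>)"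
  have fl: "real (nat \<lfloor>s / h\<rfloor>) = of_int \<lfloor>s / h\<rfloor>" using assms h by (simp add: of_nat_nat)
  have "s / h < real i" unfolding i_def using fl by (simp add: floor_less_iff[symmetric]) linarith
  then have 1: "s < h * real i" using h by (simp add: field_simps)
  have "real i \<le> s / h + 1" unfolding i_def using fl of_int_floor_le[of "s / h"] by simp
  then have "h * real i \<le> s + h" using h by (simp add: field_simps)
  then have 2: "h * real i < r" using h by simp
  have "h * real i \<in> dyadics T" using dyadicsI[of T i l] by (simp add: h_def)
  then show ?thesis using 1 2 by blast
qed

context perturbed_diffusion
begin

lemma X_cont_on: "\<omega> \<in> space M \<Longrightarrow> A \<subseteq> {0..} \<Longrightarrow> continuous_on A (\<lambda>t. X t \<omega>)"
  by (rule continuous_on_subset[OF X_cont])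

lemma U_cont: "\<omega> \<in> space M \<Longrightarrow> continuous_on {0..t} (\<lambda>t. U t \<omega>)"
  unfolding U_def
  by (intro continuous_on_diff continuous_on_mult continuous_on_const X_cont_on
      continuous_on_run_max continuous_on_run_min X_cont) auto

lemma N_increment:
  assumes "\<omega> \<in> space M" "0 \<le> s" "s \<le> r" and B: "\<And>v. v \<in> {s..r} \<Longrightarrow> \<bar>b (X v \<omega>)\<bar> \<le> B"
  shows "\<bar>(N r \<omega> - N s \<omega>) - (U r \<omega> - U s \<omega>)\<bar> \<le> B * (r - s)"
proof -
  have c: "continuous_on {p..q} (\<lambda>v. b (X v \<omega>))" if "0 \<le> p" for p q
    by (rule continuous_on_compose2[OF b_cont X_cont_on[OF assms(1)]]) (use that in auto)
  have "integral {0..s} (\<lambda>v. b (X v \<omega>)) + integral {s..r} (\<lambda>v. b (X v \<omega>)) = integral {0..r} (\<lambda>v. b (X v \<omega>))"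
    by (rule Henstock_Kurzweil_Integration.integral_combine) (use assms c in \<open>auto intro!: integrable_continuous_interval\<close>)
  then have "(N r \<omega> - N s \<omega>) - (U r \<omega> - U s \<omega>) = - integral {s..r} (\<lambda>v. b (X v \<omega>))"
    by (simp add: N_def)
  moreover have "norm (integral {s..r} (\<lambda>v. b (X v \<omega>))) \<le> B * (r - s)"
    by (rule integral_bound) (use assms c in auto)
  ultimately show ?thesis by simp
qed

text \<open>With \<zeta> = 0 it controls \<open>N\<close> itself, with \<zeta> = 1 the error of
  freezing \<sigma>. The integrand has to be bounded only up to the time of the deviation, which is
  what a stopping time would provide.\<close>

definition increment_event :: "real \<Rightarrow> real \<Rightarrow> real \<Rightarrow> nat \<Rightarrow> nat \<Rightarrow> nat \<Rightarrow> real \<Rightarrow> 'a set" where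
  "increment_event \<zeta> B T m a c \<kappa> = {\<omega>\<in>space M. \<exists>j\<in>{a..c}.
     \<kappa> < \<bar>N (T * real j / 2 ^ m) \<omega> - N (T * real a / 2 ^ m) \<omega>
        - \<zeta> * \<sigma> (X (T * real a / 2 ^ m) \<omega>) * (W (T * real j / 2 ^ m) \<omega> - W (T * real a / 2 ^ m) \<omega>)\<bar> \<and>
     (\<forall>q\<in>dyadics T. T * real a / 2 ^ m \<le> q \<and> q \<le> T * real j / 2 ^ m \<longrightarrow>
        \<bar>\<sigma> (X q \<omega>) - \<zeta> * \<sigma> (X (T * real a / 2 ^ m) \<omega>)\<bar> \<le> B)}"

lemma increment_event_sets: assumes "T > 0" shows "increment_event \<zeta> B T m a c \<kappa> \<in> events"
proof -
  have Nm: "N (T * real j / 2 ^ m) \<in> borel_measurable M"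
    and Wm: "W (T * real j / 2 ^ m) \<in> borel_measurable M"
    and Xm: "(\<lambda>\<omega>. \<sigma> (X (T * real j / 2 ^ m) \<omega>)) \<in> borel_measurable M" for j m
    using assms by (auto intro!: N_measurable measurable_compose[OF X_measurable \<sigma>_measurable] W_meas)
  show ?thesis unfolding increment_event_def ball_dyadics
  proof (intro sets.sets_Collect_finite_Ex sets.sets_Collect_conj sets.sets_Collect_countable_All
      sets.sets_Collect_imp sets.sets_Collect_const)
    fix j i l
    show "{\<omega>\<in>space M. \<kappa> < \<bar>N (T * real j / 2 ^ m) \<omega> - N (T * real a / 2 ^ m) \<omega>
        - \<zeta> * \<sigma> (X (T * real a / 2 ^ m) \<omega>) * (W (T * real j / 2 ^ m) \<omega> - W (T * real a / 2 ^ m) \<omega>)\<bar>} \<in> events"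
      by (intro borel_measurable_less borel_measurable_const borel_measurable_abs borel_measurable_diff
          borel_measurable_times Nm Wm Xm)
    show "{\<omega>\<in>space M. \<bar>\<sigma> (X (T * real i / 2 ^ l) \<omega>) - \<zeta> * \<sigma> (X (T * real a / 2 ^ m) \<omega>)\<bar> \<le> B} \<in> events"
      by (intro borel_measurable_le borel_measurable_const borel_measurable_abs borel_measurable_diff
          borel_measurable_times Xm)
  qed simp
qed

text \<open>A maximal inequality for the integral of \<sigma>(X) minus its frozen multiple, obtained
  on fine grids and passed to the limit. Half of \<kappa> absorbs the discretization error, whence
  the factor 4.\<close>

lemma prob_increment_event:
  assumes T: "T > 0" and "a \<le> c" "0 < \<kappa>" "0 \<le> B"
  shows "prob (increment_event \<zeta> B T m a c \<kappa>) \<le> 4 * B\<^sup>2 * (T * real c / 2 ^ m - T * real a / 2 ^ m) / \<kappa>\<^sup>2"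
proof -
  let ?v = "\<lambda>j. T * real j / 2 ^ m"
  let ?s = "?v a"
  let ?g = "grid T a m"
  define D where "D n i \<omega> = \<sigma> (X (?g n i) \<omega>) - \<zeta> * \<sigma> (X (?g n 0) \<omega>)" for n i \<omega>
  \<comment> \<open>Truncation makes the bound by \<open>B\<close> unconditional; on the event in
    question nothing is cut off before the deviation.\<close>
  define H where "H n i \<omega> = (if \<bar>D n i \<omega>\<bar> \<le> B then D n i \<omega> else 0)" for n i \<omega>
  let ?S = "\<lambda>n. dsum (?g n) (\<lambda>i \<omega>. \<sigma> (X (?g n i) \<omega>))"
  define err where "err n j = {\<omega>\<in>space M. \<bar>?S n ((j - a) * 2 ^ n) \<omega> - (N (?v j) \<omega> - N ?s \<omega>)\<bar> > \<kappa> / 2}" for n j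
  define mx where "mx n = {\<omega>\<in>space M. \<exists>k\<le>(c - a) * 2 ^ n. \<bar>dsum (?g n) (H n) k \<omega>\<bar> > \<kappa> / 2}" for n
  have g0: "?g n 0 = ?s" for n by (simp add: grid_def power_add)
  have gv: "?g n ((j - a) * 2 ^ n) = ?v j" if "a \<le> j" for n j using grid_block[of T a m n "j - a"] that by simp
  have gmono: "?g n k \<le> ?g n l" if "k \<le> l" for n k l
    using strict_mono_less_eq[OF grid_strict_mono[OF T]] that by blast
  have gdy: "?g n i \<in> dyadics T" for n i unfolding grid_def by (rule dyadicsI)
  have Dm: "D n i \<in> borel_measurable (\<F> (?g n i))" for n i
    unfolding D_def using T by (intro borel_measurable_diff borel_measurable_times borel_measurable_const grid_adapted) auto
  have Hm: "H n i \<in> borel_measurable (\<F> (?g n i))" for n i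
  proof -
    note [measurable] = Dm
    show ?thesis unfolding H_def by measurable
  qed
  have HB: "\<not> \<bar>H n i \<omega>\<bar> > B" for n i \<omega> using \<open>0 \<le> B\<close> by (simp add: H_def)
  have err_sets: "err n j \<in> events" for n j
  proof -
    have [measurable]: "?S n ((j - a) * 2 ^ n) \<in> borel_measurable M" "N (?v j) \<in> borel_measurable M" "N ?s \<in> borel_measurable M"
      using T by (auto intro!: dsum_grid_measurable N_measurable)
    show ?thesis unfolding err_def by measurable
  qed
  have mx_sets: "mx n \<in> events" for n
  proof -
    have [measurable]: "dsum (?g n) (H n) k \<in> borel_measurable M" for k
      using T Hm by (intro measurable_F_M[OF dsum_measurable] grid_nonneg grid_strict_mono)
    have "{\<omega>\<in>space M. \<exists>k\<in>{..(c - a) * 2 ^ n}. \<bar>dsum (?g n) (H n) k \<omega>\<bar> > \<kappa> / 2} \<in> events" by measurable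
    then show ?thesis by (simp add: mx_def Bex_def)
  qed
  have sub: "increment_event \<zeta> B T m a c \<kappa> \<subseteq> (\<Union>j\<in>{a..c}. err n j) \<union> mx n" for n
  proof
    fix \<omega> assume "\<omega> \<in> increment_event \<zeta> B T m a c \<kappa>"
    then obtain j where \<omega>: "\<omega> \<in> space M" and j: "j \<in> {a..c}"
      and big: "\<kappa> < \<bar>N (?v j) \<omega> - N ?s \<omega> - \<zeta> * \<sigma> (X ?s \<omega>) * (W (?v j) \<omega> - W ?s \<omega>)\<bar>"
      and ctl: "\<And>q. q \<in> dyadics T \<Longrightarrow> ?s \<le> q \<Longrightarrow> q \<le> ?v j \<Longrightarrow> \<bar>\<sigma> (X q \<omega>) - \<zeta> * \<sigma> (X ?s \<omega>)\<bar> \<le> B"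
      unfolding increment_event_def by blast
    let ?k = "(j - a) * 2 ^ n"
    show "\<omega> \<in> (\<Union>j\<in>{a..c}. err n j) \<union> mx n"
    proof (cases "\<omega> \<in> err n j")
      case True then show ?thesis using j by blast
    next
      case False
      have HD: "H n i \<omega> = D n i \<omega>" if "i < ?k" for i
        using ctl[OF gdy, of n i] gmono[of 0 i n] gmono[of i ?k n] that j gv[of j n] g0[of n]
        by (simp add: H_def D_def)
      have tel: "(\<Sum>i<?k. W (?g n (Suc i)) \<omega> - W (?g n i) \<omega>) = W (?v j) \<omega> - W ?s \<omega>"
        using j by (subst sum_lessThan_telescope) (simp add: gv g0)
      have "dsum (?g n) (H n) ?k \<omega> = (\<Sum>i<?k. D n i \<omega> * (W (?g n (Suc i)) \<omega> - W (?g n i) \<omega>))"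
        unfolding dsum_def by (intro sum.cong) (auto simp: HD)
      also have "\<dots> = ?S n ?k \<omega> - \<zeta> * \<sigma> (X ?s \<omega>) * (\<Sum>i<?k. W (?g n (Suc i)) \<omega> - W (?g n i) \<omega>)"
        unfolding sum_distrib_left by (simp add: dsum_def D_def g0 left_diff_distrib sum_subtractf[symmetric])
      finally have "dsum (?g n) (H n) ?k \<omega> = ?S n ?k \<omega> - \<zeta> * \<sigma> (X ?s \<omega>) * (W (?v j) \<omega> - W ?s \<omega>)"
        unfolding tel .
      moreover have "\<bar>?S n ?k \<omega> - (N (?v j) \<omega> - N ?s \<omega>)\<bar> \<le> \<kappa> / 2"
        using False \<omega> by (simp add: err_def)
      ultimately have "\<bar>dsum (?g n) (H n) ?k \<omega>\<bar> > \<kappa> / 2" using big by linarith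
      moreover have "?k \<le> (c - a) * 2 ^ n" using j by (intro mult_right_mono diff_le_mono) auto
      ultimately show ?thesis using \<omega> unfolding mx_def by blast
    qed
  qed
  have mxle: "prob (mx n) \<le> 4 * B\<^sup>2 * (?v c - ?s) / \<kappa>\<^sup>2" for n
  proof -
    have "prob (mx n) \<le> prob {\<omega>\<in>space M. \<exists>i<(c - a) * 2 ^ n. \<bar>H n i \<omega>\<bar> > B} +
        B\<^sup>2 * (?g n ((c - a) * 2 ^ n) - ?g n 0) / (\<kappa> / 2)\<^sup>2"
      unfolding mx_def using T Hm assms
      by (intro dsum_maximal grid_nonneg grid_strict_mono) auto
    also have "{\<omega>\<in>space M. \<exists>i<(c - a) * 2 ^ n. \<bar>H n i \<omega>\<bar> > B} = {}" using HB by blast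
    finally show ?thesis unfolding gv[OF \<open>a \<le> c\<close>] g0 by (simp add: power_divide field_simps)
  qed
  have le: "prob (increment_event \<zeta> B T m a c \<kappa>) \<le> (\<Sum>j\<in>{a..c}. prob (err n j)) + 4 * B\<^sup>2 * (?v c - ?s) / \<kappa>\<^sup>2" for n
  proof -
    have "prob (increment_event \<zeta> B T m a c \<kappa>) \<le> prob ((\<Union>j\<in>{a..c}. err n j) \<union> mx n)"
      by (rule finite_measure_mono[OF sub]) (use err_sets mx_sets in auto)
    also have "\<dots> \<le> prob (\<Union>j\<in>{a..c}. err n j) + prob (mx n)"
      by (rule measure_Un_le) (use err_sets mx_sets in auto)
    also have "prob (\<Union>j\<in>{a..c}. err n j) \<le> (\<Sum>j\<in>{a..c}. prob (err n j))"
      by (rule finite_measure_subadditive_finite) (use err_sets in auto)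
    finally show ?thesis using mxle[of n] by linarith
  qed
  \<comment> \<open>Only finitely many times \<open>j\<close> are involved, so the discretization
    errors vanish together.\<close>
  have "(\<lambda>n. (\<Sum>j\<in>{a..c}. prob (err n j)) + 4 * B\<^sup>2 * (?v c - ?s) / \<kappa>\<^sup>2) \<longlonglongrightarrow> (\<Sum>j\<in>{a..c}. 0) + 4 * B\<^sup>2 * (?v c - ?s) / \<kappa>\<^sup>2"
  proof (intro tendsto_add tendsto_const tendsto_sum)
    fix j assume "j \<in> {a..c}"
    then have "a \<le> j" by simp
    show "(\<lambda>n. prob (err n j)) \<longlonglongrightarrow> 0" unfolding err_def
      by (rule dsum_conv_ito_increment[OF T \<open>a \<le> j\<close>, of m, unfolded conv_prob_def, rule_format])
         (use \<open>0 < \<kappa>\<close> in simp)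
  qed
  then have "prob (increment_event \<zeta> B T m a c \<kappa>) \<le> (\<Sum>j\<in>{a..c}. 0) + 4 * B\<^sup>2 * (?v c - ?s) / \<kappa>\<^sup>2"
    by (rule LIMSEQ_le_const) (use le in blast)
  then show ?thesis by simp
qed

text \<open>Let \<open>v0\<close> be the first time at which \<open>X\<close> has moved by \<theta>.
  By the oscillation hypothesis \<open>U\<close> has moved by more than \<open>D\<close> at some
  time up to \<open>v0\<close>, and continuity allows this to be a dyadic time before
  \<open>v0\<close>, until which \<open>X\<close> stays within \<theta>.\<close>

lemma U_exceeds_at_dyadic:
  assumes \<omega>: "\<omega> \<in> space M" and "T > 0" "0 \<le> s" "0 < \<theta>" "0 \<le> D"
    and C: "\<And>v. s \<le> v \<Longrightarrow> (\<And>w. w \<in> {s..v} \<Longrightarrow> \<bar>U w \<omega> - U s \<omega>\<bar> \<le> D) \<Longrightarrow> \<bar>X v \<omega> - X s \<omega>\<bar> < \<theta>"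
    and q: "s \<le> q" "q \<le> r" "\<bar>X q \<omega> - X s \<omega>\<bar> > \<theta>"
  obtains w where "w \<in> dyadics T" "s \<le> w" "w \<le> r" "\<bar>U w \<omega> - U s \<omega>\<bar> > D"
    "\<And>v. s \<le> v \<Longrightarrow> v \<le> w \<Longrightarrow> \<bar>X v \<omega> - X s \<omega>\<bar> \<le> \<theta>"
proof -
  define A where "A = {v \<in> {s..q}. \<theta> \<le> \<bar>X v \<omega> - X s \<omega>\<bar>}"
  have "continuous_on {s..q} (\<lambda>v. \<bar>X v \<omega> - X s \<omega>\<bar>)"
    by (intro continuous_intros X_cont_on[OF \<omega>]) (use \<open>0 \<le> s\<close> in auto)
  then have "closed ({s..q} \<inter> (\<lambda>v. \<bar>X v \<omega> - X s \<omega>\<bar>) -` {\<theta>..})"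
    by (rule continuous_closed_preimage) auto
  also have "{s..q} \<inter> (\<lambda>v. \<bar>X v \<omega> - X s \<omega>\<bar>) -` {\<theta>..} = A" by (auto simp: A_def)
  finally have "closed A" .
  moreover have bdd: "bdd_below A" unfolding A_def by (rule bdd_belowI[of _ s]) auto
  moreover have "A \<noteq> {}" using q unfolding A_def by auto
  ultimately have v0: "Inf A \<in> A" by (intro closed_contains_Inf)
  define v0 where "v0 = Inf A"
  have v: "s \<le> v0" "v0 \<le> q" "\<theta> \<le> \<bar>X v0 \<omega> - X s \<omega>\<bar>" using v0 by (auto simp: A_def v0_def)
  have below: "\<bar>X v \<omega> - X s \<omega>\<bar> < \<theta>" if "s \<le> v" "v < v0" for v
  proof (rule ccontr)
    assume "\<not> \<bar>X v \<omega> - X s \<omega>\<bar> < \<theta>"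
    then have "v \<in> A" using that v by (auto simp: A_def)
    then show False using cInf_lower[OF _ bdd, of v] that by (auto simp: v0_def)
  qed
  obtain w where w: "w \<in> {s..v0}" "\<bar>U w \<omega> - U s \<omega>\<bar> > D"
    using C[OF v(1)] v(3) by (meson not_le)
  have "w \<noteq> s" using w \<open>0 \<le> D\<close> by auto
  then have "s < w" using w by auto
  \<comment> \<open>Approximation from the left, as a time after \<open>w\<close> could lie beyond
    \<open>v0\<close>.\<close>
  have "continuous_on {0..w} (\<lambda>v. \<bar>U v \<omega> - U s \<omega>\<bar>)" by (intro continuous_intros U_cont[OF \<omega>])
  then have "((\<lambda>v. \<bar>U v \<omega> - U s \<omega>\<bar>) \<longlongrightarrow> \<bar>U w \<omega> - U s \<omega>\<bar>) (at w within {0..w})"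
    using \<open>s < w\<close> \<open>0 \<le> s\<close> unfolding continuous_on_def by auto
  then have "eventually (\<lambda>v. \<bar>U v \<omega> - U s \<omega>\<bar> > D) (at w within {0..w})"
    using w(2) by (rule order_tendstoD)
  then obtain d where d: "d > 0" "\<And>v. v \<in> {0..w} \<Longrightarrow> v \<noteq> w \<Longrightarrow> dist v w < d \<Longrightarrow> \<bar>U v \<omega> - U s \<omega>\<bar> > D"
    unfolding eventually_at by blast
  obtain p where p: "p \<in> dyadics T" "max s (w - d) < p" "p < w"
  proof -
    have "0 \<le> max s (w - d)" "max s (w - d) < w" using \<open>s < w\<close> \<open>0 \<le> s\<close> d(1) by auto
    then show ?thesis using dyadics_dense[OF \<open>T > 0\<close>] that by blast
  qed
  show ?thesis
  proof (rule that[of p])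
    show "\<bar>U p \<omega> - U s \<omega>\<bar> > D"
      by (rule d(2)) (use p \<open>0 \<le> s\<close> in \<open>auto simp: dist_real_def\<close>)
    show "\<bar>X v \<omega> - X s \<omega>\<bar> \<le> \<theta>" if "s \<le> v" "v \<le> p" for v
      using below[of v] that p w by auto
  qed (use p w v q in auto)
qed

text \<open>A move of \<open>X\<close> by \<theta> forces a move of \<open>U\<close> by 2 *
  \<kappa>, hence of the martingale part by \<kappa> if the drift contributes at most \<kappa>. The
  coefficients need bounds only up to K + \<theta>, because the path is watched only until it has
  moved by \<theta>.\<close>

lemma prob_oscillation:
  obtains C where "C > 0"
    "\<And>T a c m K \<theta> Bs Bb. T > 0 \<Longrightarrow> a \<le> c \<Longrightarrow> 0 \<le> K \<Longrightarrow> 0 < \<theta> \<Longrightarrow>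
      (\<And>y. \<bar>y\<bar> \<le> K + \<theta> \<Longrightarrow> \<bar>\<sigma> y\<bar> \<le> Bs) \<Longrightarrow> (\<And>y. \<bar>y\<bar> \<le> K + \<theta> \<Longrightarrow> \<bar>b y\<bar> \<le> Bb) \<Longrightarrow>
      Bb * (T * real c / 2 ^ m - T * real a / 2 ^ m) \<le> \<theta> / (4 * C) \<Longrightarrow>
      prob {\<omega>\<in>space M. \<bar>X (T * real a / 2 ^ m) \<omega>\<bar> \<le> K \<and>
        (\<exists>q\<in>dyadics T. T * real a / 2 ^ m \<le> q \<and> q \<le> T * real c / 2 ^ m \<and> \<bar>X q \<omega> - X (T * real a / 2 ^ m) \<omega>\<bar> > \<theta>)}
      \<le> 64 * C\<^sup>2 * Bs\<^sup>2 * (T * real c / 2 ^ m - T * real a / 2 ^ m) / \<theta>\<^sup>2"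
proof -
  obtain C where C: "C > 0"
    "\<And>f s r v D. continuous_on {0..} f \<Longrightarrow> 0 \<le> s \<Longrightarrow> s \<le> v \<Longrightarrow> v \<le> r \<Longrightarrow>
      (\<And>w. w \<in> {s..r} \<Longrightarrow> \<bar>(f w - \<alpha> * run_max f w - \<beta> * run_min f w) -
         (f s - \<alpha> * run_max f s - \<beta> * run_min f s)\<bar> \<le> D) \<Longrightarrow> \<bar>f v - f s\<bar> \<le> C * D"
    using oscillation_bound[OF \<alpha> \<beta> \<rho>] by blast
  show ?thesis
  proof (rule that[OF C(1)])
    fix T :: real and a c m :: nat and K \<theta> Bs Bb :: real
    let ?s = "T * real a / 2 ^ m" and ?r = "T * real c / 2 ^ m"
    assume T: "T > 0" and ac: "a \<le> c" and K: "0 \<le> K" and \<theta>: "0 < \<theta>"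
      and Bs: "\<And>y. \<bar>y\<bar> \<le> K + \<theta> \<Longrightarrow> \<bar>\<sigma> y\<bar> \<le> Bs" and Bb: "\<And>y. \<bar>y\<bar> \<le> K + \<theta> \<Longrightarrow> \<bar>b y\<bar> \<le> Bb"
      and drift: "Bb * (?r - ?s) \<le> \<theta> / (4 * C)"
    define V where "V = {\<omega>\<in>space M. \<bar>X ?s \<omega>\<bar> \<le> K \<and>
        (\<exists>q\<in>dyadics T. ?s \<le> q \<and> q \<le> ?r \<and> \<bar>X q \<omega> - X ?s \<omega>\<bar> > \<theta>)}"
    \<comment> \<open>With this \<kappa> a move of \<open>U\<close> by at most 2 * \<kappa> moves
      \<open>X\<close> by at most \<theta> / 2, and one \<kappa> is left for the drift.\<close>
    define \<kappa> where "\<kappa> = \<theta> / (4 * C)"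
    have \<kappa>: "\<kappa> > 0" unfolding \<kappa>_def using \<theta> C by simp
    have B0: "0 \<le> Bs" "0 \<le> Bb" using Bs[of 0] Bb[of 0] K \<theta> by auto
    have s0: "0 \<le> ?s" using T by simp
    \<comment> \<open>The deviation happens at a dyadic time of unknown level. Refining the level
      enlarges the event, and the bound does not depend on the level.\<close>
    define R where "R l = increment_event 0 Bs T (m + l) (a * 2 ^ l) (c * 2 ^ l) \<kappa>" for l
    have coarse: "T * real (j * 2 ^ l) / 2 ^ (m + l) = T * real j / 2 ^ m" for j l
      by (simp add: power_add)
    have R_eq: "R l = {\<omega>\<in>space M. \<exists>j\<in>{a * 2 ^ l..c * 2 ^ l}.
       \<kappa> < \<bar>N (T * real j / 2 ^ (m + l)) \<omega> - N ?s \<omega>\<bar> \<and>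
       (\<forall>q\<in>dyadics T. ?s \<le> q \<and> q \<le> T * real j / 2 ^ (m + l) \<longrightarrow> \<bar>\<sigma> (X q \<omega>)\<bar> \<le> Bs)}" for l
      unfolding R_def increment_event_def coarse by simp
    have R_sets: "R l \<in> events" for l unfolding R_def by (rule increment_event_sets[OF T])
    have inc: "incseq R"
    proof (rule incseq_SucI)
      fix l show "R l \<subseteq> R (Suc l)"
      proof
        fix \<omega> assume "\<omega> \<in> R l"
        then obtain j where j: "\<omega> \<in> space M" "j \<in> {a * 2 ^ l..c * 2 ^ l}" 
          "\<kappa> < \<bar>N (T * real j / 2 ^ (m + l)) \<omega> - N ?s \<omega>\<bar>"
          "\<forall>q\<in>dyadics T. ?s \<le> q \<and> q \<le> T * real j / 2 ^ (m + l) \<longrightarrow> \<bar>\<sigma> (X q \<omega>)\<bar> \<le> Bs"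
          unfolding R_eq by blast
        have "T * real (2 * j) / 2 ^ (m + Suc l) = T * real j / 2 ^ (m + l)" by simp
        then show "\<omega> \<in> R (Suc l)" unfolding R_eq using j by (auto intro!: bexI[of _ "2 * j"])
      qed
    qed
    have "V \<subseteq> (\<Union>l. R l)"
    proof
      fix \<omega> assume "\<omega> \<in> V"
      then obtain q where \<omega>: "\<omega> \<in> space M" and XK: "\<bar>X ?s \<omega>\<bar> \<le> K"
        and q: "?s \<le> q" "q \<le> ?r" "\<bar>X q \<omega> - X ?s \<omega>\<bar> > \<theta>" unfolding V_def by blast
      obtain w where w: "w \<in> dyadics T" "?s \<le> w" "w \<le> ?r" "\<bar>U w \<omega> - U ?s \<omega>\<bar> > 2 * \<kappa>"
        "\<And>v. ?s \<le> v \<Longrightarrow> v \<le> w \<Longrightarrow> \<bar>X v \<omega> - X ?s \<omega>\<bar> \<le> \<theta>"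
      proof (rule U_exceeds_at_dyadic[OF \<omega> T s0 \<theta> _ _ q, of "2 * \<kappa>"])
        fix v assume "?s \<le> v" and osc: "\<And>w. w \<in> {?s..v} \<Longrightarrow> \<bar>U w \<omega> - U ?s \<omega>\<bar> \<le> 2 * \<kappa>"
        have "\<bar>X v \<omega> - X ?s \<omega>\<bar> \<le> C * (2 * \<kappa>)"
          by (rule C(2)[OF X_cont[OF \<omega>] s0 \<open>?s \<le> v\<close> order_refl]) (use osc in \<open>simp add: U_def\<close>)
        also have "C * (2 * \<kappa>) < \<theta>" unfolding \<kappa>_def using C(1) \<theta> by (simp add: field_simps)
        finally show "\<bar>X v \<omega> - X ?s \<omega>\<bar> < \<theta>" .
      qed (use \<kappa> in auto)
      have XB: "\<bar>X v \<omega>\<bar> \<le> K + \<theta>" if "?s \<le> v" "v \<le> w" for v using w(5)[OF that] XK by linarith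
      have "\<bar>(N w \<omega> - N ?s \<omega>) - (U w \<omega> - U ?s \<omega>)\<bar> \<le> Bb * (w - ?s)"
        using XB by (intro N_increment[OF \<omega> s0 w(2)] Bb) auto
      also have "\<dots> \<le> Bb * (?r - ?s)" using B0 w by (intro mult_left_mono) auto
      also have "\<dots> \<le> \<kappa>" using drift by (simp add: \<kappa>_def)
      finally have Nbig: "\<kappa> < \<bar>N w \<omega> - N ?s \<omega>\<bar>" using w(4) by linarith
      obtain i l where il: "w = T * real i / 2 ^ l" using w(1) unfolding dyadics_def by auto
      \<comment> \<open>A common level \<open>m + l\<close> for \<open>w\<close> and for the end
        points of the interval.\<close>
      have wj: "w = T * real (i * 2 ^ m) / 2 ^ (m + l)" unfolding il by (simp add: power_add)
      have cmp: "T * real j / 2 ^ m \<le> w \<longleftrightarrow> j * 2 ^ l \<le> i * 2 ^ m" "w \<le> T * real j / 2 ^ m \<longleftrightarrow> i * 2 ^ m \<le> j * 2 ^ l" for j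
        unfolding wj coarse[of j l, symmetric] using T by (simp_all add: divide_le_cancel del: of_nat_mult)
      have "i * 2 ^ m \<in> {a * 2 ^ l..c * 2 ^ l}" using w cmp by auto
      then have "\<omega> \<in> R l" unfolding R_eq using \<omega> Nbig XB Bs wj
        by (intro CollectI conjI bexI[of _ "i * 2 ^ m"]) auto
      then show "\<omega> \<in> (\<Union>l. R l)" by blast
    qed
    then have "prob V \<le> prob (\<Union>l. R l)" by (rule finite_measure_mono) (use R_sets in auto)
    also have "\<dots> \<le> 64 * C\<^sup>2 * Bs\<^sup>2 * (?r - ?s) / \<theta>\<^sup>2"
    proof (rule LIMSEQ_le_const2)
      show "(\<lambda>l. prob (R l)) \<longlonglongrightarrow> prob (\<Union>l. R l)"
        by (rule finite_Lim_measure_incseq[OF _ inc]) (use R_sets in auto)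
      have "prob (R l) \<le> 4 * Bs\<^sup>2 * (?r - ?s) / \<kappa>\<^sup>2" for l
        unfolding R_def using prob_increment_event[OF T, of "a * 2 ^ l" "c * 2 ^ l" \<kappa> Bs 0 "m + l"] ac \<kappa> B0
        unfolding coarse by simp
      also have "4 * Bs\<^sup>2 * (?r - ?s) / \<kappa>\<^sup>2 = 64 * C\<^sup>2 * Bs\<^sup>2 * (?r - ?s) / \<theta>\<^sup>2"
        unfolding \<kappa>_def by (simp add: power_divide power_mult_distrib)
      finally show "\<exists>N. \<forall>l\<ge>N. prob (R l) \<le> 64 * C\<^sup>2 * Bs\<^sup>2 * (?r - ?s) / \<theta>\<^sup>2" by blast
    qed
    finally show "prob {\<omega>\<in>space M. \<bar>X ?s \<omega>\<bar> \<le> K \<and>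
        (\<exists>q\<in>dyadics T. ?s \<le> q \<and> q \<le> ?r \<and> \<bar>X q \<omega> - X ?s \<omega>\<bar> > \<theta>)}
      \<le> 64 * C\<^sup>2 * Bs\<^sup>2 * (?r - ?s) / \<theta>\<^sup>2" unfolding V_def .
  qed
qed

end

section \<open>Gaussian shifts and window averages\<close>

lemma integral_indicator_upto:
  fixes f :: "real \<Rightarrow> real"
  assumes "integrable lborel f"
  shows "(\<integral>w. indicator {a<..} w * f (w - v) \<partial>lborel) = (\<integral>w. indicator {a - v<..} w * f w \<partial>lborel)"
  using lborel_integral_real_affine[of 1 "\<lambda>w. indicator {a<..} w * f (w - v)" v]
  by (simp add: indicator_def algebra_simps less_diff_eq)

text \<open>The total variation argument: the shifted density is the larger one to the right of v /
  2 and the smaller one elsewhere, so the worst \<open>g\<close> is the indicator of that half-line.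
  What remains is the Gaussian mass of an interval of length \<open>v\<close>, and the density is at
  most 1 / s.\<close>

lemma normal_shift_upper:
  assumes s: "s > 0" and g: "g \<in> borel_measurable borel" "\<And>w. 0 \<le> g w" "\<And>w. g w \<le> 1" and v: "0 \<le> v"
  shows "(\<integral>w. normal_density 0 s w * g (w + v) \<partial>lborel) - (\<integral>w. normal_density 0 s w * g w \<partial>lborel) \<le> v / s"
proof -
  let ?n = "normal_density 0 s"
  have int: "integrable lborel ?n" by (rule integrable_normal_density[OF s])
  have int': "integrable lborel (\<lambda>w. ?n (w - v))"
    using lborel_integrable_real_affine[OF int, of 1 "- v"] by simp
  have ig: "integrable lborel (\<lambda>w. f w * h w)"
    if "integrable lborel f" "h \<in> borel_measurable borel" "\<And>w. 0 \<le> h w" "\<And>w. h w \<le> 1" for f h :: "real \<Rightarrow> real"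
  proof (rule Bochner_Integration.integrable_bound[OF that(1)])
    show "(\<lambda>w. f w * h w) \<in> borel_measurable lborel"
      using that(1,2) by (intro borel_measurable_times) auto
    show "AE w in lborel. norm (f w * h w) \<le> norm (f w)"
      using that(3,4) by (intro AE_I2) (auto simp: abs_mult intro: mult_left_le)
  qed
  note i1 = ig[OF int' g] and i2 = ig[OF int g]
  have i3: "integrable lborel (\<lambda>w. indicator {v/2<..} w * ?n (w - v))"
    using ig[OF int', of "indicator {v/2<..}"] by (simp add: mult.commute)
  have i4: "integrable lborel (\<lambda>w. indicator {a<..} w * ?n w)" for a
    using ig[OF int, of "indicator {a<..}"] by (simp add: mult.commute)
  have "(\<integral>w. ?n w * g (w + v) \<partial>lborel) = (\<integral>w. ?n (w - v) * g w \<partial>lborel)"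
    using lborel_integral_real_affine[of 1 "\<lambda>w. ?n (w - v) * g w" v] by (simp add: add.commute)
  then have "(\<integral>w. ?n w * g (w + v) \<partial>lborel) - (\<integral>w. ?n w * g w \<partial>lborel) =
      (\<integral>w. ?n (w - v) * g w - ?n w * g w \<partial>lborel)"
    using i1 i2 by simp
  also have "\<dots> \<le> (\<integral>w. indicator {v/2<..} w * ?n (w - v) - indicator {v/2<..} w * ?n w \<partial>lborel)"
  proof (rule integral_mono)
    fix w
    show "?n (w - v) * g w - ?n w * g w \<le> indicator {v/2<..} w * ?n (w - v) - indicator {v/2<..} w * ?n w"
    proof (cases "v / 2 < w")
      case True
      then have "(w - v)\<^sup>2 \<le> w\<^sup>2" using v mult_left_mono[of v "2 * w" v] by (simp add: power2_eq_square algebra_simps)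
      then have "?n w \<le> ?n (w - v)" using s unfolding normal_density_def
        by (intro mult_left_mono) (auto intro!: divide_right_mono)
      then have "(?n (w - v) - ?n w) * g w \<le> ?n (w - v) - ?n w" using g by (intro mult_left_le) auto
      then show ?thesis using True by (simp add: algebra_simps)
    next
      case False
      then have "w\<^sup>2 \<le> (w - v)\<^sup>2" using v mult_left_mono[of "2 * w" v v] by (simp add: power2_eq_square algebra_simps)
      then have "?n (w - v) \<le> ?n w" using s unfolding normal_density_def
        by (intro mult_left_mono) (auto intro!: divide_right_mono)
      then have "(?n (w - v) - ?n w) * g w \<le> 0" using g by (intro mult_nonpos_nonneg) auto
      then show ?thesis using False by (simp add: algebra_simps)
    qed
  qed (use i1 i2 i3 i4 in auto)
  also have "\<dots> = (\<integral>w. indicator {v/2 - v<..} w * ?n w \<partial>lborel) - (\<integral>w. indicator {v/2<..} w * ?n w \<partial>lborel)"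
    using i3 i4 by (simp add: integral_indicator_upto[OF int])
  also have "\<dots> = (\<integral>w. indicator {v/2 - v<..} w * ?n w - indicator {v/2<..} w * ?n w \<partial>lborel)"
    using i4 by simp
  also have "\<dots> \<le> (\<integral>w. indicator {v/2 - v<..v/2} w * (1 / s) \<partial>lborel)"
  proof (rule integral_mono)
    fix w
    have "1 \<le> sqrt (2 * pi)" using pi_gt3 by (intro real_le_rsqrt) simp
    then have "1 / sqrt (2 * pi * s\<^sup>2) \<le> 1 / s"
      using s by (intro divide_left_mono) (auto simp: real_sqrt_mult)
    moreover have "exp (- (w - 0)\<^sup>2 / (2 * s\<^sup>2)) \<le> 1" by simp
    ultimately have "?n w \<le> 1 / s * 1" unfolding normal_density_def using s by (intro mult_mono) auto
    then show "indicator {v/2 - v<..} w * ?n w - indicator {v/2<..} w * ?n w \<le> indicator {v/2 - v<..v/2} w * (1 / s)"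
      using v by (auto simp: indicator_def)
  next
    have "integrable lborel (indicator {v/2 - v<..v/2} :: real \<Rightarrow> real)"
      by (rule integrable_real_indicator) (use v in auto)
    then show "integrable lborel (\<lambda>w. indicator {v/2 - v<..v/2} w * (1 / s))"
      by (rule integrable_mult_left)
  qed (use i4 in auto)
  also have "\<dots> = v / s" using v by simp
  finally show ?thesis .
qed

text \<open>The lower bound is the upper bound for 1 - g; a negative shift is undone by a positive
  shift of the translated function.\<close>

lemma normal_shift_le:
  assumes s: "s > 0" and g: "g \<in> borel_measurable borel" "\<And>w. 0 \<le> g w" "\<And>w. g w \<le> 1"
  shows "\<bar>(\<integral>w. normal_density 0 s w * g (w + v) \<partial>lborel) - (\<integral>w. normal_density 0 s w * g w \<partial>lborel)\<bar> \<le> \<bar>v\<bar> / s"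
proof -
  let ?n = "normal_density 0 s"
  let ?I = "\<lambda>g v. \<integral>w. ?n w * g (w + v) \<partial>lborel"
  have nonneg: "\<bar>?I g v - ?I g 0\<bar> \<le> v / s"
    if g: "g \<in> borel_measurable borel" "\<And>w. 0 \<le> g w" "\<And>w. g w \<le> 1" and "0 \<le> v" for g :: "real \<Rightarrow> real" and v
  proof -
    have up: "?I g v - ?I g 0 \<le> v / s" using normal_shift_upper[OF s g \<open>0 \<le> v\<close>] by simp
    have i: "integrable lborel (\<lambda>w. ?n w * g (w + u))" for u
    proof (rule Bochner_Integration.integrable_bound[OF integrable_normal_density[OF s]])
      show "(\<lambda>w. ?n w * g (w + u)) \<in> borel_measurable lborel" using g(1) by simp
      show "AE w in lborel. norm (?n w * g (w + u)) \<le> norm (?n w)"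
        using g(2,3) by (intro AE_I2) (auto simp: abs_mult intro: mult_left_le)
    qed
    have one: "?I (\<lambda>w. 1 - g w) u = 1 - ?I g u" for u
      using i[of u] integrable_normal_density[OF s, of 0] integral_normal_density[OF s, of 0]
      by (simp add: right_diff_distrib)
    have "?I (\<lambda>w. 1 - g w) v - ?I (\<lambda>w. 1 - g w) 0 \<le> v / s"
      using normal_shift_upper[OF s, of "\<lambda>w. 1 - g w" v] g \<open>0 \<le> v\<close> by simp
    then show ?thesis using up unfolding one by linarith
  qed
  show ?thesis
  proof (cases "0 \<le> v")
    case True
    then show ?thesis using nonneg[OF g True] by simp
  next
    case False
    have "\<bar>?I (\<lambda>w. g (w + v)) (- v) - ?I (\<lambda>w. g (w + v)) 0\<bar> \<le> - v / s"
      by (rule nonneg) (use g False in auto)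
    then show ?thesis using False by (simp add: abs_minus_commute)
  qed
qed

text \<open>Fubini for the product law: the bound is needed only with the first variable frozen at
  each of its values.\<close>

lemma (in prob_space) indep_expectation_bound:
  assumes ind: "indep_var N P N' Q"
    and H: "H \<in> borel_measurable (N \<Otimes>\<^sub>M N')" "\<And>z. \<bar>H z\<bar> \<le> 1"
    and le: "\<And>p. p \<in> space N \<Longrightarrow> \<bar>expectation (\<lambda>\<omega>. H (p, Q \<omega>))\<bar> \<le> e"
  shows "\<bar>expectation (\<lambda>\<omega>. H (P \<omega>, Q \<omega>)) :: real\<bar> \<le> e"
proof -
  have [measurable]: "P \<in> measurable M N" "Q \<in> measurable M N'" using ind by (auto dest: indep_var_rv1 indep_var_rv2)
  let ?P = "distr M N P" and ?Q = "distr M N' Q"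
  interpret P: prob_space ?P by (rule prob_space_distr) simp
  interpret Q: prob_space ?Q by (rule prob_space_distr) simp
  interpret PQ: pair_prob_space ?P ?Q ..
  have Hm: "H \<in> borel_measurable (?P \<Otimes>\<^sub>M ?Q)" using H(1) by (simp cong: measurable_cong_sets)
  have Hi: "integrable (?P \<Otimes>\<^sub>M ?Q) H"
    by (rule PQ.integrable_const_bound[of _ 1]) (use Hm H(2) in auto)
  have "expectation (\<lambda>\<omega>. H (P \<omega>, Q \<omega>)) = integral\<^sup>L (distr M (N \<Otimes>\<^sub>M N') (\<lambda>\<omega>. (P \<omega>, Q \<omega>))) H"
    using H(1) by (subst integral_distr) auto
  also have "\<dots> = integral\<^sup>L (?P \<Otimes>\<^sub>M ?Q) H"
    using ind unfolding indep_var_distribution_eq by simp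
  also have "\<dots> = (\<integral>p. (\<integral>q. H (p, q) \<partial>?Q) \<partial>?P)"
    using PQ.integral_fst'[OF Hi] by simp
  finally have eq: "expectation (\<lambda>\<omega>. H (P \<omega>, Q \<omega>)) = (\<integral>p. (\<integral>q. H (p, q) \<partial>?Q) \<partial>?P)" .
  have inner: "\<bar>\<integral>q. H (p, q) \<partial>?Q\<bar> \<le> e" if "p \<in> space ?P" for p
  proof -
    have "p \<in> space N" using that by simp
    then have "(\<lambda>q. H (p, q)) \<in> borel_measurable N'" using H(1) by simp
    then have "(\<integral>q. H (p, q) \<partial>?Q) = expectation (\<lambda>\<omega>. H (p, Q \<omega>))" by (subst integral_distr) auto
    then show ?thesis using le[OF \<open>p \<in> space N\<close>] by simp
  qed
  have "\<bar>\<integral>p. (\<integral>q. H (p, q) \<partial>?Q) \<partial>?P\<bar> \<le> (\<integral>p. \<bar>\<integral>q. H (p, q) \<partial>?Q\<bar> \<partial>?P)"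
    by (rule integral_abs_bound)
  also have "\<dots> \<le> (\<integral>p. e \<partial>?P)"
    by (rule integral_mono) (use PQ.integrable_fst'[OF Hi] inner in auto)
  also have "\<dots> = e" using P.prob_space by simp
  finally show ?thesis unfolding eq .
qed

text \<open>Given the past, adding \<open>u\<close> to the argument of \<open>g\<close> is the same
  as shifting the increment by u / Z, which is at most u / c in absolute value, against a standard
  deviation of sqrt (r - s).\<close>

lemma (in brownian) increment_shift_bound:
  assumes sr: "0 \<le> s" "s < r"
    and Y: "Y \<in> borel_measurable (\<F> s)" and Z: "Z \<in> borel_measurable (\<F> s)" and A: "A \<in> sets (\<F> s)"
    and c: "0 < c" "\<And>\<omega>. \<omega> \<in> A \<Longrightarrow> c \<le> \<bar>Z \<omega>\<bar>"
    and g: "g \<in> borel_measurable borel" "\<And>w. 0 \<le> g w" "\<And>w. g w \<le> 1" and u: "0 \<le> u"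
  shows "\<bar>expectation (\<lambda>\<omega>. indicator A \<omega> * (g (Y \<omega> + Z \<omega> * (W r \<omega> - W s \<omega>) + u) - g (Y \<omega> + Z \<omega> * (W r \<omega> - W s \<omega>))))\<bar>
    \<le> u / (c * sqrt (r - s))"
proof -
  \<comment> \<open>\<open>indep_var\<close> asks for a common type of values, so the increment is
    padded to a triple; the indicator of \<open>A\<close> travels with the past as its third
    component.\<close>
  define P where "P \<omega> = (Y \<omega>, (Z \<omega>, indicator A \<omega> :: real))" for \<omega>
  define f where "f w = (w, (0::real, 0::real))" for w :: real
  let ?N = "(borel :: real measure) \<Otimes>\<^sub>M ((borel :: real measure) \<Otimes>\<^sub>M (borel :: real measure))"
  \<comment> \<open>The lower bound on |z| is built into \<open>H\<close>, so that the estimate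
    holds for every frozen value and not only for those taken on \<open>A\<close>.\<close>
  define H where "H q = (let y = fst (fst q); z = fst (snd (fst q)); w = fst (snd q) in
     if snd (snd (fst q)) = 1 \<and> c \<le> \<bar>z\<bar> then g (y + z * w + u) - g (y + z * w) else 0)"
    for q :: "(real \<times> real \<times> real) \<times> real \<times> real \<times> real"
  have Pm: "P \<in> measurable (\<F> s) ?N" unfolding P_def using Y Z A by (intro measurable_Pair) auto
  have fm: "f \<in> measurable borel ?N" unfolding f_def by measurable
  have ind: "indep_var ?N P ?N (\<lambda>\<omega>. f (W r \<omega> - W s \<omega>))"
    by (rule indep_increment[OF sr Pm fm])
  have Hm: "H \<in> borel_measurable (?N \<Otimes>\<^sub>M ?N)"
  proof -
    note [measurable] = g(1)
    show ?thesis unfolding H_def Let_def by measurable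
  qed
  have HB: "\<bar>H z\<bar> \<le> 1" for z
  proof -
    have "\<bar>g w - g w'\<bar> \<le> 1" for w w' using g(2,3)[of w] g(2,3)[of w'] by linarith
    then show ?thesis by (simp add: H_def Let_def)
  qed
  have pos: "0 < sqrt (r - s)" using sr by simp
  note D = W_increment[OF sr]
  have "\<bar>expectation (\<lambda>\<omega>. H (p, f (W r \<omega> - W s \<omega>)))\<bar> \<le> u / (c * sqrt (r - s))" for p
  proof -
    obtain y z a where p: "p = (y, (z, a))" by (cases p) auto
    show ?thesis
    proof (cases "a = 1 \<and> c \<le> \<bar>z\<bar>")
      case True
      define h where "h w = g (y + z * w)" for w
      have h: "h \<in> borel_measurable borel" "\<And>w. 0 \<le> h w" "\<And>w. h w \<le> 1" using g unfolding h_def by auto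
      have z: "z \<noteq> 0" using True c by auto
      have hs: "g (y + z * w + u) = h (w + u / z)" for w unfolding h_def using z by (simp add: algebra_simps)
      have i: "integrable M (\<lambda>\<omega>. h (W r \<omega> - W s \<omega> + q))" for q
        by (rule integrable_const_bound[of _ 1])
           (use h sr in \<open>auto intro!: measurable_compose[OF _ h(1)] borel_measurable_add borel_measurable_diff W_meas\<close>)
      have e: "expectation (\<lambda>\<omega>. h (W r \<omega> - W s \<omega> + q)) = (\<integral>w. normal_density 0 (sqrt (r - s)) w * h (w + q) \<partial>lborel)" for q
        using distributed_integral[OF D, of "\<lambda>w. h (w + q)"] h(1) by simp
      have "expectation (\<lambda>\<omega>. H (p, f (W r \<omega> - W s \<omega>))) =
         expectation (\<lambda>\<omega>. h (W r \<omega> - W s \<omega> + u / z) - h (W r \<omega> - W s \<omega> + 0))"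
        using True by (simp add: H_def Let_def p f_def hs) (simp add: h_def)
      also have "\<dots> = expectation (\<lambda>\<omega>. h (W r \<omega> - W s \<omega> + u / z)) - expectation (\<lambda>\<omega>. h (W r \<omega> - W s \<omega> + 0))"
        by (rule Bochner_Integration.integral_diff[OF i i])
      finally have "\<bar>expectation (\<lambda>\<omega>. H (p, f (W r \<omega> - W s \<omega>)))\<bar> \<le> \<bar>u / z\<bar> / sqrt (r - s)"
        using normal_shift_le[OF pos h, of "u / z"] unfolding e by simp
      also have "\<bar>u / z\<bar> \<le> u / c" using True c u by (simp add: abs_divide frac_le)
      finally show ?thesis using pos by (simp add: divide_right_mono)
    next
      case False
      then show ?thesis using u c sr by (auto simp: H_def Let_def p f_def)
    qed
  qed
  then have "\<bar>expectation (\<lambda>\<omega>. H (P \<omega>, f (W r \<omega> - W s \<omega>)))\<bar> \<le> u / (c * sqrt (r - s))"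
    by (intro indep_expectation_bound[OF ind Hm HB])
  moreover have "H (P \<omega>, f (W r \<omega> - W s \<omega>)) =
     indicator A \<omega> * (g (Y \<omega> + Z \<omega> * (W r \<omega> - W s \<omega>) + u) - g (Y \<omega> + Z \<omega> * (W r \<omega> - W s \<omega>)))" for \<omega>
    using c(2)[of \<omega>] by (auto simp: H_def Let_def P_def f_def indicator_def)
  ultimately show ?thesis by simp
qed

text \<open>The average of the indicator of \<open>S\<close> over an interval of length
  \<open>h\<close> starting at \<open>y\<close>; half-open, so that consecutive windows
  tile.\<close>

definition window :: "real set \<Rightarrow> real \<Rightarrow> real \<Rightarrow> real" where
  "window S h y = measure lborel (S \<inter> {y..<y + h}) / h"

lemma window_measure_add:
  fixes S :: "real set"
  assumes "S \<in> sets borel" "0 \<le> h" "0 \<le> k"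
  shows "measure lborel (S \<inter> {y..<y + (h + k)}) =
    measure lborel (S \<inter> {y..<y + h}) + measure lborel (S \<inter> {y + h..<y + h + k})"
proof -
  have fin: "emeasure lborel (S \<inter> {p..<q}) \<noteq> \<infinity>" for p q :: real
  proof -
    have "emeasure lborel (S \<inter> {p..<q}) \<le> emeasure lborel {p..<q}" by (rule emeasure_mono) auto
    also have "\<dots> < \<infinity>" by (cases "p \<le> q") auto
    finally show ?thesis by simp
  qed
  have "S \<inter> {y..<y + (h + k)} = (S \<inter> {y..<y + h}) \<union> (S \<inter> {y + h..<y + h + k})" using assms by auto
  then show ?thesis using assms fin by (simp only:) (rule measure_Union, auto)
qed

lemma window_measure_bounds:
  assumes "0 \<le> h" shows "0 \<le> measure lborel (S \<inter> {y..<y + h})" "measure lborel (S \<inter> {y..<y + h}) \<le> h"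
proof -
  show "measure lborel (S \<inter> {y..<y + h}) \<le> h"
  proof (cases "S \<inter> {y..<y + h} \<in> sets lborel")
    case True
    have "measure lborel (S \<inter> {y..<y + h}) \<le> measure lborel {y..<y + h}"
      by (rule measure_mono_fmeasurable[OF _ True]) (use assms in \<open>auto simp: fmeasurable_def\<close>)
    then show ?thesis using assms by simp
  next
    case False then show ?thesis using assms by (simp add: measure_notin_sets)
  qed
qed simp

lemma window_bounds: "0 < h \<Longrightarrow> 0 \<le> window S h y" "0 < h \<Longrightarrow> window S h y \<le> 1"
  using window_measure_bounds[of h S y] by (auto simp: window_def)

text \<open>For y \<le> z the stretch from \<open>y\<close> to \<open>z + h\<close> is cut once at
  \<open>z\<close> and once at \<open>y + h\<close>; besides the two windows this leaves pieces of
  length z - y.\<close>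

lemma window_Lipschitz:
  assumes S: "S \<in> sets borel" and h: "0 < h"
  shows "\<bar>window S h y - window S h z\<bar> \<le> \<bar>y - z\<bar> / h"
proof -
  let ?m = "\<lambda>y h. measure lborel (S \<inter> {y..<y + h})"
  have *: "\<bar>?m z h - ?m y h\<bar> \<le> z - y" if "y \<le> z" for y z
  proof -
    have "?m y (z - y) + ?m z h = ?m y h + ?m (y + h) (z - y)"
      using window_measure_add[OF S, of "z - y" h y] window_measure_add[OF S, of h "z - y" y] that h
      by (simp add: add.commute)
    then show ?thesis
      using window_measure_bounds[of "z - y" S y] window_measure_bounds[of "z - y" S "y + h"] that by linarith
  qed
  have "\<bar>?m y h - ?m z h\<bar> \<le> \<bar>y - z\<bar>" using *[of y z] *[of z y] by linarith
  then show ?thesis unfolding window_def using h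
    by (simp add: diff_divide_distrib[symmetric] abs_divide divide_right_mono)
qed

lemma window_measurable:
  assumes "S \<in> sets borel" "0 < h" shows "window S h \<in> borel_measurable borel"
proof (rule borel_measurable_continuous_onI, rule lipschitz_on_continuous_on)
  show "(1 / h)-lipschitz_on UNIV (window S h)"
    by (rule lipschitz_onI) (use window_Lipschitz[OF assms] assms in \<open>auto simp: dist_real_def\<close>)
qed

text \<open>The mechanism of refinement: a window of one scale is an average of translated windows
  of the next scale.\<close>

lemma window_split:
  assumes S: "S \<in> sets borel" and h: "0 < h" and q: "0 < q"
  shows "window S (real q * h) y = (\<Sum>i<q. window S h (y + real i * h)) / real q"
proof -
  have "measure lborel (S \<inter> {y..<y + real n * h}) = (\<Sum>i<n. measure lborel (S \<inter> {y + real i * h..<y + real i * h + h}))" for n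
  proof (induction n)
    case (Suc n)
    then show ?case using window_measure_add[OF S, of "real n * h" h y] h
      by (simp add: algebra_simps)
  qed simp
  then show ?thesis unfolding window_def using h q by (simp add: sum_divide_distrib[symmetric])
qed

lemma window_le_measure:
  assumes "S \<in> sets borel" "emeasure lborel S < \<infinity>" "0 < h"
  shows "window S h y \<le> measure lborel S / h"
proof -
  have "measure lborel (S \<inter> {y..<y + h}) \<le> measure lborel S"
    by (rule measure_mono_fmeasurable) (use assms in \<open>auto simp: fmeasurable_def\<close>)
  then show ?thesis unfolding window_def using assms by (simp add: divide_right_mono)
qed

lemma window_eq_1_eventually:
  assumes "open S" "y \<in> S" shows "\<exists>d>0. \<forall>h. 0 < h \<longrightarrow> h < d \<longrightarrow> window S h y = 1"
proof -
  obtain d where d: "d > 0" "ball y d \<subseteq> S" using assms open_contains_ball by blast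
  have "window S h y = 1" if "0 < h" "h < d" for h
  proof -
    have "S \<inter> {y..<y + h} = {y..<y + h}" using d that by (auto simp: subset_iff dist_real_def)
    then show ?thesis using that by (simp add: window_def)
  qed
  then show ?thesis using d by blast
qed

section \<open>Localization\<close>

lemma dyadic_bound_extend:
  fixes f :: "real \<Rightarrow> real"
  assumes "T > 0" "0 \<le> s" "s < v" and f: "continuous_on {s..v} f"
    and le: "\<And>q. q \<in> dyadics T \<Longrightarrow> s < q \<Longrightarrow> q < v \<Longrightarrow> f q \<le> c"
  shows "f v \<le> c"
proof (rule ccontr)
  assume "\<not> f v \<le> c"
  then have "f v > c" by simp
  moreover have "(f \<longlongrightarrow> f v) (at v within {s..v})"
    using f \<open>s < v\<close> unfolding continuous_on_def by auto
  ultimately have "eventually (\<lambda>w. f w > c) (at v within {s..v})" by (intro order_tendstoD)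
  then obtain d where d: "d > 0" "\<And>w. w \<in> {s..v} \<Longrightarrow> w \<noteq> v \<Longrightarrow> dist w v < d \<Longrightarrow> f w > c"
    unfolding eventually_at by blast
  have "0 \<le> max s (v - d)" "max s (v - d) < v" using assms d(1) by auto
  then obtain q where q: "q \<in> dyadics T" "max s (v - d) < q" "q < v"
    using dyadics_dense[OF \<open>T > 0\<close>] by blast
  have "f q > c" by (rule d(2)) (use q in \<open>auto simp: dist_real_def\<close>)
  then show False using le[of q] q by auto
qed

section \<open>Adaptedness of running extrema\<close>

context brownian
begin

lemma run_max_adapted:
  assumes Y: "\<And>s. 0 \<le> s \<Longrightarrow> s \<le> t \<Longrightarrow> Y s \<in> borel_measurable (\<F> t)"
    and cont: "\<And>\<omega>. \<omega> \<in> space M \<Longrightarrow> continuous_on {0..} (\<lambda>s. Y s \<omega>)" and "0 \<le> t"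
  shows "(\<lambda>\<omega>. run_max (\<lambda>s. Y s \<omega>) t) \<in> borel_measurable (\<F> t)"
proof (cases "t = 0")
  case True
  then show ?thesis using Y[of 0] by (simp add: run_max_def)
next
  case False
  then have t: "t > 0" using \<open>0 \<le> t\<close> by simp
  show ?thesis
  proof (rule borel_measurableI_le)
    fix a
    have "(run_max (\<lambda>s. Y s \<omega>) t \<le> a) \<longleftrightarrow> (\<forall>q\<in>dyadics t. q \<le> t \<longrightarrow> Y q \<omega> \<le> a)" if \<omega>: "\<omega> \<in> space M" for \<omega>
    proof
      assume "run_max (\<lambda>s. Y s \<omega>) t \<le> a"
      then show "\<forall>q\<in>dyadics t. q \<le> t \<longrightarrow> Y q \<omega> \<le> a"
        using run_max_upper[OF cont[OF \<omega>], of _ t] dyadics_nonneg[OF t] by force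
    next
      assume *: "\<forall>q\<in>dyadics t. q \<le> t \<longrightarrow> Y q \<omega> \<le> a"
      obtain v where v: "v \<in> {0..t}" "Y v \<omega> = run_max (\<lambda>s. Y s \<omega>) t"
        using run_max_attained[OF cont[OF \<omega>] \<open>0 \<le> t\<close>] by blast
      have "Y v \<omega> \<le> a"
      proof (cases "v = 0")
        case True
        then show ?thesis using * dyadicsI[of t 0 0] t by auto
      next
        case False
        then show ?thesis using v * t
          by (intro dyadic_bound_extend[OF t, of 0 v "\<lambda>s. Y s \<omega>"] continuous_on_subset[OF cont[OF \<omega>]]) auto
      qed
      then show "run_max (\<lambda>s. Y s \<omega>) t \<le> a" using v by simp
    qed
    then have eq: "{\<omega>\<in>space (\<F> t). run_max (\<lambda>s. Y s \<omega>) t \<le> a} =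
        {\<omega>\<in>space (\<F> t). \<forall>i l. t * real i / 2 ^ l \<le> t \<longrightarrow> Y (t * real i / 2 ^ l) \<omega> \<le> a}"
      by (auto simp: ball_dyadics)
    have "{\<omega>\<in>space (\<F> t). t * real i / 2 ^ l \<le> t \<longrightarrow> Y (t * real i / 2 ^ l) \<omega> \<le> a} \<in> sets (\<F> t)" for i l
    proof (cases "t * real i / 2 ^ l \<le> t")
      case True
      then have [measurable]: "Y (t * real i / 2 ^ l) \<in> borel_measurable (\<F> t)" using t by (intro Y) auto
      have "{\<omega>\<in>space (\<F> t). Y (t * real i / 2 ^ l) \<omega> \<le> a} \<in> sets (\<F> t)" by measurable
      then show ?thesis using True by simp
    next
      case False
      have "space (\<F> t) \<in> sets (\<F> t)" by (rule sets.top)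
      with False show ?thesis by simp
    qed
    then show "{\<omega>\<in>space (\<F> t). run_max (\<lambda>s. Y s \<omega>) t \<le> a} \<in> sets (\<F> t)"
      unfolding eq by (intro sets.sets_Collect_countable_All)
  qed
qed

lemma run_min_adapted:
  assumes Y: "\<And>s. 0 \<le> s \<Longrightarrow> s \<le> t \<Longrightarrow> Y s \<in> borel_measurable (\<F> t)"
    and cont: "\<And>\<omega>. \<omega> \<in> space M \<Longrightarrow> continuous_on {0..} (\<lambda>s. Y s \<omega>)" and "0 \<le> t"
  shows "(\<lambda>\<omega>. run_min (\<lambda>s. Y s \<omega>) t) \<in> borel_measurable (\<F> t)"
  unfolding run_min_uminus
  by (intro borel_measurable_uminus run_max_adapted[where Y="\<lambda>s \<omega>. - Y s \<omega>"] continuous_on_minus assms)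

end

context perturbed_diffusion
begin

lemma X_adapted_le: "0 \<le> s \<Longrightarrow> s \<le> t \<Longrightarrow> X s \<in> borel_measurable (\<F> t)"
  by (rule measurable_F_mono[OF X_adapted])

lemma X_run_max_adapted: "0 \<le> t \<Longrightarrow> (\<lambda>\<omega>. run_max (\<lambda>s. X s \<omega>) t) \<in> borel_measurable (\<F> t)"
  by (intro run_max_adapted X_adapted_le X_cont)

lemma X_run_min_adapted: "0 \<le> t \<Longrightarrow> (\<lambda>\<omega>. run_min (\<lambda>s. X s \<omega>) t) \<in> borel_measurable (\<F> t)"
  by (intro run_min_adapted X_adapted_le X_cont)

lemma U_adapted: "0 \<le> t \<Longrightarrow> U t \<in> borel_measurable (\<F> t)"
  unfolding U_def
  by (intro borel_measurable_diff borel_measurable_times borel_measurable_const X_run_max_adapted X_run_min_adapted X_adapted)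

end

section \<open>Times accumulating geometrically at the horizon\<close>

definition tm :: "real \<Rightarrow> nat \<Rightarrow> real" where
  "tm T k = T - T / 256 ^ k"

text \<open>As 256 = 2 ^ 8, these times are dyadic fractions of \<open>T\<close>; their distance to
  \<open>T\<close> gives the Brownian increment up to \<open>T\<close> the standard deviation sqrt T
  / 16 ^ k.\<close>

lemma tm_eq_dyadic: "tm T k = T * real (256 ^ k - 1) / 2 ^ (8 * k)"
proof -
  have "(2::real) ^ (8 * k) = 256 ^ k" unfolding power_mult by simp
  then show ?thesis by (simp add: tm_def of_nat_diff field_simps)
qed

text \<open>The same time at the level of \<open>tm T (Suc k)\<close>: both ends of a step then lie
  on one grid, as \<open>prob_oscillation\<close> requires.\<close>

lemma tm_eq_dyadic_fine: "tm T k = T * real ((256 ^ k - 1) * 256) / 2 ^ (8 * Suc k)"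
proof -
  have "(2::real) ^ (8 * Suc k) = 256 ^ k * 256" by (simp add: power_mult power_add)
  then show ?thesis by (simp add: tm_def of_nat_diff field_simps)
qed

lemma tm_in_dyadics: "tm T k \<in> dyadics T"
  unfolding tm_eq_dyadic by (rule dyadicsI)

lemma tm_nonneg: "T > 0 \<Longrightarrow> 0 \<le> tm T k"
  unfolding tm_eq_dyadic by simp

lemma tm_mono: assumes "T > 0" "j \<le> k" shows "tm T j \<le> tm T k"
proof -
  have "(256::real) ^ j \<le> 256 ^ k" using assms by (intro power_increasing) auto
  then show ?thesis unfolding tm_def using assms by (simp add: frac_le)
qed

lemma tm_less: "T > 0 \<Longrightarrow> tm T k < T"
  unfolding tm_def by simp

lemma tm_lim: "tm T \<longlonglongrightarrow> T"
proof -
  have "(\<lambda>k. T - T * (1 / 256) ^ k) \<longlonglongrightarrow> T - T * 0"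
    by (intro tendsto_intros LIMSEQ_power_zero) auto
  then show ?thesis by (simp add: tm_def[abs_def] power_divide)
qed

lemma tm_diff: "T > 0 \<Longrightarrow> tm T (Suc k) - tm T k \<le> T / 256 ^ k"
  unfolding tm_def by (simp add: field_simps)

lemma tm_bracket:
  assumes T: "T > 0" and q: "tm T k \<le> q" "q < T"
  obtains j where "k \<le> j" "tm T j \<le> q" "q \<le> tm T (Suc j)"
proof -
  have "eventually (\<lambda>j. q < tm T j) sequentially" using tm_lim q(2) by (rule order_tendstoD)
  then obtain J where J: "q < tm T J" unfolding eventually_sequentially by blast
  define j' where "j' = (LEAST j. q < tm T j)"
  have j': "q < tm T j'" unfolding j'_def by (rule LeastI[of _ J]) (rule J)
  have "k < j'"
  proof (rule ccontr)
    assume "\<not> k < j'"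
    then show False using tm_mono[OF T, of j' k] j' q by auto
  qed
  then obtain j where j: "j' = Suc j" "k \<le> j" by (cases j') auto
  have "\<not> q < tm T j" using not_less_Least[of j "\<lambda>j. q < tm T j"] j unfolding j'_def by auto
  then show ?thesis using that[of j] j j' by auto
qed

text \<open>Constants fixed after localization. A path that starts within \<open>K\<close> at time
  \<open>tm T k0\<close> and has no large oscillation stays within K + 2 at the times
  \<open>tm T k\<close> and within K + 4 up to \<open>T\<close>, so bounds on \<sigma> and
  \<open>b\<close> are needed only there. The assumption \<open>drift\<close> leaves half of 64 ^ -
  k for the martingale part.\<close>

locale localized_diffusion = perturbed_diffusion +
  fixes T K L Bb C1 c :: real and k0 :: nat
  assumes T: "T > 0" and K: "0 \<le> K" and L: "L-lipschitz_on UNIV \<sigma>"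
    and c: "c > 0" "\<And>y. \<bar>y\<bar> \<le> K + 4 \<Longrightarrow> c \<le> \<bar>\<sigma> y\<bar>"
    and Bb: "\<And>y. \<bar>y\<bar> \<le> K + 4 \<Longrightarrow> \<bar>b y\<bar> \<le> Bb"
    and drift: "2 * Bb * T \<le> 4 ^ k0"
    and osc_small: "\<And>k. k0 \<le> k \<Longrightarrow> prob {\<omega>\<in>space M. \<bar>X (tm T k) \<omega>\<bar> \<le> K + 2 \<and>
        (\<exists>q\<in>dyadics T. tm T k \<le> q \<and> q \<le> tm T (Suc k) \<and> \<bar>X q \<omega> - X (tm T k) \<omega>\<bar> > 1 / 8 ^ k)} \<le> C1 / 4 ^ k"
begin

definition osc :: "nat \<Rightarrow> 'a set" where
  "osc k = {\<omega>\<in>space M. \<exists>q\<in>dyadics T. tm T k \<le> q \<and> q \<le> tm T (Suc k) \<and> \<bar>X q \<omega> - X (tm T k) \<omega>\<bar> > 1 / 8 ^ k}"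

text \<open>The requirements of \<open>Good\<close> that are decided by time
  \<open>tm T k\<close>.\<close>

definition good :: "nat \<Rightarrow> 'a set" where
  "good k = {\<omega>\<in>space M. \<bar>X (tm T k0) \<omega>\<bar> \<le> K} - (\<Union>j\<in>{k0..<k}. osc j)"

text \<open>One event for all scales, so that the expectations can be telescoped.\<close>

definition Good :: "'a set" where
  "Good = {\<omega>\<in>space M. \<bar>X (tm T k0) \<omega>\<bar> \<le> K} - (\<Union>j\<in>{k0..}. osc j)"

lemma osc_adapted: "osc k \<in> sets (\<F> (tm T (Suc k)))"
proof -
  let ?t = "tm T (Suc k)" and ?s = "tm T k"
  have Xs: "X ?s \<in> borel_measurable (\<F> ?t)" using T by (intro X_adapted_le tm_nonneg tm_mono) auto
  have "{\<omega>\<in>space (\<F> ?t). ?s \<le> T * real i / 2 ^ l \<and> T * real i / 2 ^ l \<le> ?t \<and>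
      \<bar>X (T * real i / 2 ^ l) \<omega> - X ?s \<omega>\<bar> > 1 / 8 ^ k} \<in> sets (\<F> ?t)" for i l
  proof (cases "?s \<le> T * real i / 2 ^ l \<and> T * real i / 2 ^ l \<le> ?t")
    case True
    have Xq: "X (T * real i / 2 ^ l) \<in> borel_measurable (\<F> ?t)" using True T by (intro X_adapted_le) auto
    have "{\<omega>\<in>space (\<F> ?t). 1 / 8 ^ k < \<bar>X (T * real i / 2 ^ l) \<omega> - X ?s \<omega>\<bar>} \<in> sets (\<F> ?t)"
      by (intro borel_measurable_less borel_measurable_const borel_measurable_abs borel_measurable_diff Xs Xq)
    then show ?thesis using True by simp
  next
    case False
    then have eq: "{\<omega>\<in>space (\<F> ?t). ?s \<le> T * real i / 2 ^ l \<and> T * real i / 2 ^ l \<le> ?t \<and>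
      \<bar>X (T * real i / 2 ^ l) \<omega> - X ?s \<omega>\<bar> > 1 / 8 ^ k} = {}" by blast
    show ?thesis unfolding eq by (rule sets.empty_sets)
  qed
  then have "{\<omega>\<in>space (\<F> ?t). \<exists>i l. ?s \<le> T * real i / 2 ^ l \<and> T * real i / 2 ^ l \<le> ?t \<and>
      \<bar>X (T * real i / 2 ^ l) \<omega> - X ?s \<omega>\<bar> > 1 / 8 ^ k} \<in> sets (\<F> ?t)"
    by (intro sets.sets_Collect_countable_Ex)
  then show ?thesis unfolding osc_def bex_dyadics by (simp only: space_F)
qed

lemma osc_events: "osc k \<in> events"
  using osc_adapted sets_F_le by blast

lemma start_adapted: "k0 \<le> k \<Longrightarrow> {\<omega>\<in>space M. \<bar>X (tm T k0) \<omega>\<bar> \<le> K} \<in> sets (\<F> (tm T k))"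
proof -
  assume "k0 \<le> k"
  then have "X (tm T k0) \<in> borel_measurable (\<F> (tm T k))" using T by (intro X_adapted_le tm_nonneg tm_mono)
  then have "{\<omega>\<in>space (\<F> (tm T k)). \<bar>X (tm T k0) \<omega>\<bar> \<le> K} \<in> sets (\<F> (tm T k))"
    by (intro borel_measurable_le borel_measurable_const borel_measurable_abs)
  then show ?thesis by simp
qed

lemma good_adapted: assumes "k0 \<le> k" shows "good k \<in> sets (\<F> (tm T k))"
  unfolding good_def
proof (intro sets.Diff start_adapted assms sets.finite_UN)
  fix j assume "j \<in> {k0..<k}"
  then have "tm T (Suc j) \<le> tm T k" using T by (intro tm_mono) auto
  then show "osc j \<in> sets (\<F> (tm T k))" using osc_adapted sets_F_mono by blast
qed simp

lemma good_events: "k0 \<le> k \<Longrightarrow> good k \<in> events"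
  using good_adapted sets_F_le by blast

lemma Good_events: "Good \<in> events"
  unfolding Good_def using start_adapted[of k0] sets_F_le osc_events
  by (intro sets.Diff sets.countable_UN) blast+

lemma Good_subset: "Good \<subseteq> good k"
  unfolding Good_def good_def by auto

text \<open>A geometric series. The subtracted term is slack that lets the induction close and that
  \<open>Good_increment\<close> spends on its last step.\<close>

lemma good_chain:
  assumes \<omega>: "\<omega> \<in> good (i + n)" and "k0 \<le> i"
  shows "\<bar>X (tm T (i + n)) \<omega> - X (tm T i) \<omega>\<bar> \<le> 2 / 8 ^ i - 2 / 8 ^ (i + n)"
  using \<omega>
proof (induction n)
  case (Suc n)
  have "\<omega> \<in> good (i + n)" using Suc.prems by (auto simp: good_def)
  note IH = Suc.IH[OF this]
  have "\<omega> \<notin> osc (i + n)" "\<omega> \<in> space M" using Suc.prems \<open>k0 \<le> i\<close> by (auto simp: good_def)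
  then have "\<bar>X (tm T (Suc (i + n))) \<omega> - X (tm T (i + n)) \<omega>\<bar> \<le> 1 / 8 ^ (i + n)"
    using tm_in_dyadics[of T "Suc (i + n)"] tm_mono[OF T, of "i + n" "Suc (i + n)"]
    by (auto simp: osc_def not_less)
  moreover have "2 / 8 ^ (i + Suc n) = (1 / 4) * (1 / 8 ^ (i + n) :: real)" by simp
  moreover have "2 / 8 ^ (i + n) = 2 * (1 / 8 ^ (i + n) :: real)" by simp
  moreover have "0 < (1 / 8 ^ (i + n) :: real)" by simp
  ultimately show ?case using IH unfolding add_Suc_right by linarith
qed simp

lemma good_bound:
  assumes "\<omega> \<in> good k" "k0 \<le> k" shows "\<bar>X (tm T k) \<omega>\<bar> \<le> K + 2"
proof -
  obtain n where k: "k = k0 + n" using \<open>k0 \<le> k\<close> le_Suc_ex by blast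
  have "\<bar>X (tm T k) \<omega> - X (tm T k0) \<omega>\<bar> \<le> 2 / 8 ^ k0 - 2 / 8 ^ k"
    using good_chain[of \<omega> k0 n] assms k by simp
  moreover have "2 / 8 ^ k0 \<le> (2 :: real)" by (simp add: divide_le_eq)
  moreover have "0 < (2 / 8 ^ k :: real)" by simp
  moreover have "\<bar>X (tm T k0) \<omega>\<bar> \<le> K" using assms(1) by (auto simp: good_def)
  ultimately show ?thesis by linarith
qed

text \<open>A dyadic time before \<open>T\<close> lies between two consecutive
  \<open>tm T j\<close>, and the step from \<open>tm T j\<close> is paid by the slack of
  \<open>good_chain\<close>. The other times, \<open>T\<close> included, are reached by continuity
  from the left.\<close>

lemma Good_increment:
  assumes \<omega>: "\<omega> \<in> Good" and k: "k0 \<le> k" and v: "tm T k \<le> v" "v \<le> T"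
  shows "\<bar>X v \<omega> - X (tm T k) \<omega>\<bar> \<le> 2 / 8 ^ k"
proof (cases "v = tm T k")
  case False
  have sp: "\<omega> \<in> space M" using \<omega> by (auto simp: Good_def)
  have lt: "tm T k < v" using False v by simp
  show ?thesis
  proof (rule dyadic_bound_extend[OF T tm_nonneg[OF T] lt])
    show "continuous_on {tm T k..v} (\<lambda>v. \<bar>X v \<omega> - X (tm T k) \<omega>\<bar>)"
      by (intro continuous_intros X_cont_on[OF sp]) (use tm_nonneg[OF T, of k] in auto)
    fix q assume q: "q \<in> dyadics T" "tm T k < q" "q < v"
    obtain j where j: "k \<le> j" "tm T j \<le> q" "q \<le> tm T (Suc j)"
      using tm_bracket[OF T, of k q] q v by auto
    obtain n where n: "j = k + n" using \<open>k \<le> j\<close> le_Suc_ex by blast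
    have "\<omega> \<notin> osc j" using \<omega> j k by (auto simp: Good_def)
    then have "\<bar>X q \<omega> - X (tm T j) \<omega>\<bar> \<le> 1 / 8 ^ j"
      using sp j q by (auto simp: osc_def not_less)
    moreover have "\<bar>X (tm T j) \<omega> - X (tm T k) \<omega>\<bar> \<le> 2 / 8 ^ k - 2 / 8 ^ j"
      using good_chain[of \<omega> k n] Good_subset \<omega> k n by auto
    moreover have "2 / 8 ^ j = 2 * (1 / 8 ^ j :: real)" by simp
    moreover have "0 < (1 / 8 ^ j :: real)" by simp
    ultimately show "\<bar>X q \<omega> - X (tm T k) \<omega>\<bar> \<le> 2 / 8 ^ k" by linarith
  qed
qed simp

lemma C1_nonneg: "0 \<le> C1"
proof -
  have "0 \<le> C1 / 4 ^ k0" using order_trans[OF measure_nonneg osc_small[OF order_refl]] .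
  then have "0 \<le> C1 / 4 ^ k0 * 4 ^ k0" by (intro mult_nonneg_nonneg) auto
  then show ?thesis by simp
qed

lemma prob_good_step: assumes "k0 \<le> k" shows "prob (good k - good (Suc k)) \<le> C1 / 4 ^ k"
proof -
  have "good k - good (Suc k) \<subseteq> {\<omega>\<in>space M. \<bar>X (tm T k) \<omega>\<bar> \<le> K + 2 \<and>
        (\<exists>q\<in>dyadics T. tm T k \<le> q \<and> q \<le> tm T (Suc k) \<and> \<bar>X q \<omega> - X (tm T k) \<omega>\<bar> > 1 / 8 ^ k)}"
    (is "_ \<subseteq> ?A")
  proof
    fix \<omega> assume \<omega>: "\<omega> \<in> good k - good (Suc k)"
    then have "\<omega> \<in> osc k" unfolding good_def by (auto simp: less_Suc_eq)
    then show "\<omega> \<in> ?A" using good_bound[of \<omega> k] \<omega> assms unfolding osc_def by blast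
  qed
  moreover have "?A \<in> events"
  proof -
    have "{\<omega>\<in>space M. \<bar>X (tm T k) \<omega>\<bar> \<le> K + 2} \<in> events"
      by (intro borel_measurable_le borel_measurable_const borel_measurable_abs X_measurable tm_nonneg T)
    moreover have "?A = {\<omega>\<in>space M. \<bar>X (tm T k) \<omega>\<bar> \<le> K + 2} \<inter> osc k" by (auto simp: osc_def)
    ultimately show ?thesis using osc_events by auto
  qed
  ultimately have "prob (good k - good (Suc k)) \<le> prob ?A" by (rule finite_measure_mono)
  also have "\<dots> \<le> C1 / 4 ^ k" by (rule osc_small[OF assms])
  finally show ?thesis .
qed

text \<open>The failure probabilities form a geometric series, and the sets
  \<open>good k - good (k + n)\<close> exhaust \<open>good k - Good\<close>.\<close>

lemma prob_good_diff: assumes "k0 \<le> k" shows "prob (good k - Good) \<le> 2 * C1 / 4 ^ k"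
proof -
  have step: "prob (good k - good (k + n)) \<le> 2 * (C1 / 4 ^ k) - 2 * (C1 / 4 ^ (k + n))" for n
  proof (induction n)
    case (Suc n)
    have ev: "good k \<in> events" "good (k + n) \<in> events" "good (Suc (k + n)) \<in> events"
      using assms by (auto intro: good_events)
    have "prob (good k - good (k + Suc n)) \<le> prob ((good k - good (k + n)) \<union> (good (k + n) - good (Suc (k + n))))"
      by (rule finite_measure_mono) (use ev in auto)
    also have "\<dots> \<le> prob (good k - good (k + n)) + prob (good (k + n) - good (Suc (k + n)))"
      by (rule measure_Un_le) (use ev in auto)
    also have "\<dots> \<le> 2 * (C1 / 4 ^ k) - 2 * (C1 / 4 ^ (k + n)) + C1 / 4 ^ (k + n)"
      using Suc.IH prob_good_step[of "k + n"] assms by simp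
    also have "\<dots> \<le> 2 * (C1 / 4 ^ k) - 2 * (C1 / 4 ^ (k + Suc n))"
    proof -
      define e where "e = C1 / 4 ^ (k + n)"
      have e: "C1 / 4 ^ (k + Suc n) = e / 4" "0 \<le> e" using C1_nonneg by (simp_all add: e_def)
      show ?thesis unfolding e(1) e_def[symmetric] using e(2) by simp
    qed
    finally show ?case .
  qed simp
  have "(\<lambda>n. prob (good k - good (k + n))) \<longlonglongrightarrow> prob (\<Union>n. good k - good (k + n))"
  proof (rule finite_Lim_measure_incseq)
    have "good k - good (k + n) \<in> events" for n using assms by (intro sets.Diff good_events) auto
    then show "range (\<lambda>n. good k - good (k + n)) \<subseteq> events" by blast
    show "incseq (\<lambda>n. good k - good (k + n))" by (rule incseq_SucI) (auto simp: good_def)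
  qed
  moreover have "(\<Union>n. good k - good (k + n)) = good k - Good"
  proof -
    have "\<exists>n. \<omega> \<notin> good (k + n)" if \<omega>: "\<omega> \<in> good k" "\<omega> \<notin> Good" for \<omega>
    proof -
      obtain j where "k0 \<le> j" "\<omega> \<in> osc j" using \<omega> by (auto simp: Good_def good_def)
      then have "\<omega> \<notin> good (k + Suc j)" by (auto simp: good_def)
      then show ?thesis by blast
    qed
    then show ?thesis using Good_subset by blast
  qed
  ultimately have lim: "(\<lambda>n. prob (good k - good (k + n))) \<longlonglongrightarrow> prob (good k - Good)" by simp
  have "prob (good k - good (k + n)) \<le> 2 * (C1 / 4 ^ k)" for n
  proof -
    have "0 \<le> C1 / 4 ^ (k + n)" using C1_nonneg by simp
    then show ?thesis using step[of n] by linarith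
  qed
  then have "prob (good k - Good) \<le> 2 * (C1 / 4 ^ k)"
    by (intro LIMSEQ_le_const2[OF lim]) blast
  then show ?thesis by simp
qed

text \<open>What is neglected when \<sigma> is frozen at time \<open>tm T k\<close> and the drift is
  dropped.\<close>

definition frozen_error :: "nat \<Rightarrow> 'a \<Rightarrow> real" where
  "frozen_error k \<omega> = U T \<omega> - U (tm T k) \<omega> - \<sigma> (X (tm T k) \<omega>) * (W T \<omega> - W (tm T k) \<omega>)"

text \<open>On \<open>Good\<close> the integrand differs from its frozen value by at most 2 * L / 8
  ^ k over a time T / 256 ^ k, so the error has standard deviation of order 128 ^ - k, and Chebyshev
  at 64 ^ - k yields 4 ^ - k. Half of the threshold is spent on the drift.\<close>

lemma prob_frozen_error:
  assumes k: "k0 \<le> k"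
  shows "prob (Good \<inter> {\<omega>\<in>space M. \<bar>frozen_error k \<omega>\<bar> > 1 / 64 ^ k}) \<le> 64 * L\<^sup>2 * T / 4 ^ k"
proof -
  \<comment> \<open>On the grid of level 8 * k the times \<open>tm T k\<close> and \<open>T\<close>
    are neighbours.\<close>
  let ?a = "256 ^ k - 1 :: nat" and ?c = "256 ^ k :: nat" and ?m = "8 * k"
  define \<kappa> B where "\<kappa> = 1 / (2 * 64 ^ k :: real)" and "B = L * (2 / 8 ^ k)"
  have L0: "0 \<le> L" using L by (rule lipschitz_on_nonneg)
  have pw: "(2::real) ^ (8 * k) = 256 ^ k" unfolding power_mult by simp
  have times: "T * real ?a / 2 ^ ?m = tm T k" "T * real ?c / 2 ^ ?m = T"
    using tm_eq_dyadic[of T k] pw by simp_all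
  have "Good \<inter> {\<omega>\<in>space M. \<bar>frozen_error k \<omega>\<bar> > 1 / 64 ^ k} \<subseteq> increment_event 1 B T ?m ?a ?c \<kappa>"
  proof
    fix \<omega> assume "\<omega> \<in> Good \<inter> {\<omega>\<in>space M. \<bar>frozen_error k \<omega>\<bar> > 1 / 64 ^ k}"
    then have \<omega>: "\<omega> \<in> Good" "\<omega> \<in> space M" and big: "\<bar>frozen_error k \<omega>\<bar> > 1 / 64 ^ k" by auto
    have inc: "\<bar>X v \<omega> - X (tm T k) \<omega>\<bar> \<le> 2 / 8 ^ k" if "tm T k \<le> v" "v \<le> T" for v
      by (rule Good_increment[OF \<omega>(1) k that])
    have "2 / 8 ^ k \<le> (2 :: real)" by (simp add: divide_le_eq)
    moreover have "\<bar>X (tm T k) \<omega>\<bar> \<le> K + 2" using good_bound[of \<omega> k] \<omega>(1) Good_subset k by blast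
    ultimately have XB: "\<bar>X v \<omega>\<bar> \<le> K + 4" if "tm T k \<le> v" "v \<le> T" for v
      using inc[OF that] by linarith
    have "\<bar>(N T \<omega> - N (tm T k) \<omega>) - (U T \<omega> - U (tm T k) \<omega>)\<bar> \<le> Bb * (T - tm T k)"
      using T XB by (intro N_increment[OF \<omega>(2)] tm_nonneg less_imp_le[OF tm_less] Bb) auto
    also have "\<dots> \<le> \<kappa>"
    proof -
      have "(4::real) ^ k0 \<le> 4 ^ k" using k by (intro power_increasing) auto
      then have "2 * (Bb * T) \<le> 4 ^ k" using drift by linarith
      then have "Bb * T \<le> 4 ^ k / 2" by simp
      then have "Bb * T / 256 ^ k \<le> 4 ^ k / 2 / 256 ^ k" by (rule divide_right_mono) simp
      moreover have p: "(256::real) ^ k = 4 ^ k * 64 ^ k" by (simp flip: power_mult_distrib)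
      have "4 ^ k / 2 / 256 ^ k = \<kappa>" unfolding p \<kappa>_def by simp
      moreover have "Bb * (T - tm T k) = Bb * T / 256 ^ k" by (simp add: tm_def)
      ultimately show ?thesis by simp
    qed
    finally have "\<bar>(N T \<omega> - N (tm T k) \<omega>) - (U T \<omega> - U (tm T k) \<omega>)\<bar> \<le> \<kappa>" .
    moreover have "1 / 64 ^ k = 2 * \<kappa>" by (simp add: \<kappa>_def)
    ultimately have 1: "\<kappa> < \<bar>N T \<omega> - N (tm T k) \<omega> - 1 * \<sigma> (X (tm T k) \<omega>) * (W T \<omega> - W (tm T k) \<omega>)\<bar>"
      using big unfolding frozen_error_def mult_1 by linarith
    have 2: "\<bar>\<sigma> (X q \<omega>) - 1 * \<sigma> (X (tm T k) \<omega>)\<bar> \<le> B" if "tm T k \<le> q" "q \<le> T" for q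
    proof -
      have "\<bar>\<sigma> (X q \<omega>) - \<sigma> (X (tm T k) \<omega>)\<bar> \<le> L * \<bar>X q \<omega> - X (tm T k) \<omega>\<bar>"
        using lipschitz_onD[OF L, of "X q \<omega>" "X (tm T k) \<omega>"] by (simp add: dist_real_def)
      also have "\<dots> \<le> B" unfolding B_def using inc[OF that] L0 by (rule mult_left_mono)
      finally show ?thesis by simp
    qed
    show "\<omega> \<in> increment_event 1 B T ?m ?a ?c \<kappa>"
      unfolding increment_event_def times
      by (intro CollectI conjI \<omega>(2) bexI[of _ ?c]) (use 1 2 times in auto)
  qed
  then have "prob (Good \<inter> {\<omega>\<in>space M. \<bar>frozen_error k \<omega>\<bar> > 1 / 64 ^ k}) \<le> prob (increment_event 1 B T ?m ?a ?c \<kappa>)"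
    by (rule finite_measure_mono) (rule increment_event_sets[OF T])
  also have "\<dots> \<le> 4 * B\<^sup>2 * (T * real ?c / 2 ^ ?m - T * real ?a / 2 ^ ?m) / \<kappa>\<^sup>2"
    using L0 by (intro prob_increment_event[OF T]) (auto simp: \<kappa>_def B_def)
  also have "\<dots> = 4 * B\<^sup>2 * (T / 256 ^ k) / \<kappa>\<^sup>2" unfolding times by (simp add: tm_def)
  also have "\<dots> = 64 * L\<^sup>2 * T / 4 ^ k"
  proof -
    have e: "((8::real) ^ k)\<^sup>2 = 64 ^ k" "((64::real) ^ k)\<^sup>2 = 64 ^ k * 64 ^ k" "(256::real) ^ k = 4 ^ k * 64 ^ k"
      by (simp_all add: power2_eq_square flip: power_mult_distrib)
    show ?thesis unfolding B_def \<kappa>_def power_mult_distrib power_divide e by (simp add: field_simps)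
  qed
  finally show ?thesis .
qed

end

section \<open>Absolute continuity up to an earlier shift\<close>

context localized_diffusion
begin

text \<open>Neither \<open>Good\<close> nor \<open>U T\<close> has the form that
  \<open>increment_shift_bound\<close> treats; \<open>good k\<close> and the increment with frozen
  \<sigma> have it, and the replacement costs the first three terms.\<close>

lemma Good_shift_bound:
  assumes k: "k0 \<le> k" and S: "S \<in> borel_measurable (\<F> (tm T k0))"
    and g: "g \<in> borel_measurable borel" "\<And>w. 0 \<le> g w" "\<And>w. g w \<le> 1"
    and Lip: "0 \<le> \<Lambda>" "\<And>y z. \<bar>g y - g z\<bar> \<le> \<Lambda> * \<bar>y - z\<bar>" and u: "0 \<le> u"
  shows "\<bar>expectation (\<lambda>\<omega>. indicator Good \<omega> * (g (U T \<omega> + S \<omega> + u) - g (U T \<omega> + S \<omega>)))\<bar>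
     \<le> 2 * \<Lambda> / 64 ^ k + 128 * L\<^sup>2 * T / 4 ^ k + 2 * C1 / 4 ^ k + u * 16 ^ k / (c * sqrt T)"
proof -
  let ?t = "tm T k"
  define Y where "Y \<omega> = U ?t \<omega> + S \<omega>" for \<omega>
  define Z where "Z \<omega> = \<sigma> (X ?t \<omega>)" for \<omega>
  define Z' where "Z' \<omega> = Y \<omega> + Z \<omega> * (W T \<omega> - W ?t \<omega>)" for \<omega>
  define Bd where "Bd = Good \<inter> {\<omega>\<in>space M. \<bar>frozen_error k \<omega>\<bar> > 1 / 64 ^ k}"
  have t0: "0 \<le> ?t" "?t < T" using tm_nonneg[OF T] tm_less[OF T] by auto
  have Sk: "S \<in> borel_measurable (\<F> ?t)" by (rule measurable_F_mono[OF S tm_mono[OF T k]])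
  have Ym: "Y \<in> borel_measurable (\<F> ?t)" unfolding Y_def by (intro borel_measurable_add U_adapted t0 Sk)
  have Zm: "Z \<in> borel_measurable (\<F> ?t)" unfolding Z_def by (intro \<sigma>X_adapted t0 order_refl)
  have WM: "W T \<in> borel_measurable M" "W ?t \<in> borel_measurable M" using t0 T by (auto intro: W_meas)
  have UM: "U T \<in> borel_measurable M" "U ?t \<in> borel_measurable M"
    using t0 T by (auto intro!: measurable_F_M[OF U_adapted])
  have SM: "S \<in> borel_measurable M" by (rule measurable_F_M[OF S])
  have Z'M: "Z' \<in> borel_measurable M" unfolding Z'_def
    by (intro borel_measurable_add borel_measurable_times borel_measurable_diff WM measurable_F_M[OF Ym] measurable_F_M[OF Zm])
  have ZM: "(\<lambda>\<omega>. U T \<omega> + S \<omega>) \<in> borel_measurable M" by (intro borel_measurable_add UM SM)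
  have feM: "frozen_error k \<in> borel_measurable M" unfolding frozen_error_def
    by (intro borel_measurable_diff borel_measurable_times UM WM measurable_F_M[OF Zm[unfolded Z_def]])
  have Bd_ev: "Bd \<in> events" unfolding Bd_def
    by (intro sets.Int Good_events borel_measurable_less borel_measurable_const borel_measurable_abs feM)
  have good_ev: "good k \<in> events" by (rule good_events[OF k])
  have Zeq: "U T \<omega> + S \<omega> = Z' \<omega> + frozen_error k \<omega>" for \<omega>
    by (simp add: Z'_def Y_def Z_def frozen_error_def)
  have g1: "\<bar>g w - g w'\<bar> \<le> 1" for w w' using g(2,3)[of w] g(2,3)[of w'] by linarith
  have int: "integrable M (\<lambda>\<omega>. indicator A \<omega> * (g (V \<omega> + u) - g (V \<omega>)))"
    if "A \<in> events" "V \<in> borel_measurable M" for A V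
  proof (rule integrable_const_bound[of _ 1])
    show "(\<lambda>\<omega>. indicator A \<omega> * (g (V \<omega> + u) - g (V \<omega>))) \<in> borel_measurable M"
      using that by (intro borel_measurable_times borel_measurable_indicator borel_measurable_diff
          measurable_compose[OF _ g(1)] borel_measurable_add borel_measurable_const)
    show "AE \<omega> in M. norm (indicator A \<omega> * (g (V \<omega> + u) - g (V \<omega>))) \<le> 1"
      using g1 by (intro AE_I2) (auto simp: indicator_def)
  qed
  let ?a = "\<lambda>\<omega>. indicator Good \<omega> * (g (U T \<omega> + S \<omega> + u) - g (U T \<omega> + S \<omega>))"
  let ?b = "\<lambda>\<omega>. indicator (good k) \<omega> * (g (Z' \<omega> + u) - g (Z' \<omega>))"
  \<comment> \<open>Three sources of error: the Lipschitz bound at both arguments of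
    \<open>g\<close> off \<open>Bd\<close>, the trivial bound 2 on \<open>Bd\<close>, and the
    trivial bound 1 where \<open>good k\<close> holds but \<open>Good\<close> fails.\<close>
  let ?r = "\<lambda>\<omega>. 2 * \<Lambda> / 64 ^ k + 2 * indicator Bd \<omega> + indicator (good k - Good) \<omega>"
  have ia: "integrable M ?a" by (rule int[OF Good_events ZM])
  have ib: "integrable M ?b" by (rule int[OF good_ev Z'M])
  have ir: "integrable M ?r"
    using Bd_ev good_ev Good_events by (intro Bochner_Integration.integrable_add integrable_mult_right integrable_real_indicator) (auto simp: emeasure_eq_measure)
  have pw: "\<bar>?a \<omega> - ?b \<omega>\<bar> \<le> ?r \<omega>" if "\<omega> \<in> space M" for \<omega>
  proof (cases "\<omega> \<in> Good")
    case True
    then have gk: "\<omega> \<in> good k" using Good_subset by blast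
    have "?a \<omega> - ?b \<omega> = (g (U T \<omega> + S \<omega> + u) - g (Z' \<omega> + u)) - (g (U T \<omega> + S \<omega>) - g (Z' \<omega>))"
      using True gk by simp
    then have tri: "\<bar>?a \<omega> - ?b \<omega>\<bar> \<le> \<bar>g (U T \<omega> + S \<omega> + u) - g (Z' \<omega> + u)\<bar> + \<bar>g (U T \<omega> + S \<omega>) - g (Z' \<omega>)\<bar>" by linarith
    show ?thesis
    proof (cases "\<omega> \<in> Bd")
      case True
      have "0 \<le> 2 * \<Lambda> / 64 ^ k" using Lip(1) by simp
      then show ?thesis using tri g1[of "U T \<omega> + S \<omega> + u" "Z' \<omega> + u"] g1[of "U T \<omega> + S \<omega>" "Z' \<omega>"] True gk \<open>\<omega> \<in> Good\<close> by simp
    next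
      case False
      then have fe: "\<bar>frozen_error k \<omega>\<bar> \<le> 1 / 64 ^ k" using \<open>\<omega> \<in> Good\<close> that by (auto simp: Bd_def not_less)
      have "\<Lambda> * \<bar>frozen_error k \<omega>\<bar> \<le> \<Lambda> * (1 / 64 ^ k)" by (rule mult_left_mono[OF fe Lip(1)])
      moreover have "\<bar>g (U T \<omega> + S \<omega> + u) - g (Z' \<omega> + u)\<bar> \<le> \<Lambda> * \<bar>frozen_error k \<omega>\<bar>"
        using Lip(2)[of "U T \<omega> + S \<omega> + u" "Z' \<omega> + u"] unfolding Zeq by simp
      moreover have "\<bar>g (U T \<omega> + S \<omega>) - g (Z' \<omega>)\<bar> \<le> \<Lambda> * \<bar>frozen_error k \<omega>\<bar>"
        using Lip(2)[of "U T \<omega> + S \<omega>" "Z' \<omega>"] unfolding Zeq by simp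
      ultimately show ?thesis using tri False \<open>\<omega> \<in> Good\<close> by simp
    qed
  next
    case False
    have "0 \<le> 2 * \<Lambda> / 64 ^ k" using Lip(1) by simp
    moreover have "\<omega> \<notin> Bd" using False by (auto simp: Bd_def)
    ultimately show ?thesis using False g1[of "Z' \<omega> + u" "Z' \<omega>"] by (cases "\<omega> \<in> good k") (simp_all add: add_increasing)
  qed
  have "\<bar>expectation ?a - expectation ?b\<bar> = \<bar>expectation (\<lambda>\<omega>. ?a \<omega> - ?b \<omega>)\<bar>" using ia ib by simp
  also have "\<dots> \<le> expectation (\<lambda>\<omega>. \<bar>?a \<omega> - ?b \<omega>\<bar>)" by (rule integral_abs_bound)
  also have "\<dots> \<le> expectation ?r" by (rule integral_mono[OF _ ir pw]) (use ia ib in auto)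
  also have "\<dots> = 2 * \<Lambda> / 64 ^ k + 2 * prob Bd + prob (good k - Good)"
  proof -
    have i1: "integrable M (indicator Bd :: 'a \<Rightarrow> real)" and i2: "integrable M (indicator (good k - Good) :: 'a \<Rightarrow> real)"
      using Bd_ev good_ev Good_events by (auto intro!: integrable_real_indicator simp: emeasure_eq_measure)
    have "Bd \<inter> space M = Bd" "(good k - Good) \<inter> space M = good k - Good"
      using sets.sets_into_space[OF Bd_ev] sets.sets_into_space[OF good_ev] by auto
    then show ?thesis using i1 i2 by (simp add: prob_space)
  qed
  also have "\<dots> \<le> 2 * \<Lambda> / 64 ^ k + 2 * (64 * L\<^sup>2 * T / 4 ^ k) + 2 * C1 / 4 ^ k"
    using prob_frozen_error[OF k] prob_good_diff[OF k] unfolding Bd_def by linarith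
  finally have 1: "\<bar>expectation ?a - expectation ?b\<bar> \<le> 2 * \<Lambda> / 64 ^ k + 128 * L\<^sup>2 * T / 4 ^ k + 2 * C1 / 4 ^ k"
    by simp
  have "\<bar>expectation ?b\<bar> \<le> u / (c * sqrt (T - ?t))" unfolding Z'_def
  proof (rule increment_shift_bound[OF t0 Ym Zm good_adapted[OF k] c(1) _ g u])
    fix \<omega> assume "\<omega> \<in> good k"
    then show "c \<le> \<bar>Z \<omega>\<bar>" unfolding Z_def using good_bound[OF _ k, of \<omega>] by (intro c(2)) linarith
  qed
  also have "sqrt (T - ?t) = sqrt T / 16 ^ k"
  proof -
    have "T - ?t = T / (16 ^ k)\<^sup>2" by (simp add: tm_def power2_eq_square flip: power_mult_distrib)
    then show ?thesis by (simp add: real_sqrt_divide)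
  qed
  finally have "\<bar>expectation ?b\<bar> \<le> u * 16 ^ k / (c * sqrt T)" by simp
  then show ?thesis using 1 by linarith
qed

text \<open>Collects the terms of \<open>Good_shift_bound\<close> for Lipschitz constant 32 ^ (k +
  1) and shift at most 32 ^ - k, each estimated by a multiple of 2 ^ - k; 64 is 2 * 32.\<close>

definition C3 :: real where
  "C3 = 64 + 128 * L\<^sup>2 * T + 2 * C1 + 1 / (c * sqrt T)"

lemma C3_nonneg: "0 \<le> C3"
  unfolding C3_def using T c(1) C1_nonneg by simp

text \<open>The coarse window is the average of 32 fine windows whose shifts do not exceed its
  length, and each of them has nearly the same expectation as the unshifted one.\<close>

lemma Good_window_step:
  assumes k: "k0 \<le> k" and S: "S \<in> borel_measurable (\<F> (tm T k0))" and B: "B \<in> sets borel"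
  shows "\<bar>expectation (\<lambda>\<omega>. indicator Good \<omega> * window B (1 / 32 ^ k) (U T \<omega> + S \<omega>)) -
    expectation (\<lambda>\<omega>. indicator Good \<omega> * window B (1 / 32 ^ Suc k) (U T \<omega> + S \<omega>))\<bar> \<le> C3 / 2 ^ k"
proof -
  define h where "h = (1 / 32 ^ Suc k :: real)"
  define g where "g = window B h"
  have h: "0 < h" "1 / 32 ^ k = real 32 * h" unfolding h_def by simp_all
  have gm: "g \<in> borel_measurable borel" unfolding g_def by (rule window_measurable[OF B h(1)])
  have gb: "0 \<le> g w" "g w \<le> 1" for w unfolding g_def using window_bounds[OF h(1)] by auto
  have gL: "\<bar>g y - g z\<bar> \<le> 1 / h * \<bar>y - z\<bar>" for y z
    unfolding g_def using window_Lipschitz[OF B h(1), of y z] by simp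
  let ?Z = "\<lambda>\<omega>. U T \<omega> + S \<omega>"
  have ZM: "?Z \<in> borel_measurable M"
    using T by (intro borel_measurable_add measurable_F_M[OF U_adapted] measurable_F_M[OF S]) auto
  have int: "integrable M (\<lambda>\<omega>. indicator Good \<omega> * g (?Z \<omega> + u))" for u
  proof (rule integrable_const_bound[of _ 1])
    show "(\<lambda>\<omega>. indicator Good \<omega> * g (?Z \<omega> + u)) \<in> borel_measurable M"
      by (intro borel_measurable_times borel_measurable_indicator Good_events
          measurable_compose[OF _ gm] borel_measurable_add[OF ZM borel_measurable_const])
    show "AE \<omega> in M. norm (indicator Good \<omega> * g (?Z \<omega> + u)) \<le> 1"
      using gb by (intro AE_I2) (auto simp: indicator_def)
  qed
  let ?E = "\<lambda>u. expectation (\<lambda>\<omega>. indicator Good \<omega> * g (?Z \<omega> + u))"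
  have diff: "\<bar>?E u - ?E 0\<bar> \<le> C3 / 2 ^ k" if u: "0 \<le> u" "u \<le> 1 / 32 ^ k" for u
  proof -
    have "?E u - ?E 0 = expectation (\<lambda>\<omega>. indicator Good \<omega> * g (?Z \<omega> + u) - indicator Good \<omega> * g (?Z \<omega> + 0))"
      by (rule Bochner_Integration.integral_diff[symmetric, OF int int])
    also have "\<dots> = expectation (\<lambda>\<omega>. indicator Good \<omega> * (g (U T \<omega> + S \<omega> + u) - g (U T \<omega> + S \<omega>)))"
      by (simp add: right_diff_distrib)
    finally have "\<bar>?E u - ?E 0\<bar> \<le> 2 * (1 / h) / 64 ^ k + 128 * L\<^sup>2 * T / 4 ^ k + 2 * C1 / 4 ^ k + u * 16 ^ k / (c * sqrt T)"
      using Good_shift_bound[OF k S gm gb _ gL u(1)] h by simp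
    also have "\<dots> \<le> 64 / 2 ^ k + 128 * L\<^sup>2 * T / 2 ^ k + 2 * C1 / 2 ^ k + 1 / (c * sqrt T) / 2 ^ k"
    proof (intro add_mono)
      have "(64::real) ^ k = 2 ^ k * 32 ^ k" by (simp flip: power_mult_distrib)
      then show "2 * (1 / h) / 64 ^ k \<le> 64 / 2 ^ k" by (simp add: h_def)
      have "(2::real) ^ k \<le> 4 ^ k" by (rule power_mono) auto
      then show "128 * L\<^sup>2 * T / 4 ^ k \<le> 128 * L\<^sup>2 * T / 2 ^ k" "2 * C1 / 4 ^ k \<le> 2 * C1 / 2 ^ k"
        using T C1_nonneg by (auto intro!: divide_left_mono)
      have p: "(32::real) ^ k = 2 ^ k * 16 ^ k" by (simp flip: power_mult_distrib)
      have "u * 16 ^ k \<le> 1 / 32 ^ k * 16 ^ k" using u(2) by (rule mult_right_mono) simp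
      also have "\<dots> = 1 / 2 ^ k" unfolding p by simp
      finally have "u * 16 ^ k / (c * sqrt T) \<le> 1 / 2 ^ k / (c * sqrt T)"
        using c(1) T by (intro divide_right_mono) auto
      then show "u * 16 ^ k / (c * sqrt T) \<le> 1 / (c * sqrt T) / 2 ^ k" by (simp add: mult.commute)
    qed
    also have "\<dots> = C3 / 2 ^ k" unfolding C3_def by (simp add: add_divide_distrib)
    finally show ?thesis .
  qed
  have split: "window B (1 / 32 ^ k) y = (\<Sum>i<32. g (y + real i * h)) / 32" for y
    unfolding h(2) g_def using window_split[OF B h(1), of 32 y] by simp
  have "expectation (\<lambda>\<omega>. indicator Good \<omega> * window B (1 / 32 ^ k) (?Z \<omega>)) =
      expectation (\<lambda>\<omega>. (\<Sum>i<32. indicator Good \<omega> * g (?Z \<omega> + real i * h)) / 32)"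
    unfolding split by (simp add: sum_distrib_left)
  also have "\<dots> = (\<Sum>i<32. ?E (real i * h)) / 32"
    by (simp only: integral_divide_zero Bochner_Integration.integral_sum[OF int])
  finally have e1: "expectation (\<lambda>\<omega>. indicator Good \<omega> * window B (1 / 32 ^ k) (?Z \<omega>)) = (\<Sum>i<32. ?E (real i * h)) / 32" .
  have e2: "expectation (\<lambda>\<omega>. indicator Good \<omega> * window B (1 / 32 ^ Suc k) (?Z \<omega>)) = (\<Sum>i<(32::nat). ?E 0) / 32"
    by (simp add: g_def h_def)
  have "\<bar>(\<Sum>i<32. ?E (real i * h)) - (\<Sum>i<(32::nat). ?E 0)\<bar> = \<bar>\<Sum>i<32. (?E (real i * h) - ?E 0)\<bar>"
    by (simp only: sum_subtractf)
  also have "\<dots> \<le> (\<Sum>i<32. \<bar>?E (real i * h) - ?E 0\<bar>)" by (rule sum_abs)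
  also have "\<dots> \<le> (\<Sum>i<(32::nat). C3 / 2 ^ k)"
  proof (rule sum_mono, rule diff)
    fix i :: nat assume "i \<in> {..<32}"
    then have "real i * h \<le> real 32 * h" using h(1) by (intro mult_right_mono) auto
    then show "real i * h \<le> 1 / 32 ^ k" using h(2) by simp
  qed (use h in simp)
  finally have "\<bar>(\<Sum>i<32. ?E (real i * h)) - (\<Sum>i<(32::nat). ?E 0)\<bar> \<le> 32 * (C3 / 2 ^ k)" by simp
  moreover have "\<bar>p / 32 - q / 32\<bar> \<le> r" if "\<bar>p - q\<bar> \<le> 32 * r" for p q r :: real using that by linarith
  ultimately show ?thesis unfolding e1 e2 by blast
qed

text \<open>At scale \<open>k\<close> the window average is bounded through the measure of
  \<open>V\<close>. It is moved to ever finer scales at a total cost of 2 * C3 / 2 ^ k, and in the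
  limit it becomes 1 on \<open>V\<close> because \<open>V\<close> is open.\<close>

lemma prob_Good_open:
  assumes k: "k0 \<le> k" and S: "S \<in> borel_measurable (\<F> (tm T k0))"
    and V: "open V" "emeasure lborel V < \<infinity>"
  shows "prob (Good \<inter> {\<omega>\<in>space M. U T \<omega> + S \<omega> \<in> V}) \<le> measure lborel V * 32 ^ k + 2 * C3 / 2 ^ k"
proof -
  let ?Z = "\<lambda>\<omega>. U T \<omega> + S \<omega>"
  let ?w = "\<lambda>n. window V (1 / 32 ^ n)"
  let ?E = "\<lambda>n. expectation (\<lambda>\<omega>. indicator Good \<omega> * ?w n (?Z \<omega>))"
  have OB: "V \<in> sets borel" using V(1) by simp
  have ZM: "?Z \<in> borel_measurable M"
    using T by (intro borel_measurable_add measurable_F_M[OF U_adapted] measurable_F_M[OF S]) auto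
  have wb: "0 \<le> ?w n y" "?w n y \<le> 1" for n y using window_bounds[of "1 / 32 ^ n" V y] by auto
  have wM: "(\<lambda>\<omega>. ?w n (?Z \<omega>)) \<in> borel_measurable M" for n
    by (rule measurable_compose[OF ZM window_measurable[OF OB]]) simp
  have int: "integrable M (\<lambda>\<omega>. indicator Good \<omega> * ?w n (?Z \<omega>))" for n
  proof (rule integrable_const_bound[of _ 1])
    show "(\<lambda>\<omega>. indicator Good \<omega> * ?w n (?Z \<omega>)) \<in> borel_measurable M"
      by (intro borel_measurable_times borel_measurable_indicator Good_events wM)
    show "AE \<omega> in M. norm (indicator Good \<omega> * ?w n (?Z \<omega>)) \<le> 1"
      using wb by (intro AE_I2) (auto simp: indicator_def)
  qed
  have "?E k \<le> expectation (\<lambda>\<omega>. measure lborel V * 32 ^ k)"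
  proof (rule integral_mono[OF int])
    fix \<omega>
    have "?w k (?Z \<omega>) \<le> measure lborel V * 32 ^ k"
      using window_le_measure[OF OB V(2), of "1 / 32 ^ k"] by simp
    then show "indicator Good \<omega> * ?w k (?Z \<omega>) \<le> measure lborel V * 32 ^ k"
      by (simp add: indicator_def)
  qed simp
  then have Ek: "?E k \<le> measure lborel V * 32 ^ k" by (simp add: prob_space)
  \<comment> \<open>The subtracted term makes the bound on the geometric sum inductive.\<close>
  have En: "?E (k + n) \<le> ?E k + 2 * (C3 / 2 ^ k) - 2 * (C3 / 2 ^ (k + n))" for n
  proof (induction n)
    case (Suc n)
    define e where "e = C3 / 2 ^ (k + n)"
    have e: "C3 / 2 ^ (k + Suc n) = e / 2" by (simp add: e_def)
    have "\<bar>?E (k + n) - ?E (k + Suc n)\<bar> \<le> e" unfolding e_def add_Suc_right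
      by (rule Good_window_step[OF _ S OB]) (use k in simp)
    then show ?case using Suc.IH unfolding e e_def[symmetric] by linarith
  qed simp
  \<comment> \<open>Here the window of scale \<open>n\<close> has not yet resolved \<open>V\<close>;
    every \<omega> leaves these events eventually.\<close>
  define bad where "bad n = {\<omega>\<in>space M. ?Z \<omega> \<in> V \<and> ?w n (?Z \<omega>) \<noteq> 1}" for n
  have OM: "{\<omega>\<in>space M. ?Z \<omega> \<in> V} \<in> events"
    using measurable_sets[OF ZM OB] by (simp add: vimage_def Int_def conj_commute)
  have badM: "bad n \<in> events" for n
  proof -
    have "{\<omega>\<in>space M. ?w n (?Z \<omega>) \<noteq> 1} \<in> events" by (intro borel_measurable_neq wM borel_measurable_const)
    moreover have "bad n = {\<omega>\<in>space M. ?Z \<omega> \<in> V} \<inter> {\<omega>\<in>space M. ?w n (?Z \<omega>) \<noteq> 1}" by (auto simp: bad_def)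
    ultimately show ?thesis using OM by auto
  qed
  have "(\<lambda>n. prob (bad n)) \<longlonglongrightarrow> 0" unfolding bad_def
  proof (rule prob_tendsto_0)
    show "{\<omega>\<in>space M. ?Z \<omega> \<in> V \<and> ?w n (?Z \<omega>) \<noteq> 1} \<in> events" for n using badM by (simp add: bad_def)
    fix \<omega> assume "\<omega> \<in> space M"
    show "\<forall>\<^sub>F n in sequentially. \<not> (?Z \<omega> \<in> V \<and> ?w n (?Z \<omega>) \<noteq> 1)"
    proof (cases "?Z \<omega> \<in> V")
      case True
      obtain d where d: "d > 0" "\<And>h. 0 < h \<Longrightarrow> h < d \<Longrightarrow> window V h (?Z \<omega>) = 1"
        using window_eq_1_eventually[OF V(1) True] by blast
      have "(\<lambda>n. (1 / 32 :: real) ^ n) \<longlonglongrightarrow> 0" by (rule LIMSEQ_power_zero) simp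
      then have "eventually (\<lambda>n. (1 / 32 :: real) ^ n < d) sequentially" using d(1) by (rule order_tendstoD)
      then show ?thesis
      proof eventually_elim
        case (elim n)
        then show ?case using d(2)[of "1 / 32 ^ n"] by (simp add: power_divide)
      qed
    qed simp
  qed
  then have "(\<lambda>n. prob (bad (n + k))) \<longlonglongrightarrow> 0" by (rule LIMSEQ_ignore_initial_segment)
  then have lim: "(\<lambda>n. measure lborel V * 32 ^ k + 2 * (C3 / 2 ^ k) + prob (bad (n + k))) \<longlonglongrightarrow>
      measure lborel V * 32 ^ k + 2 * (C3 / 2 ^ k) + 0"
    by (intro tendsto_add tendsto_const)
  have "prob (Good \<inter> {\<omega>\<in>space M. ?Z \<omega> \<in> V}) \<le> measure lborel V * 32 ^ k + 2 * (C3 / 2 ^ k) + prob (bad (n + k))" for n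
  proof -
    let ?A = "Good \<inter> {\<omega>\<in>space M. ?Z \<omega> \<in> V}"
    have Aev: "?A \<in> events" using Good_events OM by auto
    have iA: "integrable M (indicator ?A :: 'a \<Rightarrow> real)" and iB: "integrable M (indicator (bad (k + n)) :: 'a \<Rightarrow> real)"
      using Aev badM by (auto intro!: integrable_real_indicator simp: emeasure_eq_measure)
    have "prob ?A = expectation (indicator ?A)"
      using sets.sets_into_space[OF Aev] by (simp add: Int_absorb2)
    also have "\<dots> \<le> expectation (\<lambda>\<omega>. indicator Good \<omega> * ?w (k + n) (?Z \<omega>) + indicator (bad (k + n)) \<omega>)"
    proof (rule integral_mono[OF iA])
      show "integrable M (\<lambda>\<omega>. indicator Good \<omega> * ?w (k + n) (?Z \<omega>) + indicator (bad (k + n)) \<omega>)"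
        using int iB by (intro Bochner_Integration.integrable_add)
      fix \<omega> assume "\<omega> \<in> space M"
      then show "indicator ?A \<omega> \<le> indicator Good \<omega> * ?w (k + n) (?Z \<omega>) + indicator (bad (k + n)) \<omega>"
        using wb[of "k + n" "?Z \<omega>"] by (auto simp: indicator_def bad_def)
    qed
    also have "\<dots> = ?E (k + n) + expectation (indicator (bad (k + n)))"
      by (rule Bochner_Integration.integral_add[OF int iB])
    also have "expectation (indicator (bad (k + n))) = prob (bad (k + n))"
      using sets.sets_into_space[OF badM] by (simp add: Int_absorb2)
    finally have "prob ?A \<le> ?E (k + n) + prob (bad (k + n))" .
    moreover have "0 \<le> C3 / 2 ^ (k + n)" using C3_nonneg by simp
    ultimately show ?thesis using En[of n] Ek unfolding add.commute[of n k] by linarith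
  qed
  then have "prob (Good \<inter> {\<omega>\<in>space M. ?Z \<omega> \<in> V}) \<le> measure lborel V * 32 ^ k + 2 * (C3 / 2 ^ k) + 0"
    by (intro LIMSEQ_le_const[OF lim]) blast
  then show ?thesis by simp
qed

lemma prob_Good_null:
  assumes S: "S \<in> borel_measurable (\<F> (tm T k0))" and A: "A \<in> null_sets lborel"
  shows "prob (Good \<inter> {\<omega>\<in>space M. U T \<omega> + S \<omega> \<in> A}) = 0"
proof -
  have "prob (Good \<inter> {\<omega>\<in>space M. U T \<omega> + S \<omega> \<in> A}) \<le> 0 + e" if e: "0 < e" for e
  proof -
    have "(\<lambda>k. 2 * C3 * (1 / 2) ^ k) \<longlonglongrightarrow> 2 * C3 * 0"
      by (intro tendsto_mult tendsto_const LIMSEQ_power_zero) simp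
    then have "eventually (\<lambda>k. 2 * C3 * (1 / 2) ^ k < e / 2) sequentially"
      using e by (intro order_tendstoD(2)[where y="2 * C3 * 0"]) auto
    then have "eventually (\<lambda>k. 2 * C3 * (1 / 2) ^ k < e / 2 \<and> k0 \<le> k) sequentially"
      using eventually_ge_at_top by (rule eventually_conj)
    then obtain k where k: "2 * C3 * (1 / 2) ^ k < e / 2" "k0 \<le> k"
      unfolding eventually_sequentially by blast
    have Ab: "A \<in> sets borel" using A by (auto simp: null_sets_def)
    \<comment> \<open>The scale \<open>k\<close> is chosen before \<open>V\<close>: the measure of
      \<open>V\<close> enters with the factor 32 ^ k, so \<open>V\<close> has to be small relative
      to the chosen scale.\<close>
    have "0 < ennreal (e / 2 / 32 ^ k)" using e by simp
    then obtain V where V: "open V" "A \<subseteq> V" "emeasure lborel (V - A) < ennreal (e / 2 / 32 ^ k)"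
      using outer_regular_lborel[OF Ab, of "e / 2 / 32 ^ k"] e by auto
    have "emeasure lborel V = emeasure lborel (V - A)"
      using emeasure_Diff_null_set[OF A, of V] V(1) by simp
    then have lt: "emeasure lborel V < ennreal (e / 2 / 32 ^ k)" using V(3) by simp
    from lt have fin: "emeasure lborel V < \<infinity>" by (rule less_trans) simp
    have "measure lborel V < e / 2 / 32 ^ k"
      using lt fin e by (simp add: measure_def enn2real_less_iff)
    then have "measure lborel V * 32 ^ k < e / 2" by (simp add: field_simps)
    moreover have "prob (Good \<inter> {\<omega>\<in>space M. U T \<omega> + S \<omega> \<in> V}) \<le> measure lborel V * 32 ^ k + 2 * C3 / 2 ^ k"
      by (rule prob_Good_open[OF k(2) S V(1) fin])
    moreover have "2 * C3 / 2 ^ k = 2 * C3 * (1 / 2) ^ k" by (simp add: power_divide)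
    moreover have "prob (Good \<inter> {\<omega>\<in>space M. U T \<omega> + S \<omega> \<in> A}) \<le> prob (Good \<inter> {\<omega>\<in>space M. U T \<omega> + S \<omega> \<in> V})"
    proof (rule finite_measure_mono)
      have "(\<lambda>\<omega>. U T \<omega> + S \<omega>) \<in> borel_measurable M"
        using T by (intro borel_measurable_add measurable_F_M[OF U_adapted] measurable_F_M[OF S]) auto
      then have "(\<lambda>\<omega>. U T \<omega> + S \<omega>) -` V \<inter> space M \<in> events"
        by (rule measurable_sets) (use V(1) in simp)
      then show "Good \<inter> {\<omega>\<in>space M. U T \<omega> + S \<omega> \<in> V} \<in> events"
        using Good_events by (simp add: vimage_def Int_def conj_commute)
    qed (use V(2) in auto)
    ultimately show ?thesis using k(1) by linarith
  qed
  then have "prob (Good \<inter> {\<omega>\<in>space M. U T \<omega> + S \<omega> \<in> A}) \<le> 0" by (rule field_le_epsilon)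
  then show ?thesis by (simp add: measure_le_0_iff)
qed

end

section \<open>Removing the localization\<close>

lemma continuous_bound_on_interval:
  fixes f :: "real \<Rightarrow> real"
  assumes "continuous_on UNIV f" obtains B where "\<And>y. \<bar>y\<bar> \<le> R \<Longrightarrow> \<bar>f y\<bar> \<le> B"
proof -
  have "bounded (f ` {- R..R})"
    by (intro compact_imp_bounded compact_continuous_image continuous_on_subset[OF assms]) auto
  then obtain B where "\<forall>y\<in>f ` {- R..R}. norm y \<le> B" unfolding bounded_iff by blast
  then show ?thesis by (intro that[of B]) (auto simp: abs_le_iff)
qed

lemma eventually_power_bound:
  fixes r :: real assumes "1 < r" shows "eventually (\<lambda>k. B \<le> r ^ k) sequentially"
proof -
  obtain n where n: "B < r ^ n" using real_arch_pow[OF assms] by blast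
  have "B \<le> r ^ k" if "n \<le> k" for k
  proof -
    have "r ^ n \<le> r ^ k" using assms by (intro power_increasing that) simp
    then show ?thesis using n by simp
  qed
  then show ?thesis unfolding eventually_sequentially by blast
qed

context perturbed_diffusion
begin

lemma exceedance_events:
  assumes "T > 0" shows "{\<omega>\<in>space M. \<exists>q\<in>dyadics T. q \<le> T \<and> \<bar>X q \<omega>\<bar> > B} \<in> events"
proof -
  have "{\<omega>\<in>space M. T * real i / 2 ^ l \<le> T \<and> \<bar>X (T * real i / 2 ^ l) \<omega>\<bar> > B} \<in> events" for i l
    using assms by (intro sets.sets_Collect_conj sets.sets_Collect_const borel_measurable_less
        borel_measurable_const borel_measurable_abs X_measurable) auto
  then show ?thesis unfolding bex_dyadics by (intro sets.sets_Collect_countable_Ex)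
qed

lemma prob_exceedance:
  assumes "T > 0"
  shows "(\<lambda>n. prob {\<omega>\<in>space M. \<exists>q\<in>dyadics T. q \<le> T \<and> \<bar>X q \<omega>\<bar> > real n}) \<longlonglongrightarrow> 0"
proof (rule prob_tendsto_0)
  show "{\<omega>\<in>space M. \<exists>q\<in>dyadics T. q \<le> T \<and> \<bar>X q \<omega>\<bar> > real n} \<in> events" for n
    by (rule exceedance_events[OF assms])
next
  fix \<omega> assume \<omega>: "\<omega> \<in> space M"
  have "bounded ((\<lambda>t. X t \<omega>) ` {0..T})"
    by (intro compact_imp_bounded compact_continuous_image X_cont_on[OF \<omega>]) auto
  then obtain B where "\<forall>y\<in>(\<lambda>t. X t \<omega>) ` {0..T}. norm y \<le> B" unfolding bounded_iff by blast
  then have B: "\<And>t. t \<in> {0..T} \<Longrightarrow> \<bar>X t \<omega>\<bar> \<le> B" by auto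
  obtain n0 :: nat where n0: "B \<le> real n0" using real_arch_simple by blast
  have "\<not> (\<exists>q\<in>dyadics T. q \<le> T \<and> \<bar>X q \<omega>\<bar> > real n)" if "n0 \<le> n" for n
  proof (intro notI, elim bexE conjE)
    fix q assume "q \<in> dyadics T" "q \<le> T" "\<bar>X q \<omega>\<bar> > real n"
    then show False using B[of q] dyadics_nonneg[OF assms, of q] n0 that by simp
  qed
  then show "\<forall>\<^sub>F n in sequentially. \<not> (\<exists>q\<in>dyadics T. q \<le> T \<and> \<bar>X q \<omega>\<bar> > real n)"
    unfolding eventually_sequentially by blast
qed

lemma \<sigma>_lower_bound:
  assumes "0 \<le> R" obtains c where "c > 0" "\<And>y. \<bar>y\<bar> \<le> R \<Longrightarrow> c \<le> \<bar>\<sigma> y\<bar>"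
proof -
  have "\<exists>z\<in>{- R..R}. \<forall>y\<in>{- R..R}. \<bar>\<sigma> z\<bar> \<le> \<bar>\<sigma> y\<bar>"
    by (rule continuous_attains_inf) (use assms in \<open>auto intro!: continuous_intros \<sigma>_cont\<close>)
  then obtain z where "\<And>y. y \<in> {- R..R} \<Longrightarrow> \<bar>\<sigma> z\<bar> \<le> \<bar>\<sigma> y\<bar>" by blast
  then show ?thesis using \<sigma>_pos[of z] by (intro that[of "\<bar>\<sigma> z\<bar>"]) (auto simp: abs_le_iff)
qed

lemma prob_U_shift_null:
  assumes T: "T > 0" and s: "0 \<le> s" "s < T" and S: "S \<in> borel_measurable (\<F> s)"
    and A: "A \<in> null_sets lborel"
  shows "prob {\<omega>\<in>space M. U T \<omega> + S \<omega> \<in> A} = 0"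
proof -
  have ZM: "(\<lambda>\<omega>. U T \<omega> + S \<omega>) \<in> borel_measurable M"
    using T by (intro borel_measurable_add measurable_F_M[OF U_adapted] measurable_F_M[OF S]) auto
  have "A \<in> sets borel" using A by (auto simp: null_sets_def)
  then have ev: "{\<omega>\<in>space M. U T \<omega> + S \<omega> \<in> A} \<in> events"
    using measurable_sets[OF ZM] by (simp add: vimage_def Int_def conj_commute)
  have "prob {\<omega>\<in>space M. U T \<omega> + S \<omega> \<in> A} \<le> 0 + e" if e: "0 < e" for e
  proof -
    \<comment> \<open>The bound \<open>K\<close> comes first, with probability less than
      \<open>e / 2\<close> of exceeding it; all later constants may depend on it.\<close>
    have "eventually (\<lambda>n. prob {\<omega>\<in>space M. \<exists>q\<in>dyadics T. q \<le> T \<and> \<bar>X q \<omega>\<bar> > real n} < e / 2) sequentially"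
      using prob_exceedance[OF T] e by (intro order_tendstoD) auto
    then obtain n where n: "prob {\<omega>\<in>space M. \<exists>q\<in>dyadics T. q \<le> T \<and> \<bar>X q \<omega>\<bar> > real n} < e / 2"
      unfolding eventually_sequentially by blast
    define K where "K = real n"
    have K: "0 \<le> K" by (simp add: K_def)
    obtain L where L: "L-lipschitz_on UNIV \<sigma>" using \<sigma>_Lipschitz by blast
    obtain Bs where Bs: "\<And>y. \<bar>y\<bar> \<le> K + 4 \<Longrightarrow> \<bar>\<sigma> y\<bar> \<le> Bs" using continuous_bound_on_interval[OF \<sigma>_cont] by blast
    obtain Bb where Bb: "\<And>y. \<bar>y\<bar> \<le> K + 4 \<Longrightarrow> \<bar>b y\<bar> \<le> Bb" using continuous_bound_on_interval[OF b_cont] by blast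
    have Bb0: "0 \<le> Bb" using Bb[of 0] K by simp
    obtain c where c: "c > 0" "\<And>y. \<bar>y\<bar> \<le> K + 4 \<Longrightarrow> c \<le> \<bar>\<sigma> y\<bar>" using \<sigma>_lower_bound[of "K + 4"] K by auto
    obtain C where C: "C > 0"
      and osc: "\<And>T a c m K \<theta> Bs Bb. T > 0 \<Longrightarrow> a \<le> c \<Longrightarrow> 0 \<le> K \<Longrightarrow> 0 < \<theta> \<Longrightarrow>
      (\<And>y. \<bar>y\<bar> \<le> K + \<theta> \<Longrightarrow> \<bar>\<sigma> y\<bar> \<le> Bs) \<Longrightarrow> (\<And>y. \<bar>y\<bar> \<le> K + \<theta> \<Longrightarrow> \<bar>b y\<bar> \<le> Bb) \<Longrightarrow>
      Bb * (T * real c / 2 ^ m - T * real a / 2 ^ m) \<le> \<theta> / (4 * C) \<Longrightarrow>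
      prob {\<omega>\<in>space M. \<bar>X (T * real a / 2 ^ m) \<omega>\<bar> \<le> K \<and>
        (\<exists>q\<in>dyadics T. T * real a / 2 ^ m \<le> q \<and> q \<le> T * real c / 2 ^ m \<and> \<bar>X q \<omega> - X (T * real a / 2 ^ m) \<omega>\<bar> > \<theta>)}
      \<le> 64 * C\<^sup>2 * Bs\<^sup>2 * (T * real c / 2 ^ m - T * real a / 2 ^ m) / \<theta>\<^sup>2"
      using prob_oscillation by blast
    define C1 where "C1 = 64 * C\<^sup>2 * Bs\<^sup>2 * T"
    have "eventually (\<lambda>k. 2 * Bb * T \<le> 4 ^ k \<and> 4 * C * Bb * T \<le> 32 ^ k \<and> 4 * C1 / e \<le> 4 ^ k \<and> s < tm T k) sequentially"
      by (intro eventually_conj eventually_power_bound order_tendstoD(1)[OF tm_lim s(2)]) auto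
    then obtain k0 where k0: "2 * Bb * T \<le> 4 ^ k0" "4 * C * Bb * T \<le> 32 ^ k0" "4 * C1 / e \<le> 4 ^ k0" "s < tm T k0"
      unfolding eventually_sequentially by blast
    interpret localized_diffusion M W X b \<sigma> \<alpha> \<beta> x T K L Bb C1 c k0
    proof
      fix k assume k: "k0 \<le> k"
      let ?s = "tm T k" and ?r = "tm T (Suc k)"
      have diff: "?r - ?s \<le> T / 256 ^ k" by (rule tm_diff[OF T])
      have p: "(256::real) ^ k = 8 ^ k * 32 ^ k" "((8::real) ^ k)\<^sup>2 = 64 ^ k" "(256::real) ^ k = 4 ^ k * 64 ^ k"
        by (simp_all add: power2_eq_square flip: power_mult_distrib)
      have theta: "1 / 8 ^ k \<le> (1 :: real)" by simp
      have bnd: "\<bar>\<sigma> y\<bar> \<le> Bs" "\<bar>b y\<bar> \<le> Bb" if "\<bar>y\<bar> \<le> K + 2 + 1 / 8 ^ k" for y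
      proof -
        have "\<bar>y\<bar> \<le> K + 4" using that theta by linarith
        then show "\<bar>\<sigma> y\<bar> \<le> Bs" "\<bar>b y\<bar> \<le> Bb" by (auto intro: Bs Bb)
      qed
      have "(32::real) ^ k0 \<le> 32 ^ k" using k by (intro power_increasing) auto
      then have big: "4 * C * Bb * T \<le> 32 ^ k" using k0(2) by linarith
      have "Bb * (?r - ?s) \<le> Bb * (T / 256 ^ k)" using diff Bb0 by (rule mult_left_mono)
      also have "\<dots> \<le> 1 / 8 ^ k / (4 * C)" unfolding p(1) using big C by (simp add: field_simps)
      finally have drift: "Bb * (?r - ?s) \<le> 1 / 8 ^ k / (4 * C)" .
      have "prob {\<omega>\<in>space M. \<bar>X ?s \<omega>\<bar> \<le> K + 2 \<and>
          (\<exists>q\<in>dyadics T. ?s \<le> q \<and> q \<le> ?r \<and> \<bar>X q \<omega> - X ?s \<omega>\<bar> > 1 / 8 ^ k)} \<le> 64 * C\<^sup>2 * Bs\<^sup>2 * (?r - ?s) / (1 / 8 ^ k)\<^sup>2"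
        using drift unfolding tm_eq_dyadic_fine[of T k] tm_eq_dyadic[of T "Suc k"]
      proof (intro osc T bnd)
        show "(256 ^ k - 1) * 256 \<le> (256 ^ Suc k - 1 :: nat)" by (simp add: algebra_simps)
      qed (use K in \<open>auto intro: bnd\<close>)
      also have "\<dots> \<le> 64 * C\<^sup>2 * Bs\<^sup>2 * (T / 256 ^ k) / (1 / 8 ^ k)\<^sup>2"
        using diff by (intro divide_right_mono mult_left_mono) auto
      \<comment> \<open>The squared threshold contributes 64 ^ k, the time step 256 ^ - k.\<close>
      also have "\<dots> = C1 / 4 ^ k" unfolding C1_def power_divide p(2,3) by simp
      finally show "prob {\<omega>\<in>space M. \<bar>X ?s \<omega>\<bar> \<le> K + 2 \<and>
          (\<exists>q\<in>dyadics T. ?s \<le> q \<and> q \<le> ?r \<and> \<bar>X q \<omega> - X ?s \<omega>\<bar> > 1 / 8 ^ k)} \<le> C1 / 4 ^ k" .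
    qed (use T K L c Bb k0 in auto)
    let ?Z = "{\<omega>\<in>space M. U T \<omega> + S \<omega> \<in> A}"
      and ?B = "{\<omega>\<in>space M. \<exists>q\<in>dyadics T. q \<le> T \<and> \<bar>X q \<omega>\<bar> > real n}"
    have Sk: "S \<in> borel_measurable (\<F> (tm T k0))" by (rule measurable_F_mono[OF S]) (use k0 in simp)
    have B_ev: "?B \<in> events" by (rule exceedance_events[OF T])
    have evs: "Good \<inter> ?Z \<in> events" "good k0 - Good \<in> events"
      using Good_events good_events[OF order_refl] ev by auto
    \<comment> \<open>Outside \<open>Good\<close> either the path exceeds \<open>K\<close> at time
      \<open>tm T k0\<close>, or some later oscillation condition fails.\<close>
    have "?Z \<subseteq> (Good \<inter> ?Z) \<union> (?B \<union> (good k0 - Good))"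
    proof
      fix \<omega> assume \<omega>: "\<omega> \<in> ?Z"
      show "\<omega> \<in> (Good \<inter> ?Z) \<union> (?B \<union> (good k0 - Good))"
      proof (cases "\<bar>X (tm T k0) \<omega>\<bar> \<le> K")
        case True
        then have "\<omega> \<in> good k0" using \<omega> by (simp add: good_def)
        then show ?thesis using \<omega> by blast
      next
        case False
        then have "\<omega> \<in> ?B" using \<omega> tm_in_dyadics[of T k0] tm_less[OF T, of k0]
          by (auto simp: K_def not_le intro!: bexI[of _ "tm T k0"])
        then show ?thesis by blast
      qed
    qed
    then have "prob ?Z \<le> prob ((Good \<inter> ?Z) \<union> (?B \<union> (good k0 - Good)))"
      by (rule finite_measure_mono) (use evs B_ev in auto)
    also have "\<dots> \<le> prob (Good \<inter> ?Z) + prob (?B \<union> (good k0 - Good))"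
      by (rule measure_Un_le) (use evs B_ev in auto)
    also have "prob (?B \<union> (good k0 - Good)) \<le> prob ?B + prob (good k0 - Good)"
      by (rule measure_Un_le) (use evs B_ev in auto)
    finally have le: "prob ?Z \<le> prob (Good \<inter> ?Z) + (prob ?B + prob (good k0 - Good))" by simp
    have "4 * C1 \<le> 4 ^ k0 * e" using k0(3) e by (simp add: field_simps)
    then have "2 * C1 / 4 ^ k0 \<le> e / 2" by (simp add: field_simps)
    then show ?thesis
      using le prob_Good_null[OF Sk A] prob_good_diff[OF order_refl] n by linarith
  qed
  then have "prob {\<omega>\<in>space M. U T \<omega> + S \<omega> \<in> A} \<le> 0" by (rule field_le_epsilon)
  then show ?thesis by (simp add: measure_le_0_iff)
qed

end

section \<open>The law of the perturbed diffusion\<close>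

lemma null_sets_scale:
  fixes A :: "real set"
  assumes A: "A \<in> null_sets lborel" and c: "c \<noteq> 0"
  shows "(\<lambda>y. c * y) -` A \<in> null_sets lborel"
proof -
  have Ab: "A \<in> sets borel" using A by (auto simp: null_sets_def)
  have m: "(\<lambda>y. c * y) \<in> borel_measurable borel" by simp
  have pre: "(\<lambda>y. c * y) -` A \<in> sets borel" using measurable_sets[OF m Ab] by simp
  have "emeasure lborel A = emeasure (density (distr lborel borel (\<lambda>x. 0 + c * x)) (\<lambda>_. ennreal \<bar>c\<bar>)) A"
    using lborel_real_affine[OF c, of 0] by (rule arg_cong)
  also have "\<dots> = ennreal \<bar>c\<bar> * emeasure lborel ((\<lambda>y. c * y) -` A)"
    using Ab by (simp add: emeasure_density_const emeasure_distr)
  finally have "ennreal \<bar>c\<bar> * emeasure lborel ((\<lambda>y. c * y) -` A) = 0" using A by (simp add: null_sets_def)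
  then show ?thesis using pre c by (auto simp: null_sets_def)
qed

text \<open>The time from which an extremum stays constant is random; being below \<open>T\<close>,
  it is passed by some \<open>tm T k\<close>, so countably many exceptional sets suffice.\<close>

lemma (in perturbed_diffusion) prob_X_null:
  assumes T: "T > 0" and A: "A \<in> null_sets lborel"
  shows "prob (X T -` A \<inter> space M) = 0"
proof -
  let ?M = "\<lambda>t \<omega>. run_max (\<lambda>s. X s \<omega>) t" and ?m = "\<lambda>t \<omega>. run_min (\<lambda>s. X s \<omega>) t"
  let ?A1 = "(\<lambda>y. 1 / (1 - \<alpha>) * y) -` A" and ?A2 = "(\<lambda>y. 1 / (1 - \<beta>) * y) -` A"
  define E where "E S B = {\<omega>\<in>space M. U T \<omega> + S \<omega> \<in> B}" for S and B :: "real set"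
  \<comment> \<open>\<open>S4\<close> serves the case that \<open>X T\<close> is both extrema: the
    path is then constant up to \<open>T\<close>, so U T = (1 - \<alpha> - \<beta>) * X 0, and the
    shifted variable hits the null set {0}.\<close>
  define S1 S2 S3 S4 where "S1 k \<omega> = \<alpha> * ?M (tm T k) \<omega> + \<beta> * ?m (tm T k) \<omega>"
    and "S2 k \<omega> = \<beta> * ?m (tm T k) \<omega>" and "S3 k \<omega> = \<alpha> * ?M (tm T k) \<omega>"
    and "S4 \<omega> = (\<alpha> + \<beta> - 1) * X 0 \<omega>" for k \<omega>
  define N where "N = (\<Union>k. E (S1 k) A \<union> E (S2 k) ?A1 \<union> E (S3 k) ?A2) \<union> E S4 {0}"
  have null: "E S B \<in> null_sets M"
    if "S \<in> borel_measurable (\<F> s)" "0 \<le> s" "s < T" "B \<in> null_sets lborel" for S B s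
  proof -
    have "(\<lambda>\<omega>. U T \<omega> + S \<omega>) \<in> borel_measurable M"
      using T that by (intro borel_measurable_add measurable_F_M[OF U_adapted] measurable_F_M[OF that(1)]) auto
    moreover have "B \<in> sets borel" using that by (auto simp: null_sets_def)
    ultimately have "E S B \<in> events"
      using measurable_sets[of "\<lambda>\<omega>. U T \<omega> + S \<omega>" M borel B] by (simp add: E_def vimage_def Int_def conj_commute)
    moreover have "prob (E S B) = 0" unfolding E_def by (rule prob_U_shift_null[OF T that(2,3,1,4)])
    ultimately show ?thesis by (simp add: null_sets_def emeasure_eq_measure)
  qed
  have Mm: "?M (tm T k) \<in> borel_measurable (\<F> (tm T k))" "?m (tm T k) \<in> borel_measurable (\<F> (tm T k))" for k
    using tm_nonneg[OF T] by (auto intro: X_run_max_adapted X_run_min_adapted)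
  have A1: "?A1 \<in> null_sets lborel" by (rule null_sets_scale[OF A]) (use \<alpha> in auto)
  have A2: "?A2 \<in> null_sets lborel" by (rule null_sets_scale[OF A]) (use \<beta> in auto)
  have "N \<in> null_sets M" unfolding N_def
  proof (intro null_sets.Un null_sets_UN)
    fix k
    have t: "0 \<le> tm T k" "tm T k < T" using tm_nonneg[OF T] tm_less[OF T] by auto
    show "E (S1 k) A \<in> null_sets M"
      by (rule null[OF _ t A]) (unfold S1_def, intro borel_measurable_add borel_measurable_times borel_measurable_const Mm)
    show "E (S2 k) ?A1 \<in> null_sets M"
      by (rule null[OF _ t A1]) (unfold S2_def, intro borel_measurable_times borel_measurable_const Mm)
    show "E (S3 k) ?A2 \<in> null_sets M"
      by (rule null[OF _ t A2]) (unfold S3_def, intro borel_measurable_times borel_measurable_const Mm)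
  next
    show "E S4 {0} \<in> null_sets M"
      by (rule null[of _ 0]) (use T in \<open>auto simp: S4_def[abs_def] intro!: borel_measurable_times X_adapted\<close>)
  qed
  moreover have "X T -` A \<inter> space M \<subseteq> N"
  proof
    fix \<omega> assume "\<omega> \<in> X T -` A \<inter> space M"
    then have XA: "X T \<omega> \<in> A" and \<omega>: "\<omega> \<in> space M" by auto
    note cont = X_cont[OF \<omega>]
    have cont': "continuous_on {0..} (\<lambda>t. - X t \<omega>)" using cont by (rule continuous_on_minus)
    have UT: "U T \<omega> = X T \<omega> - \<alpha> * ?M T \<omega> - \<beta> * ?m T \<omega>" by (simp add: U_def)
    have range: "?m T \<omega> \<le> X t \<omega>" "X t \<omega> \<le> ?M T \<omega>" if "0 \<le> t" "t \<le> T" for t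
      using run_max_upper[OF cont that] run_max_upper[OF cont' that] by (auto simp: run_min_uminus)
    have maxs: "\<exists>s. s < T \<and> (\<forall>r. s \<le> r \<longrightarrow> r \<le> T \<longrightarrow> ?M r \<omega> = ?M T \<omega>)" if "X T \<omega> \<noteq> ?M T \<omega>"
    proof -
      have "X T \<omega> < ?M T \<omega>" using that range[of T] T by simp
      then show ?thesis using run_max_eq_before[OF cont T] by metis
    qed
    have mins: "\<exists>s. s < T \<and> (\<forall>r. s \<le> r \<longrightarrow> r \<le> T \<longrightarrow> ?m r \<omega> = ?m T \<omega>)" if "X T \<omega> \<noteq> ?m T \<omega>"
    proof -
      have "- X T \<omega> < run_max (\<lambda>t. - X t \<omega>) T" using that range[of T] T by (simp add: run_min_uminus)
      then show ?thesis using run_max_eq_before[OF cont' T] unfolding run_min_uminus by metis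
    qed
    have late: "\<exists>k. s < tm T k" if "s < T" for s
      using order_tendstoD(1)[OF tm_lim that] unfolding eventually_sequentially by blast
    show "\<omega> \<in> N"
    proof (cases "X T \<omega> = ?M T \<omega>"; cases "X T \<omega> = ?m T \<omega>")
      assume a: "X T \<omega> \<noteq> ?M T \<omega>" "X T \<omega> \<noteq> ?m T \<omega>"
      obtain s s' where s: "s < T" "\<And>r. s \<le> r \<Longrightarrow> r \<le> T \<Longrightarrow> ?M r \<omega> = ?M T \<omega>"
        "s' < T" "\<And>r. s' \<le> r \<Longrightarrow> r \<le> T \<Longrightarrow> ?m r \<omega> = ?m T \<omega>"
        using maxs[OF a(1)] mins[OF a(2)] by blast
      obtain k where k: "max s s' < tm T k" using late[of "max s s'"] s(1,3) by auto
      have "?M (tm T k) \<omega> = ?M T \<omega>" "?m (tm T k) \<omega> = ?m T \<omega>"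
        using k tm_less[OF T, of k] by (auto intro!: s(2) s(4))
      then have "U T \<omega> + S1 k \<omega> = X T \<omega>" by (simp add: UT S1_def)
      then have "\<omega> \<in> E (S1 k) A" using XA \<omega> by (simp add: E_def)
      then show ?thesis unfolding N_def by blast
    next
      assume a: "X T \<omega> = ?M T \<omega>" "X T \<omega> \<noteq> ?m T \<omega>"
      obtain s where s: "s < T" "\<And>r. s \<le> r \<Longrightarrow> r \<le> T \<Longrightarrow> ?m r \<omega> = ?m T \<omega>"
        using mins[OF a(2)] by blast
      obtain k where k: "s < tm T k" using late[OF s(1)] by blast
      have "?m (tm T k) \<omega> = ?m T \<omega>" using k tm_less[OF T, of k] by (auto intro!: s(2))
      then have "U T \<omega> + S2 k \<omega> = (1 - \<alpha>) * X T \<omega>" using a(1) by (simp add: UT S2_def algebra_simps)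
      then have "1 / (1 - \<alpha>) * (U T \<omega> + S2 k \<omega>) = X T \<omega>" using \<alpha> by simp
      then have "\<omega> \<in> E (S2 k) ?A1" using XA \<omega> unfolding E_def by simp
      then show ?thesis unfolding N_def by blast
    next
      assume a: "X T \<omega> \<noteq> ?M T \<omega>" "X T \<omega> = ?m T \<omega>"
      obtain s where s: "s < T" "\<And>r. s \<le> r \<Longrightarrow> r \<le> T \<Longrightarrow> ?M r \<omega> = ?M T \<omega>"
        using maxs[OF a(1)] by blast
      obtain k where k: "s < tm T k" using late[OF s(1)] by blast
      have "?M (tm T k) \<omega> = ?M T \<omega>" using k tm_less[OF T, of k] by (auto intro!: s(2))
      then have "U T \<omega> + S3 k \<omega> = (1 - \<beta>) * X T \<omega>" using a(2) by (simp add: UT S3_def algebra_simps)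
      then have "1 / (1 - \<beta>) * (U T \<omega> + S3 k \<omega>) = X T \<omega>" using \<beta> by simp
      then have "\<omega> \<in> E (S3 k) ?A2" using XA \<omega> unfolding E_def by simp
      then show ?thesis unfolding N_def by blast
    next
      assume a: "X T \<omega> = ?M T \<omega>" "X T \<omega> = ?m T \<omega>"
      have "X 0 \<omega> = X T \<omega>" using range[of 0] T a by simp
      then have "U T \<omega> + S4 \<omega> = 0" using a by (simp add: UT S4_def algebra_simps)
      then have "\<omega> \<in> E S4 {0}" using \<omega> by (simp add: E_def)
      then show ?thesis unfolding N_def by blast
    qed
  qed
  ultimately have "prob (X T -` A \<inter> space M) \<le> prob N"
    by (intro finite_measure_mono) auto
  also have "prob N = 0" using \<open>N \<in> null_sets M\<close> by (rule measure_eq_0_null_sets)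
  finally show ?thesis by (simp add: measure_le_0_iff)
qed

theorem theorem4p1:
  fixes M :: "'a measure" and W X :: "real \<Rightarrow> 'a \<Rightarrow> real"
    and b \<sigma> :: "real \<Rightarrow> real" and \<alpha> \<beta> x :: real
  assumes "prob_space M" and "complete_measure M"
    and "brownian_motion M W"
    and "\<alpha> < 1" and "\<beta> < 1" and "\<bar>rho \<alpha> \<beta>\<bar> < 1"
    and "\<exists>L. L-lipschitz_on UNIV b" and "\<exists>L. L-lipschitz_on UNIV \<sigma>"
    and "\<forall>y. \<bar>\<sigma> y\<bar> > 0"
    and "\<forall>t\<ge>0. X t \<in> borel_measurable M"
    and "\<forall>t\<ge>0. X t \<in> borel_measurable (nat_filtration M W t)"
    and "\<forall>\<omega>\<in>space M. continuous_on {0..} (\<lambda>t. X t \<omega>)"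
    and "\<forall>t\<ge>0. is_ito_integral M W (\<lambda>s \<omega>. \<sigma> (X s \<omega>)) t
           (\<lambda>\<omega>. X t \<omega> - x - integral {0..t} (\<lambda>s. b (X s \<omega>))
                 - \<alpha> * (SUP s\<in>{0..t}. X s \<omega>) - \<beta> * (INF s\<in>{0..t}. X s \<omega>))"
  shows "\<forall>t>0. absolutely_continuous lborel (distr M lborel (X t))"
proof (intro allI impI)
  fix t :: real assume t: "t > 0"
  interpret prob_space M by fact
  interpret perturbed_diffusion M W X b \<sigma> \<alpha> \<beta> x
    by unfold_locales (use assms in \<open>auto simp: run_max_def run_min_def\<close>)
  have Xt: "X t \<in> measurable M lborel" using X_measurable[of t] t by simp
  show "absolutely_continuous lborel (distr M lborel (X t))"
    unfolding absolutely_continuous_def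
  proof
    fix A :: "real set" assume A: "A \<in> null_sets lborel"
    then have "A \<in> sets lborel" by auto
    then show "A \<in> null_sets (distr M lborel (X t))"
      using prob_X_null[OF t A] Xt by (simp add: null_sets_def emeasure_distr emeasure_eq_measure)
  qed
qed

end
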